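(* Let $n\ge1$, $\alpha\in(0,1]$, $\beta\in(0,n)$, $1\le p<n/\beta$ (with $\beta\notin\mathbb{N}$ when $p=1$) and $\gamma\in(-1,\infty)$. For $v_0\in\dot W^{\beta,p}(\mathbb{R}^n)$ let $v(t,x)=S_\alpha(t)v_0(x)$. Then the following two conditions hold: (a) $\displaystyle\left(\int_{\mathbb{R}^{1+n}_{+}}|v(t^{2\alpha},x)|^{\frac{p(1+n+\gamma)}{n-p\beta}}t^\gamma\,dt\,dx\right)^{\frac{n-p\beta}{p(1+n+\gamma)}}\lesssim\|v_0\|_{\dot W^{\beta,p}(\mathbb{R}^n)}$ for all $v_0\in\dot W^{\beta,p}(\mathbb{R}^n)$; (b) $\displaystyle\sup_{t>0}\left(\int_{\mathbb{R}^n}|v(t^{2\alpha},x)|^{\frac{pn}{n-p\beta}}dx\right)^{\frac{n-p\beta}{pn}}\lesssim\|v_0\|_{\dot W^{\beta,p}(\mathbb{R}^n)}$ for all $v_0\in\dot W^{\beta,p}(\mathbb{R}^n)$.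
   Context: $\mathbb{R}^{1+n}_{+}=(0,\infty)\times\mathbb{R}^n$. $U\lesssim V$ means $U\le\theta V$ for some constant $\theta>0$ independent of the functions or sets under consideration. $v(t,x)=S_\alpha(t)v_0(x):=(K^\alpha_t* v_0)(x)$ (convolution in the space variable), with $K^\alpha_t(x)=(2\pi)^{-n/2}\int_{\mathbb{R}^n}e^{ix\cdot\xi}e^{-t|\xi|^{2\alpha}}d\xi$; it solves $\partial_t v+(-\Delta)^\alpha v=0$ on $\mathbb{R}^{1+n}_{+}$, $v(0,\cdot)=v_0$. $\dot W^{\beta,p}(\mathbb{R}^n)$ is the completion of $C_0^\infty(\mathbb{R}^n)$ with respect to $\|f\|_{\dot W^{\beta,p}(\mathbb{R}^n)}=\|(-\Delta)^{\beta/2}f\|_{L^p}$ if $p\in(1,n/\beta)$, and $\|f\|_{\dot W^{\beta,p}(\mathbb{R}^n)}=\left(\int_{\mathbb{R}^n}\frac{\|\Delta_h^kf\|_{L^p}^p}{|h|^{n+p\beta}}dh\right)^{1/p}$ if $p=1$ and $\beta\in(0,n)\setminus\mathbb{N}$, where $k=1+[\beta]$ ($[\beta]$ the integer part), $\Delta_h^1f(x)=f(x+h)-f(x)$, $\Delta_h^kf=\Delta_h^1\Delta_h^{k-1}f$ for $k>1$. Here $(-\Delta)^{s}$ is the Fourier multiplier with symbol $|\xi|^{2s}$. *)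

theory Defs
  imports "HOL-Analysis.Analysis"
begin

text \<open>The space \<open>\<real>\<^sup>n\<close> is a type \<open>'a :: euclidean_space\<close> with \<open>n = DIM('a)\<close>. Functions are
  complex-valued. Norms take values in \<open>ennreal\<close>, so that a divergent integral is \<open>\<infinity>\<close>.\<close>

text \<open>Power of an extended nonnegative number, meant for an exponent \<open>r > 0\<close>.\<close>

definition epowr :: "ennreal \<Rightarrow> real \<Rightarrow> ennreal" where
  "epowr x r = (if x = \<infinity> then \<infinity> else ennreal (enn2real x powr r))"

definition Lp_norm :: "real \<Rightarrow> ('a::euclidean_space \<Rightarrow> complex) \<Rightarrow> ennreal" where
  "Lp_norm p f = epowr (\<integral>\<^sup>+x. ennreal (norm (f x) powr p) \<partial>lborel) (1 / p)"


subsection \<open>Fourier multipliers and the fractional heat semigroup\<close>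

definition fourier :: "('a::euclidean_space \<Rightarrow> complex) \<Rightarrow> 'a \<Rightarrow> complex" where
  "fourier f \<xi> = complex_of_real ((2 * pi) powr (- (real DIM('a) / 2))) *
     (LINT x|lborel. cis (- (x \<bullet> \<xi>)) * f x)"

definition inv_fourier :: "('a::euclidean_space \<Rightarrow> complex) \<Rightarrow> 'a \<Rightarrow> complex" where
  "inv_fourier g x = complex_of_real ((2 * pi) powr (- (real DIM('a) / 2))) *
     (LINT \<xi>|lborel. cis (x \<bullet> \<xi>) * g \<xi>)"

text \<open>\<open>(-\<Delta>)\<^sup>s\<close>, applied below only to test functions.\<close>

definition frac_laplacian :: "real \<Rightarrow> ('a::euclidean_space \<Rightarrow> complex) \<Rightarrow> 'a \<Rightarrow> complex" where
  "frac_laplacian s f = inv_fourier (\<lambda>\<xi>. complex_of_real (norm \<xi> powr (2 * s)) * fourier f \<xi>)"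

text \<open>The kernel carries the factor \<open>(2\<pi>)\<^bsup>-n/2\<^esup>\<close> of the unitary Fourier transform. With the
  convolution taken without a normalising factor, this makes the semigroup
  \<open>(2\<pi>)\<^bsup>n/2\<^esup>\<close> times the one that is the identity at \<open>t = 0\<close>.\<close>

definition heat_kernel :: "real \<Rightarrow> real \<Rightarrow> 'a::euclidean_space \<Rightarrow> complex" where
  "heat_kernel \<alpha> t = inv_fourier (\<lambda>\<xi>. complex_of_real (exp (- t * norm \<xi> powr (2 * \<alpha>))))"

definition heat_semigroup ::
    "real \<Rightarrow> real \<Rightarrow> ('a::euclidean_space \<Rightarrow> complex) \<Rightarrow> 'a \<Rightarrow> complex" where
  "heat_semigroup \<alpha> t f x = (LINT y|lborel. heat_kernel \<alpha> t (x - y) * f y)"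


subsection \<open>Test functions\<close>

fun Ck :: "nat \<Rightarrow> ('a::euclidean_space \<Rightarrow> complex) \<Rightarrow> bool" where
  "Ck 0 f \<longleftrightarrow> continuous_on UNIV f"
| "Ck (Suc k) f \<longleftrightarrow>
     (\<forall>x. f differentiable (at x)) \<and> (\<forall>v. Ck k (\<lambda>x. frechet_derivative f (at x) v))"

definition test_functions :: "('a::euclidean_space \<Rightarrow> complex) set" where
  "test_functions = {f. (\<forall>k. Ck k f) \<and> compact (closure {x. f x \<noteq> 0})}"


subsection \<open>The homogeneous Sobolev space\<close>

definition fdiff :: "'a \<Rightarrow> ('a::euclidean_space \<Rightarrow> complex) \<Rightarrow> 'a \<Rightarrow> complex" where
  "fdiff h f x = f (x + h) - f x"

definition sobolev_norm :: "real \<Rightarrow> real \<Rightarrow> ('a::euclidean_space \<Rightarrow> complex) \<Rightarrow> ennreal" where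
  "sobolev_norm \<beta> p f =
     (if p = 1
      then epowr (\<integral>\<^sup>+h. epowr (Lp_norm p ((fdiff h ^^ (1 + nat \<lfloor>\<beta>\<rfloor>)) f)) p
                        / ennreal (norm h powr (real DIM('a) + p * \<beta>)) \<partial>lborel) (1 / p)
      else Lp_norm p (frac_laplacian (\<beta> / 2) f))"

text \<open>The completion of the test functions: Cauchy sequences modulo sequences of norm tending
  to zero.\<close>

definition sobolev_Cauchy ::
    "real \<Rightarrow> real \<Rightarrow> (nat \<Rightarrow> 'a::euclidean_space \<Rightarrow> complex) set" where
  "sobolev_Cauchy \<beta> p =
     {\<phi>. (\<forall>k. \<phi> k \<in> test_functions) \<and>
         (\<forall>\<epsilon>>0. \<exists>N. \<forall>j\<ge>N. \<forall>k\<ge>N. sobolev_norm \<beta> p (\<lambda>x. \<phi> j x - \<phi> k x) < ennreal \<epsilon>)}"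

definition sobolev_rel ::
    "real \<Rightarrow> real \<Rightarrow> ((nat \<Rightarrow> 'a::euclidean_space \<Rightarrow> complex) \<times> (nat \<Rightarrow> 'a \<Rightarrow> complex)) set" where
  "sobolev_rel \<beta> p =
     {(\<phi>, \<psi>). \<phi> \<in> sobolev_Cauchy \<beta> p \<and> \<psi> \<in> sobolev_Cauchy \<beta> p \<and>
              (\<lambda>k. sobolev_norm \<beta> p (\<lambda>x. \<phi> k x - \<psi> k x)) \<longlonglongrightarrow> 0}"

definition sobolev_space ::
    "real \<Rightarrow> real \<Rightarrow> (nat \<Rightarrow> 'a::euclidean_space \<Rightarrow> complex) set set" where
  "sobolev_space \<beta> p = sobolev_Cauchy \<beta> p // sobolev_rel \<beta> p"

definition sobolev_space_norm ::
    "real \<Rightarrow> real \<Rightarrow> (nat \<Rightarrow> 'a::euclidean_space \<Rightarrow> complex) set \<Rightarrow> ennreal" where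
  "sobolev_space_norm \<beta> p V = (THE L. \<forall>\<phi>\<in>V. (\<lambda>k. sobolev_norm \<beta> p (\<phi> k)) \<longlonglongrightarrow> L)"

text \<open>An element of the completion is identified with the function that is the local \<open>L\<^sup>1\<close> limit of
  its representatives; this function is determined up to a null set. That it exists for
  \<open>p < n/\<beta>\<close> follows from the Sobolev embedding and is not assumed here: without it,
  \<open>sobolev_fun\<close> would be unspecified.\<close>

definition represents ::
    "('a::euclidean_space \<Rightarrow> complex) \<Rightarrow> (nat \<Rightarrow> 'a \<Rightarrow> complex) set \<Rightarrow> bool" where
  "represents f V \<longleftrightarrow>
     f \<in> borel_measurable borel \<and>
     (\<forall>K. compact K \<longrightarrow> set_integrable lborel K f) \<and>
     (\<forall>\<phi>\<in>V. \<forall>K. compact K \<longrightarrow> (\<lambda>k. \<integral>\<^sup>+x\<in>K. ennreal (norm (\<phi> k x - f x)) \<partial>lborel) \<longlonglongrightarrow> 0)"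

definition sobolev_fun ::
    "(nat \<Rightarrow> 'a::euclidean_space \<Rightarrow> complex) set \<Rightarrow> 'a \<Rightarrow> complex" where
  "sobolev_fun V = (SOME f. represents f V)"

end

(* With q = pn/(n - p beta), the Sobolev embedding bounds the L^q norm of v_0 by its homogeneous
   Sobolev norm, so both claims reduce to estimates on L^q for convolutions with the dilates
   k_t(x) = t^(-n) k(x/t) of one bounded integrable kernel k.  Claim (b) is the L^q bound for such
   convolutions.  For claim (a) let s = (1 + n + gamma)/n: the maps g |-> (t,x) |-> (k_t * g)(x) are
   bounded from L^1 to weak L^s and from L^infinity to L^infinity for the measure t^gamma dt dx, and
   Marcinkiewicz interpolation gives L^q to L^(qs).  No decay of k is needed; integrability of the
   fractional heat kernel follows from its positivity, which comes from writing its symbol as a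
   limit of mixtures of Gaussians.

   For p > 1 the embedding follows from f = c * integral of s^(beta-1) G_s * (-Laplacian)^(beta/2) f ds
   with Gaussians G_s, and the same interpolation argument.  For p = 1, f differs from an average of
   its translates by at most S by an average of k-th differences; at the level l, S is chosen such
   that the average of the translates is at most l/2, and integrating over l yields
   |f|_q^q <= C |f|_q^(q-1) [f], where |f|_q is finite for test functions. *)

theory Submission
  imports Defs "HOL-Probability.Probability"
begin

subsection \<open>Powers of extended nonnegative numbers and the layer cake formula\<close>

text \<open>\<open>sobolev_fun\<close> is a choice by \<open>SOME\<close>, about which nothing is
  known until some representing function has been constructed. The embedding on test functions is
  therefore used twice: it makes a Cauchy sequence of the completion convergent in a
  Gaussian-weighted L^1 space, and, through Fatou's lemma, it bounds the L^q norm of the limit. All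
  estimates of convolutions are made for nonnegative functions with values in [0, \<infinity>]. No
  convolution then has to be shown to converge: a Bochner integral is dominated by the integral of
  the norm also where it diverges and has the default value 0. Evaluating v at t^(2\<alpha>) makes t
  the dilation parameter, so that \<alpha> enters only through the kernel at time 1. That kernel has
  a nonsmooth symbol for \<alpha> < 1, hence no cheap decay; its positivity replaces decay, because
  the integral of a nonnegative function against wide Gaussians can be read off from its Fourier
  transform. The factor (2\<pi>)^(n/2) by which the semigroup differs from the usual one only
  changes constants.\<close>

lemma epowr_ennreal: "0 \<le> a \<Longrightarrow> epowr (ennreal a) r = ennreal (a powr r)"
  by (simp add: epowr_def)

lemma epowr_top [simp]: "epowr top r = top"
  by (simp add: epowr_def)

lemma epowr_0 [simp]: "epowr 0 r = 0"
  by (simp add: epowr_def)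

lemma epowr_mono: "x \<le> y \<Longrightarrow> 0 \<le> r \<Longrightarrow> epowr x r \<le> epowr y r"
  by (cases x; cases y) (auto simp: epowr_ennreal top_unique intro!: ennreal_leI powr_mono2)

lemma epowr_mult: "epowr (x * y) r = epowr x r * epowr y r"
proof (cases "x = 0 \<or> y = 0")
  case False
  then show ?thesis
    by (cases x; cases y)
       (auto simp: epowr_ennreal powr_mult ennreal_mult[symmetric] ennreal_mult_top ennreal_top_mult)
qed auto

lemma epowr_epowr: "epowr (epowr x a) b = epowr x (a * b)"
  by (cases x) (auto simp: epowr_ennreal powr_powr)

lemma epowr_1 [simp]: "epowr x 1 = x"
  by (cases x) (auto simp: epowr_ennreal)

text \<open>Valid for exponents of any sign: at 0 both sides are 0, because
  \<open>0 powr a = 0\<close> for every \<open>a\<close>, and at \<infinity> both sides are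
  \<infinity>.\<close>

lemma epowr_add: "epowr x (a + b) = epowr x a * epowr x b"
  by (cases x) (auto simp: epowr_ennreal powr_add ennreal_mult[symmetric])

lemma epowr_eq_0_iff [simp]: "epowr x r = 0 \<longleftrightarrow> x = 0"
  by (cases x) (auto simp: epowr_ennreal)

lemma epowr_eq_top_iff [simp]: "epowr x r = top \<longleftrightarrow> x = top"
  by (cases x) (auto simp: epowr_ennreal)

lemma epowr_measurable [measurable]:
  assumes [measurable]: "f \<in> borel_measurable M"
  shows "(\<lambda>x. epowr (f x) r) \<in> borel_measurable M"
  unfolding epowr_def by measurable

text \<open>Integrating this bound and optimising over \<open>\<tau>\<close> replaces Hoelder's inequality throughout.\<close>

lemma le_split_power:
  fixes g :: ennreal and \<tau> p :: real
  assumes "0 < \<tau>" "1 \<le> p"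
  shows "g \<le> ennreal \<tau> + ennreal (\<tau> powr (1 - p)) * epowr g p"
proof (cases g)
  case (real r)
  show ?thesis
  proof (cases "r \<le> \<tau>")
    case True
    then show ?thesis using real by (simp add: add_increasing2 ennreal_leI)
  next
    case False
    \<comment> \<open>Above the threshold the factor (r/\<tau>)^(p-1), which is at least 1, is
      inserted.\<close>
    have "r = \<tau> powr (1 - p) * (\<tau> powr (p - 1) * r)"
      using assms by (simp add: mult.assoc[symmetric] powr_add[symmetric])
    also have "\<dots> \<le> \<tau> powr (1 - p) * (r powr (p - 1) * r)"
      using False assms by (intro mult_left_mono mult_right_mono powr_mono2) auto
    also have "r powr (p - 1) * r = r powr p"
      using False assms by (simp add: powr_diff)
    finally show ?thesis using real
      by (simp add: epowr_ennreal ennreal_mult[symmetric] add_increasing ennreal_leI)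
  qed
qed (use assms in \<open>simp add: ennreal_mult_top\<close>)

text \<open>The choice \<tau> = W^(1/q) turns both terms into multiples of W^(1/q). For W = 0 there
  is no optimal \<tau>, and \<tau> is made arbitrarily small instead. When W is an integral of a
  q-th power, the conclusion is Hoelder's inequality against a finite measure, up to the
  constant.\<close>

lemma le_epowr_optimize:
  fixes X W :: ennreal and a b q :: real
  assumes X: "\<And>\<tau>. 0 < \<tau> \<Longrightarrow> X \<le> ennreal (a * \<tau>) + ennreal (b * \<tau> powr (1 - q)) * W"
    and "0 \<le> a" "0 < b" "1 \<le> q"
  shows "X \<le> ennreal (a + b) * epowr W (1 / q)"
proof (cases W)
  case (real w)
  consider "w = 0" | "w > 0" using real by force
  then show ?thesis
  proof cases
    case 1
    have "X \<le> 0"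
    proof (rule ennreal_le_epsilon)
      fix e :: real assume "0 < e"
      \<comment> \<open>The summand 1 in the denominator covers \<open>a = 0\<close>.\<close>
      then have "X \<le> ennreal (a * (e / (a + 1)))" using X[of "e / (a + 1)"] real 1 assms by simp
      also have "\<dots> \<le> ennreal e" using \<open>0 < e\<close> assms by (intro ennreal_leI) (simp add: field_simps)
      finally show "X \<le> 0 + ennreal e" by simp
    qed
    then show ?thesis by simp
  next
    case 2
    define \<tau> where "\<tau> = w powr (1 / q)"
    have \<tau>: "\<tau> > 0" using 2 by (simp add: \<tau>_def)
    have "\<tau> powr (1 - q) * w = \<tau>"
    proof -
      have "w = \<tau> powr q" using 2 assms by (simp add: \<tau>_def powr_powr)
      then show ?thesis using \<tau> by (simp add: powr_add[symmetric])
    qed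
    then have "b * \<tau> powr (1 - q) * w = b * \<tau>" by (simp add: mult.assoc)
    then have "ennreal (b * \<tau> powr (1 - q)) * W = ennreal (b * \<tau>)"
      unfolding real(2) by (subst ennreal_mult''[OF real(1), symmetric]) (simp only:)
    then have "X \<le> ennreal (a * \<tau>) + ennreal (b * \<tau>)"
      using X[OF \<tau>] by simp
    also have "\<dots> = ennreal (a + b) * ennreal \<tau>"
      using \<tau> assms by (simp add: ennreal_mult[symmetric] ring_distribs ennreal_plus[symmetric] del: ennreal_plus)
    finally show ?thesis using real by (simp add: epowr_ennreal \<tau>_def)
  qed
next
  case top
  then show ?thesis using assms by (simp add: ennreal_mult_top)
qed

text \<open>This is the inner integral of the layer cake formula. The bound \<open>u\<close> may be
  \<infinity>, since averages of unbounded functions may be infinite; in that case the integral is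
  compared with those over finite intervals, which exceed every natural number.\<close>

lemma nn_integral_powr_less:
  assumes "-1 < e"
  shows "(\<integral>\<^sup>+l. ennreal (l powr e) * indicator {l. 0 < l \<and> ennreal l < u} l \<partial>lborel)
         = ennreal (1 / (e + 1)) * epowr u (e + 1)"
proof -
  have *: "(\<integral>\<^sup>+l. ennreal (l powr e) * indicator {0..c} l \<partial>lborel) = ennreal (c powr (e + 1) / (e + 1))"
    if "0 \<le> c" for c :: real
    by (rule nn_integral_has_integral_lebesgue'[OF _ has_integral_powr_from_0]) (use that assms in auto)
  have fin: "(\<integral>\<^sup>+l. ennreal (l powr e) * indicator {l. 0 < l \<and> ennreal l < ennreal c} l \<partial>lborel)
      = ennreal (c powr (e + 1) / (e + 1))" if "0 \<le> c" for c :: real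
  proof -
    have "AE l in lborel. l \<noteq> 0 \<and> l \<noteq> c" using AE_lborel_singleton[of 0] AE_lborel_singleton[of c] by eventually_elim simp
    then have "AE l in lborel. ennreal (l powr e) * indicator {l. 0 < l \<and> ennreal l < ennreal c} l
        = ennreal (l powr e) * indicator {0..c} l"
      by eventually_elim (use that in \<open>auto simp: indicator_def ennreal_less_iff\<close>)
    then show ?thesis using *[OF that] nn_integral_cong_AE by metis
  qed
  show ?thesis
  proof (cases u)
    case (real c)
    then show ?thesis using fin[of c] assms by (simp add: epowr_ennreal ennreal_mult[symmetric])
  next
    case top
    have "(\<integral>\<^sup>+l. ennreal (l powr e) * indicator {l. 0 < l \<and> ennreal l < u} l \<partial>lborel) \<ge> of_nat N" for N :: nat
    proof -
      \<comment> \<open>Solves c^(e+1) / (e+1) = N.\<close>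
      define c where "c = ((e + 1) * real N) powr (1 / (e + 1))"
      have "ennreal (c powr (e + 1) / (e + 1)) = of_nat N"
        using assms unfolding c_def by (cases "N = 0") (simp_all add: powr_powr ennreal_of_nat_eq_real_of_nat)
      then have "of_nat N = (\<integral>\<^sup>+l. ennreal (l powr e) * indicator {l. 0 < l \<and> ennreal l < ennreal c} l \<partial>lborel)"
        using fin[of c] by (simp add: c_def)
      also have "\<dots> \<le> (\<integral>\<^sup>+l. ennreal (l powr e) * indicator {l. 0 < l \<and> ennreal l < u} l \<partial>lborel)"
        using top by (intro nn_integral_mono) (auto simp: indicator_def)
      finally show ?thesis .
    qed
    then have "(\<integral>\<^sup>+l. ennreal (l powr e) * indicator {l. 0 < l \<and> ennreal l < u} l \<partial>lborel) = top"
      by (rule_tac ccontr, drule_tac ennreal_Ex_less_of_nat[OF iffD1[OF less_top]]) (auto dest: leD)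
    then show ?thesis using top assms by (simp add: ennreal_mult_top)
  qed
qed

lemma nn_integral_powr_less':
  assumes "-1 < e"
  shows "(\<integral>\<^sup>+t. ennreal (t powr e) * indicator {0<..<T} t \<partial>lborel) = ennreal ((max 0 T) powr (e + 1) / (e + 1))"
proof -
  have "{l. 0 < l \<and> ennreal l < ennreal T} = {0<..<T}" by (auto simp: ennreal_less_iff)
  then show ?thesis
    using nn_integral_powr_less[OF assms, of "ennreal T"] assms
    by (cases "0 \<le> T") (auto simp: epowr_ennreal ennreal_mult[symmetric] max_def ennreal_neg)
qed

lemma nn_integral_powr_ge:
  assumes "e < -1" "0 < a"
  shows "(\<integral>\<^sup>+t. ennreal (t powr e) * indicator {a..} t \<partial>lborel) = ennreal (a powr (e + 1) / (- e - 1))"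
proof -
  have "-(a powr (e + 1)) / (e + 1) = a powr (e + 1) / (- e - 1)" using assms by (simp add: field_simps)
  then show ?thesis
    using nn_integral_has_integral_lebesgue'[OF _ has_integral_powr_to_inf[OF assms]] by simp
qed

lemma (in sigma_finite_measure) nn_integral_layer_cake:
  assumes [measurable]: "U \<in> borel_measurable M" and "0 < q"
  shows "(\<integral>\<^sup>+x. epowr (U x) q \<partial>M) =
    (\<integral>\<^sup>+l. ennreal (q * l powr (q - 1)) * indicator {0<..} l * emeasure M {x\<in>space M. ennreal l < U x} \<partial>lborel)"
proof -
  interpret p: pair_sigma_finite lborel M ..
  have "(\<integral>\<^sup>+x. epowr (U x) q \<partial>M) =
    (\<integral>\<^sup>+x. (\<integral>\<^sup>+l. ennreal q * (ennreal (l powr (q - 1)) * indicator {l. 0 < l \<and> ennreal l < U x} l) \<partial>lborel) \<partial>M)"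
  proof (intro nn_integral_cong)
    fix x assume "x \<in> space M"
    show "epowr (U x) q = (\<integral>\<^sup>+l. ennreal q * (ennreal (l powr (q - 1)) * indicator {l. 0 < l \<and> ennreal l < U x} l) \<partial>lborel)"
      (is "_ = ?R")
    proof -
      have "?R = ennreal q * (\<integral>\<^sup>+l. ennreal (l powr (q - 1)) * indicator {l. 0 < l \<and> ennreal l < U x} l \<partial>lborel)"
        by (rule nn_integral_cmult) measurable
      also have "\<dots> = ennreal q * (ennreal (1 / q) * epowr (U x) q)"
        using assms by (subst nn_integral_powr_less) auto
      also have "\<dots> = ennreal (q * (1 / q)) * epowr (U x) q"
        using assms by (subst ennreal_mult) (auto simp: mult.assoc)
      finally show ?thesis using assms by simp
    qed
  qed
  also have "\<dots> = (\<integral>\<^sup>+x. (\<integral>\<^sup>+l. ennreal (q * l powr (q - 1)) * indicator {0<..} l * indicator {x\<in>space M. ennreal l < U x} x \<partial>lborel) \<partial>M)"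
    using assms by (intro nn_integral_cong) (auto simp: ennreal_mult indicator_def)
  also have "\<dots> = (\<integral>\<^sup>+l. (\<integral>\<^sup>+x. ennreal (q * l powr (q - 1)) * indicator {0<..} l * indicator {x\<in>space M. ennreal l < U x} x \<partial>M) \<partial>lborel)"
    by (rule p.Fubini') measurable
  also have "\<dots> = (\<integral>\<^sup>+l. ennreal (q * l powr (q - 1)) * indicator {0<..} l * emeasure M {x\<in>space M. ennreal l < U x} \<partial>lborel)"
    by (intro nn_integral_cong) (simp add: nn_integral_cmult)
  finally show ?thesis .
qed

text \<open>Reduces an estimate to the case of norm 1. \<open>F\<close> stands for the integral of
  g^p and \<open>X\<close> for a quantity of degree q in g, so that scaling g by c multiplies them
  by c^p and c^q; take c = F^(-1/p). If F = 0 every c is admissible, and letting c grow forces X =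
  0.\<close>

lemma homogeneous_epowr_bound:
  fixes X F :: ennreal and p q C :: real
  assumes X: "\<And>c. 0 < c \<Longrightarrow> ennreal (c powr p) * F \<le> 1 \<Longrightarrow> ennreal (c powr q) * X \<le> ennreal C"
    and "0 < p" "0 < q" "0 < C"
  shows "X \<le> ennreal C * epowr F (q / p)"
proof (cases F)
  case (real f)
  consider "f = 0" | "f > 0" using real by force
  then show ?thesis
  proof cases
    case 1
    have "X \<le> 0"
    proof (rule ennreal_le_epsilon)
      fix e :: real assume "0 < e"
      \<comment> \<open>With this c the bound c^q X \<le> C reads X \<le> e.\<close>
      define c where "c = (C / e) powr (1 / q)"
      have c: "c > 0" "c powr q = C / e" using \<open>0 < e\<close> assms by (auto simp: c_def powr_powr)
      then have "ennreal (C / e) * X \<le> ennreal C" using X[of c] real 1 by simp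
      then have "ennreal (e / C) * (ennreal (C / e) * X) \<le> ennreal (e / C) * ennreal C" by (rule mult_left_mono) simp
      then show "X \<le> 0 + ennreal e" using \<open>0 < e\<close> assms by (simp add: mult.assoc[symmetric] ennreal_mult[symmetric])
    qed
    then show ?thesis by simp
  next
    case 2
    define c where "c = f powr (- 1 / p)"
    have "c powr p = f powr (-1)" "c powr q = f powr (- (q / p))"
      unfolding c_def powr_powr using assms by (simp_all add: field_simps)
    then have c: "c > 0" "c powr p = 1 / f" "c powr q = f powr (- (q / p))"
      using 2 by (simp_all add: c_def powr_minus_divide del: minus_divide_left)
    have "ennreal (c powr q) * X \<le> ennreal C"
      using X[of c] real 2 c by (simp add: ennreal_mult[symmetric])
    then have "ennreal (f powr (q / p)) * (ennreal (c powr q) * X) \<le> ennreal (f powr (q / p)) * ennreal C"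
      by (rule mult_left_mono) simp
    then have "ennreal (f powr (q / p) * c powr q) * X \<le> epowr F (q / p) * ennreal C"
      unfolding real(2) by (simp add: epowr_ennreal[OF real(1)] mult.assoc ennreal_mult)
    moreover have "f powr (q / p) * c powr q = 1" using 2 c(3) by (simp add: powr_add[symmetric])
    ultimately show ?thesis by (simp add: mult.commute)
  qed
qed (use assms in \<open>simp add: ennreal_mult_top\<close>)

subsection \<open>Averages over the dilates of a bounded kernel\<close>

lemma nn_integral_lborel_affine:
  fixes f :: "'a::euclidean_space \<Rightarrow> ennreal"
  assumes [measurable]: "f \<in> borel_measurable borel" and c: "c \<noteq> 0"
  shows "(\<integral>\<^sup>+x. f x \<partial>lborel) = ennreal (\<bar>c\<bar> ^ DIM('a)) * (\<integral>\<^sup>+x. f (t + c *\<^sub>R x) \<partial>lborel)"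
  by (subst lborel_affine[OF c, of t]) (simp add: nn_integral_density nn_integral_distr nn_integral_cmult)

text \<open>The closing step of both Marcinkiewicz arguments, where the tail of g above the
  truncation level c l^m is integrated over the levels l. After exchanging the integrals, the
  admissible l for a point y fill the interval from 0 to (g(y)/c)^(1/m), and g(y) times the power
  integral over it is a single power of g(y). For the averages m is 1; for Riesz potentials the
  truncation level is not proportional to l.\<close>

lemma nn_integral_tail_powr:
  fixes g :: "'a::euclidean_space \<Rightarrow> ennreal" and c m e :: real
  assumes [measurable]: "g \<in> borel_measurable borel" and "0 < c" "0 < m" "-1 < e"
  shows "(\<integral>\<^sup>+l. ennreal (l powr e) * indicator {0<..} l *
            (\<integral>\<^sup>+y. g y * indicator {y. ennreal (c * l powr m) < g y} y \<partial>lborel) \<partial>lborel)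
    = ennreal (c powr (- ((e + 1) / m)) / (e + 1)) * (\<integral>\<^sup>+y. epowr (g y) (1 + (e + 1) / m) \<partial>lborel)"
proof -
  have set_eq: "{l. 0 < l \<and> ennreal (c * l powr m) < u} = {l. 0 < l \<and> ennreal l < epowr (ennreal (1 / c) * u) (1 / m)}" for u
  proof (cases u)
    case (real r)
    have "c * l powr m < r \<longleftrightarrow> l < (r / c) powr (1 / m)" if "0 < l" for l
    proof -
      have "c * l powr m < r \<longleftrightarrow> l powr m < r / c" using \<open>0 < c\<close> by (simp add: field_simps)
      also have "\<dots> \<longleftrightarrow> l powr m < ((r / c) powr (1 / m)) powr m"
        using assms real by (cases "r = 0") (auto simp: powr_powr)
      also have "\<dots> \<longleftrightarrow> l < (r / c) powr (1 / m)"
        using that \<open>0 < m\<close> by (meson less_imp_le linorder_not_le powr_ge_zero powr_less_mono2 powr_mono2)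
      finally show ?thesis .
    qed
    moreover have "epowr (ennreal (1 / c) * u) (1 / m) = ennreal ((r / c) powr (1 / m))"
      using real assms by (simp add: ennreal_mult[symmetric] epowr_ennreal)
    ultimately show ?thesis using real assms by (auto simp: ennreal_less_iff)
  qed (use assms in \<open>simp add: ennreal_mult_top\<close>)
  have "(\<integral>\<^sup>+l. ennreal (l powr e) * indicator {0<..} l *
            (\<integral>\<^sup>+y. g y * indicator {y. ennreal (c * l powr m) < g y} y \<partial>lborel) \<partial>lborel)
    = (\<integral>\<^sup>+l. (\<integral>\<^sup>+y. ennreal (l powr e) * indicator {0<..} l * (g y * indicator {y. ennreal (c * l powr m) < g y} y) \<partial>lborel) \<partial>lborel)"
    by (intro nn_integral_cong nn_integral_cmult[symmetric]) measurable
  also have "\<dots> = (\<integral>\<^sup>+y. (\<integral>\<^sup>+l. ennreal (l powr e) * indicator {0<..} l * (g y * indicator {y. ennreal (c * l powr m) < g y} y) \<partial>lborel) \<partial>lborel)"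
    by (rule lborel_pair.Fubini'[symmetric]) measurable
  also have "\<dots> = (\<integral>\<^sup>+y. (\<integral>\<^sup>+l. g y * (ennreal (l powr e) * indicator {l. 0 < l \<and> ennreal l < epowr (ennreal (1 / c) * g y) (1 / m)} l) \<partial>lborel) \<partial>lborel)"
    unfolding set_eq[symmetric] by (intro nn_integral_cong) (auto simp: indicator_def mult.commute)
  also have "\<dots> = (\<integral>\<^sup>+y. g y * (\<integral>\<^sup>+l. (ennreal (l powr e) * indicator {l. 0 < l \<and> ennreal l < epowr (ennreal (1 / c) * g y) (1 / m)} l) \<partial>lborel) \<partial>lborel)"
    by (intro nn_integral_cong nn_integral_cmult) measurable
  also have "\<dots> = (\<integral>\<^sup>+y. ennreal (c powr (- ((e + 1) / m)) / (e + 1)) * epowr (g y) (1 + (e + 1) / m) \<partial>lborel)"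
  proof (intro nn_integral_cong)
    fix y
    have "epowr (ennreal (1 / c) * g y) ((e + 1) / m) = ennreal (c powr (- ((e + 1) / m))) * epowr (g y) ((e + 1) / m)"
      using \<open>0 < c\<close> by (simp add: epowr_mult epowr_ennreal powr_divide powr_minus_divide[symmetric])
    then show "g y * (\<integral>\<^sup>+l. (ennreal (l powr e) * indicator {l. 0 < l \<and> ennreal l < epowr (ennreal (1 / c) * g y) (1 / m)} l) \<partial>lborel)
      = ennreal (c powr (- ((e + 1) / m)) / (e + 1)) * epowr (g y) (1 + (e + 1) / m)"
      unfolding nn_integral_powr_less[OF \<open>-1 < e\<close>] epowr_epowr
      using assms by (simp add: epowr_add divide_inverse ennreal_mult mult_ac)
  qed
  also have "\<dots> = ennreal (c powr (- ((e + 1) / m)) / (e + 1)) * (\<integral>\<^sup>+y. epowr (g y) (1 + (e + 1) / m) \<partial>lborel)"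
    by (rule nn_integral_cmult) measurable
  finally show ?thesis .
qed

lemma ennreal_mult3:
  "0 \<le> a \<Longrightarrow> 0 \<le> b \<Longrightarrow> 0 \<le> c \<Longrightarrow> ennreal a * ennreal b * ennreal c = ennreal (a * b * c)"
  by (simp add: ennreal_mult)

lemma le_split_level:
  fixes g :: ennreal shows "g \<le> ennreal \<tau> + g * indicator {g. ennreal \<tau> < g} g"
  by (cases "ennreal \<tau> < g") (auto simp: indicator_def)

text \<open>Half of the level is reserved for the bounded part of U, so a point with U > l has V
  \<ge> l/2, and Markov's inequality for V applies.\<close>

lemma emeasure_level_bound:
  fixes U V :: "'a::euclidean_space \<Rightarrow> ennreal"
  assumes [measurable]: "V \<in> borel_measurable borel" and l: "0 < l"
    and U: "\<And>x. U x \<le> ennreal (l / 2) + V x"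
  shows "emeasure lborel {x\<in>space lborel. ennreal l < U x} \<le> ennreal (2 / l) * (\<integral>\<^sup>+x. V x \<partial>lborel)"
proof -
  have "{x\<in>space lborel. ennreal l < U x} \<subseteq> {x\<in>space lborel. 1 \<le> ennreal (2 / l) * V x}"
  proof safe
    fix x assume "ennreal l < U x"
    then have "ennreal l < ennreal (l / 2) + V x" using U[of x] by simp
    then have "ennreal (l / 2) \<le> V x"
    proof (cases "V x")
      case (real v)
      have "ennreal l < ennreal (l / 2 + v)"
        using \<open>ennreal l < ennreal (l / 2) + V x\<close> real l by simp
      then have "l < l / 2 + v" using l by (subst (asm) ennreal_less_iff) auto
      then show ?thesis using real l by (simp add: ennreal_leI)
    qed simp
    from mult_left_mono[OF this, of "ennreal (2 / l)"] l
    show "1 \<le> ennreal (2 / l) * V x" by (simp add: ennreal_mult[symmetric])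
  qed
  then have "emeasure lborel {x\<in>space lborel. ennreal l < U x} \<le> emeasure lborel {x\<in>space lborel. 1 \<le> ennreal (2 / l) * V x}"
    by (intro emeasure_mono) auto
  also have "\<dots> \<le> ennreal (2 / l) * (\<integral>\<^sup>+x. V x \<partial>lborel)"
    using nn_integral_Markov_inequality[of V UNIV lborel "ennreal (2 / l)"] by simp
  finally show ?thesis .
qed

text \<open>It is instantiated by the modulus of the heat kernel at time 1 and by a Gaussian, so
  that the heat semigroup and the Riesz potential share their estimates. \<open>A\<close> and
  \<open>B\<close> are upper bounds rather than exact values; they are kept positive so that levels
  can be divided by \<open>A\<close> and powers of \<open>B\<close> stay positive.\<close>

locale bounded_kernel =
  fixes k :: "'a::euclidean_space \<Rightarrow> real" and A B :: real
  assumes k_measurable [measurable]: "k \<in> borel_measurable borel"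
    and k_nonneg: "0 \<le> k x" and k_le: "k x \<le> B"
    and k_mass: "(\<integral>\<^sup>+x. ennreal (k x) \<partial>lborel) \<le> ennreal A"
    and A_pos: "0 < A" and B_pos: "0 < B"
begin

definition avg :: "real \<Rightarrow> ('a \<Rightarrow> ennreal) \<Rightarrow> 'a \<Rightarrow> ennreal" where
  "avg s g x = (\<integral>\<^sup>+y. ennreal (k ((x - y) /\<^sub>R s) / s ^ DIM('a)) * g y \<partial>lborel)"

lemma avg_measurable [measurable]:
  assumes [measurable]: "g \<in> borel_measurable borel" "f \<in> borel_measurable M" "h \<in> borel_measurable M"
  shows "(\<lambda>z. avg (f z) g (h z)) \<in> borel_measurable M"
  unfolding avg_def by measurable

lemma avg_mono: "(\<And>y. g y \<le> h y) \<Longrightarrow> avg s g x \<le> avg s h x"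
  unfolding avg_def by (intro nn_integral_mono mult_left_mono) auto

lemma avg_add:
  assumes [measurable]: "g \<in> borel_measurable borel" "h \<in> borel_measurable borel"
  shows "avg s (\<lambda>y. g y + h y) x = avg s g x + avg s h x"
  unfolding avg_def by (simp add: distrib_left nn_integral_add)

lemma avg_cmult:
  assumes [measurable]: "g \<in> borel_measurable borel"
  shows "avg s (\<lambda>y. c * g y) x = c * avg s g x"
  unfolding avg_def by (simp add: mult.left_commute[of _ c] nn_integral_cmult)

lemma kernel_mass:
  assumes "0 < s"
  shows "(\<integral>\<^sup>+y. ennreal (k ((x - y) /\<^sub>R s) / s ^ DIM('a)) \<partial>lborel) \<le> ennreal A"
    and "(\<integral>\<^sup>+x. ennreal (k ((x - y) /\<^sub>R s) / s ^ DIM('a)) \<partial>lborel) \<le> ennreal A"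
proof -
  have *: "ennreal (s ^ DIM('a)) * (ennreal (k z / s ^ DIM('a))) = ennreal (k z)" for z
    using assms k_nonneg by (simp add: ennreal_mult[symmetric])
  have "(\<integral>\<^sup>+y. ennreal (k ((x - y) /\<^sub>R s) / s ^ DIM('a)) \<partial>lborel) = (\<integral>\<^sup>+x. ennreal (k x) \<partial>lborel)"
    using assms
    by (subst nn_integral_lborel_affine[of _ "- s" x]) (simp_all add: nn_integral_cmult[symmetric] *)
  then show "(\<integral>\<^sup>+y. ennreal (k ((x - y) /\<^sub>R s) / s ^ DIM('a)) \<partial>lborel) \<le> ennreal A"
    using k_mass by simp
  have "(\<integral>\<^sup>+x. ennreal (k ((x - y) /\<^sub>R s) / s ^ DIM('a)) \<partial>lborel) = (\<integral>\<^sup>+x. ennreal (k x) \<partial>lborel)"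
    using assms
    by (subst nn_integral_lborel_affine[of _ s y]) (simp_all add: nn_integral_cmult[symmetric] *)
  then show "(\<integral>\<^sup>+x. ennreal (k ((x - y) /\<^sub>R s) / s ^ DIM('a)) \<partial>lborel) \<le> ennreal A"
    using k_mass by simp
qed

lemma avg_const: "0 < s \<Longrightarrow> avg s (\<lambda>_. c) x \<le> ennreal A * c"
  unfolding avg_def using kernel_mass(1)[of s x] by (simp add: nn_integral_multc mult_right_mono)

lemma nn_integral_avg:
  assumes [measurable]: "g \<in> borel_measurable borel" and "0 < s"
  shows "(\<integral>\<^sup>+x. avg s g x \<partial>lborel) \<le> ennreal A * (\<integral>\<^sup>+y. g y \<partial>lborel)"
proof -
  have "(\<integral>\<^sup>+x. avg s g x \<partial>lborel) = (\<integral>\<^sup>+y. (\<integral>\<^sup>+x. ennreal (k ((x - y) /\<^sub>R s) / s ^ DIM('a)) * g y \<partial>lborel) \<partial>lborel)"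
    unfolding avg_def by (rule lborel_pair.Fubini') measurable
  also have "\<dots> = (\<integral>\<^sup>+y. (\<integral>\<^sup>+x. ennreal (k ((x - y) /\<^sub>R s) / s ^ DIM('a)) \<partial>lborel) * g y \<partial>lborel)"
    by (intro nn_integral_cong nn_integral_multc) measurable
  also have "\<dots> \<le> (\<integral>\<^sup>+y. ennreal A * g y \<partial>lborel)"
    using assms by (intro nn_integral_mono mult_right_mono kernel_mass) auto
  also have "\<dots> = ennreal A * (\<integral>\<^sup>+y. g y \<partial>lborel)" by (rule nn_integral_cmult) measurable
  finally show ?thesis .
qed

lemma avg_le:
  assumes [measurable]: "g \<in> borel_measurable borel" and "0 < s"
  shows "avg s g x \<le> ennreal (B / s ^ DIM('a)) * (\<integral>\<^sup>+y. g y \<partial>lborel)"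
proof -
  have "avg s g x \<le> (\<integral>\<^sup>+y. ennreal (B / s ^ DIM('a)) * g y \<partial>lborel)"
    unfolding avg_def using assms
    by (intro nn_integral_mono mult_right_mono ennreal_leI divide_right_mono k_le) auto
  also have "\<dots> = ennreal (B / s ^ DIM('a)) * (\<integral>\<^sup>+y. g y \<partial>lborel)" by (rule nn_integral_cmult) measurable
  finally show ?thesis .
qed

text \<open>The part of g below \<tau> contributes at most A \<tau>, because the kernel has mass at
  most A. Only the tail of g remains, to which L^1 estimates apply.\<close>

lemma avg_split_level:
  assumes [measurable]: "g \<in> borel_measurable borel" and "0 < s" "0 \<le> \<tau>"
  shows "avg s g x \<le> ennreal (A * \<tau>) + avg s (\<lambda>y. g y * indicator {y. ennreal \<tau> < g y} y) x"
proof -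
  have "avg s g x \<le> avg s (\<lambda>y. ennreal \<tau> + g y * indicator {y. ennreal \<tau> < g y} y) x"
    using le_split_level[of _ \<tau>] by (intro avg_mono) (simp add: indicator_def)
  also have "\<dots> = avg s (\<lambda>_. ennreal \<tau>) x + avg s (\<lambda>y. g y * indicator {y. ennreal \<tau> < g y} y) x"
    by (rule avg_add) measurable
  also have "\<dots> \<le> ennreal (A * \<tau>) + avg s (\<lambda>y. g y * indicator {y. ennreal \<tau> < g y} y) x"
    using avg_const[OF \<open>0 < s\<close>, of "ennreal \<tau>" x] A_pos assms by (intro add_right_mono) (simp add: ennreal_mult)
  finally show ?thesis .
qed

text \<open>Jensen's inequality for a kernel whose mass is not normalised; this costs the factor A +
  1.\<close>

lemma avg_le_epowr_avg:
  assumes [measurable]: "g \<in> borel_measurable borel" and "0 < s" "1 \<le> q"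
  shows "avg s g x \<le> ennreal (A + 1) * epowr (avg s (\<lambda>y. epowr (g y) q) x) (1 / q)"
proof (rule le_epowr_optimize)
  fix \<tau> :: real assume "0 < \<tau>"
  have "avg s g x \<le> avg s (\<lambda>y. ennreal \<tau> + ennreal (\<tau> powr (1 - q)) * epowr (g y) q) x"
    using \<open>0 < \<tau>\<close> assms by (intro avg_mono le_split_power)
  also have "\<dots> = avg s (\<lambda>_. ennreal \<tau>) x + ennreal (\<tau> powr (1 - q)) * avg s (\<lambda>y. epowr (g y) q) x"
    by (subst avg_add) (simp_all add: avg_cmult)
  also have "\<dots> \<le> ennreal (A * \<tau>) + ennreal (1 * \<tau> powr (1 - q)) * avg s (\<lambda>y. epowr (g y) q) x"
    using avg_const[OF \<open>0 < s\<close>, of "ennreal \<tau>" x] A_pos \<open>0 < \<tau>\<close>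
    by (intro add_mono) (simp_all add: ennreal_mult)
  finally show "avg s g x \<le> ennreal (A * \<tau>) + ennreal (1 * \<tau> powr (1 - q)) * avg s (\<lambda>y. epowr (g y) q) x" .
qed (use A_pos assms in auto)

text \<open>Young's inequality with an L^1 kernel, obtained by integrating Jensen's inequality. The
  constant does not depend on s, which is what the supremum over t in claim (b) requires.\<close>

lemma nn_integral_epowr_avg:
  assumes [measurable]: "g \<in> borel_measurable borel" and "0 < s" "1 \<le> q"
  shows "(\<integral>\<^sup>+x. epowr (avg s g x) q \<partial>lborel) \<le> ennreal ((A + 1) powr q * A) * (\<integral>\<^sup>+y. epowr (g y) q \<partial>lborel)"
proof -
  have "(\<integral>\<^sup>+x. epowr (avg s g x) q \<partial>lborel) \<le> (\<integral>\<^sup>+x. ennreal ((A + 1) powr q) * avg s (\<lambda>y. epowr (g y) q) x \<partial>lborel)"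
  proof (rule nn_integral_mono)
    fix x
    have "epowr (avg s g x) q \<le> epowr (ennreal (A + 1) * epowr (avg s (\<lambda>y. epowr (g y) q) x) (1 / q)) q"
      using assms by (intro epowr_mono avg_le_epowr_avg) auto
    then show "epowr (avg s g x) q \<le> ennreal ((A + 1) powr q) * avg s (\<lambda>y. epowr (g y) q) x"
      using assms A_pos by (simp add: epowr_mult epowr_epowr epowr_ennreal del: ennreal_plus)
  qed
  also have "\<dots> = ennreal ((A + 1) powr q) * (\<integral>\<^sup>+x. avg s (\<lambda>y. epowr (g y) q) x \<partial>lborel)"
    by (rule nn_integral_cmult) measurable
  also have "\<dots> \<le> ennreal ((A + 1) powr q) * (ennreal A * (\<integral>\<^sup>+y. epowr (g y) q \<partial>lborel))"
    using assms by (intro mult_left_mono nn_integral_avg) auto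
  finally show ?thesis using A_pos by (simp add: ennreal_mult mult.assoc)
qed

definition "sup_const p = (A + 1) * B powr (1 / p)"

lemma sup_const_pos: "0 < sup_const p"
  using A_pos B_pos by (simp add: sup_const_def)

text \<open>The dilate of the kernel is at most B s^(-n), and Jensen's inequality converts this into
  decay s^(-n/p) for g in the unit ball of L^p. It limits the dilations s at which an average can
  exceed a given level.\<close>

lemma avg_sup_bound:
  assumes [measurable]: "g \<in> borel_measurable borel" and "0 < s" "1 \<le> p"
    and F: "(\<integral>\<^sup>+y. epowr (g y) p \<partial>lborel) \<le> 1"
  shows "avg s g x \<le> ennreal (sup_const p * s powr (- (real DIM('a) / p)))"
proof -
  have "avg s (\<lambda>y. epowr (g y) p) x \<le> ennreal (B / s ^ DIM('a)) * (\<integral>\<^sup>+y. epowr (g y) p \<partial>lborel)"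
    using assms by (intro avg_le) auto
  also have "\<dots> \<le> ennreal (B / s ^ DIM('a))" using mult_left_mono[OF F, of "ennreal (B / s ^ DIM('a))"] by simp
  finally have "epowr (avg s (\<lambda>y. epowr (g y) p) x) (1 / p) \<le> epowr (ennreal (B / s ^ DIM('a))) (1 / p)"
    using assms by (intro epowr_mono) auto
  also have "\<dots> = ennreal (B powr (1 / p) * s powr (- (real DIM('a) / p)))"
    using assms B_pos by (simp add: epowr_ennreal powr_divide powr_realpow[symmetric] powr_powr powr_minus_divide)
  finally have "ennreal (A + 1) * epowr (avg s (\<lambda>y. epowr (g y) p) x) (1 / p)
      \<le> ennreal (A + 1) * ennreal (B powr (1 / p) * s powr (- (real DIM('a) / p)))"
    by (rule mult_left_mono) simp
  also have "\<dots> = ennreal (sup_const p * s powr (- (real DIM('a) / p)))"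
    using A_pos by (simp add: sup_const_def ennreal_mult[symmetric] mult.assoc del: ennreal_plus)
  finally show ?thesis using avg_le_epowr_avg[of g s p x] assms by (meson order_trans)
qed

text \<open>The interpolation is carried out by hand after normalising the L^q norm of g to be at
  most 1. For a level l two facts are combined: the sup bound allows the average to exceed l only
  for t < (D/l)^(q/n), and at each such t the level set has measure at most 2A/l times the integral
  of g over the set where g > l/(2A). Integrating t^\<gamma> over the admissible times produces the
  power of l by which the exponent rises from q to r.\<close>

lemma avg_mixed_norm_bound:
  fixes q \<gamma> r :: real
  assumes q: "1 < q" and \<gamma>: "-1 < \<gamma>" and r: "r = q * (1 + real DIM('a) + \<gamma>) / real DIM('a)"
  shows "\<exists>C>0. \<forall>g\<in>borel_measurable borel.
    (\<integral>\<^sup>+t. ennreal (t powr \<gamma>) * indicator {0<..} t * (\<integral>\<^sup>+x. epowr (avg t g x) r \<partial>lborel) \<partial>lborel)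
      \<le> ennreal C * epowr (\<integral>\<^sup>+y. epowr (g y) q \<partial>lborel) (r / q)"
proof -
  define n where "n = real DIM('a)"
  have n: "0 < n" by (simp add: n_def)
  have r': "r = q + q * (\<gamma> + 1) / n" using n by (simp add: r n_def[symmetric] field_simps)
  have "0 < q * (\<gamma> + 1) / n" using q \<gamma> n by simp
  then have r_pos: "0 < r" using q unfolding r' by linarith
  define D where "D = sup_const q"
  have D: "0 < D" by (simp add: D_def sup_const_pos)
  \<comment> \<open>The factor r comes from the layer cake formula, 2A from Markov's inequality and
    the mass of the kernel, and the rest from integrating t^\<gamma> up to (D/l)^(q/n).\<close>
  define K where "K = 2 * A * r * D powr (q * (\<gamma> + 1) / n) / (\<gamma> + 1)"
  have K: "0 < K" using A_pos r_pos D \<gamma> by (simp add: K_def)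
  define C where "C = K * ((1 / (2 * A)) powr (- (q - 1)) / (q - 1))"
  have C: "0 < C" using K A_pos q by (simp add: C_def)
  have main: "(\<integral>\<^sup>+t. ennreal (t powr \<gamma>) * indicator {0<..} t * (\<integral>\<^sup>+x. epowr (avg t g x) r \<partial>lborel) \<partial>lborel) \<le> ennreal C"
    if g[measurable]: "g \<in> borel_measurable borel" and F: "(\<integral>\<^sup>+y. epowr (g y) q \<partial>lborel) \<le> 1" for g
  proof -
    \<comment> \<open>Below the level l/(2A) the function g contributes at most l/2 to an
      average.\<close>
    define tail where "tail l = (\<integral>\<^sup>+y. g y * indicator {y. ennreal (l / (2 * A)) < g y} y \<partial>lborel)" for l :: real
    have tail[measurable]: "tail \<in> borel_measurable borel" unfolding tail_def by measurable
    \<comment> \<open>From the time (D/l)^(q/n) on, the sup bound D t^(-n/q) is at most l and the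
      level set is empty; this is the meaning of the indicator.\<close>
    have level: "emeasure lborel {x\<in>space lborel. ennreal l < avg t g x}
        \<le> indicator {t. t < (D / l) powr (q / n)} t * (ennreal (2 * A / l) * tail l)"
      if t: "0 < t" and l: "0 < l" for t l
    proof (cases "t < (D / l) powr (q / n)")
      case True
      have "emeasure lborel {x\<in>space lborel. ennreal l < avg t g x}
          \<le> ennreal (2 / l) * (\<integral>\<^sup>+x. avg t (\<lambda>y. g y * indicator {y. ennreal (l / (2 * A)) < g y} y) x \<partial>lborel)"
        using avg_split_level[OF g t, of "l / (2 * A)"] A_pos l by (intro emeasure_level_bound) auto
      also have "\<dots> \<le> ennreal (2 / l) * (ennreal A * tail l)"
        unfolding tail_def using t by (intro mult_left_mono nn_integral_avg) auto
      finally show ?thesis using True t l A_pos by (simp add: mult.assoc[symmetric] ennreal_mult[symmetric])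
    next
      case False
      have "D * t powr (- (n / q)) \<le> l"
      proof -
        have "((D / l) powr (q / n)) powr (n / q) \<le> t powr (n / q)"
          using False q n by (intro powr_mono2) auto
        then have "D / l \<le> t powr (n / q)" using q n D l by (simp add: powr_powr)
        then show ?thesis using l t by (simp add: powr_minus field_simps)
      qed
      then have "avg t g x \<le> ennreal l" for x
        using avg_sup_bound[OF g t, of q x] q F unfolding D_def n_def
        by (meson ennreal_leI less_imp_le order_trans)
      then have "{x\<in>space lborel. ennreal l < avg t g x} = {}" by (auto simp: not_less)
      then show ?thesis by (simp only: emeasure_empty) simp
    qed
    have "(\<integral>\<^sup>+t. ennreal (t powr \<gamma>) * indicator {0<..} t * (\<integral>\<^sup>+x. epowr (avg t g x) r \<partial>lborel) \<partial>lborel)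
      = (\<integral>\<^sup>+t. ennreal (t powr \<gamma>) * indicator {0<..} t *
          (\<integral>\<^sup>+l. ennreal (r * l powr (r - 1)) * indicator {0<..} l * emeasure lborel {x\<in>space lborel. ennreal l < avg t g x} \<partial>lborel) \<partial>lborel)"
      by (subst lborel.nn_integral_layer_cake) (use r_pos in simp_all)
    also have "\<dots> \<le> (\<integral>\<^sup>+t. ennreal (t powr \<gamma>) * indicator {0<..} t *
          (\<integral>\<^sup>+l. ennreal (r * l powr (r - 1)) * indicator {0<..} l *
             (indicator {t. t < (D / l) powr (q / n)} t * (ennreal (2 * A / l) * tail l)) \<partial>lborel) \<partial>lborel)"
    proof (intro nn_integral_mono)
      fix t :: real
      show "ennreal (t powr \<gamma>) * indicator {0<..} t *
          (\<integral>\<^sup>+l. ennreal (r * l powr (r - 1)) * indicator {0<..} l * emeasure lborel {x\<in>space lborel. ennreal l < avg t g x} \<partial>lborel)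
        \<le> ennreal (t powr \<gamma>) * indicator {0<..} t *
          (\<integral>\<^sup>+l. ennreal (r * l powr (r - 1)) * indicator {0<..} l *
             (indicator {t. t < (D / l) powr (q / n)} t * (ennreal (2 * A / l) * tail l)) \<partial>lborel)"
      proof (cases "0 < t")
        case True
        show ?thesis
        proof (rule mult_left_mono, rule nn_integral_mono)
          fix l :: real
          show "ennreal (r * l powr (r - 1)) * indicator {0<..} l * emeasure lborel {x\<in>space lborel. ennreal l < avg t g x}
            \<le> ennreal (r * l powr (r - 1)) * indicator {0<..} l *
             (indicator {t. t < (D / l) powr (q / n)} t * (ennreal (2 * A / l) * tail l))"
            using level[OF True, of l] by (cases "0 < l") (auto intro: mult_left_mono)
        qed simp
      qed simp
    qed
    also have "\<dots> = (\<integral>\<^sup>+t. (\<integral>\<^sup>+l. ennreal (t powr \<gamma>) * indicator {0<..} t * (ennreal (r * l powr (r - 1)) * indicator {0<..} l *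
             (indicator {t. t < (D / l) powr (q / n)} t * (ennreal (2 * A / l) * tail l))) \<partial>lborel) \<partial>lborel)"
      by (intro nn_integral_cong nn_integral_cmult[symmetric]) measurable
    also have "\<dots> = (\<integral>\<^sup>+l. (\<integral>\<^sup>+t. ennreal (t powr \<gamma>) * indicator {0<..} t * (ennreal (r * l powr (r - 1)) * indicator {0<..} l *
             (indicator {t. t < (D / l) powr (q / n)} t * (ennreal (2 * A / l) * tail l))) \<partial>lborel) \<partial>lborel)"
      by (rule lborel_pair.Fubini') measurable
    also have "\<dots> = (\<integral>\<^sup>+l. ennreal (r * l powr (r - 1)) * indicator {0<..} l * (ennreal (2 * A / l) * tail l) *
         (\<integral>\<^sup>+t. ennreal (t powr \<gamma>) * indicator {0<..<(D / l) powr (q / n)} t \<partial>lborel) \<partial>lborel)"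
    proof (intro nn_integral_cong)
      fix l :: real
      have "(\<integral>\<^sup>+t. ennreal (t powr \<gamma>) * indicator {0<..} t * (ennreal (r * l powr (r - 1)) * indicator {0<..} l *
             (indicator {t. t < (D / l) powr (q / n)} t * (ennreal (2 * A / l) * tail l))) \<partial>lborel)
       = (\<integral>\<^sup>+t. (ennreal (r * l powr (r - 1)) * indicator {0<..} l * (ennreal (2 * A / l) * tail l)) *
           (ennreal (t powr \<gamma>) * indicator {0<..<(D / l) powr (q / n)} t) \<partial>lborel)"
        by (intro nn_integral_cong) (auto simp: indicator_def mult_ac)
      also have "\<dots> = ennreal (r * l powr (r - 1)) * indicator {0<..} l * (ennreal (2 * A / l) * tail l) *
         (\<integral>\<^sup>+t. ennreal (t powr \<gamma>) * indicator {0<..<(D / l) powr (q / n)} t \<partial>lborel)"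
        by (rule nn_integral_cmult) measurable
      finally show "(\<integral>\<^sup>+t. ennreal (t powr \<gamma>) * indicator {0<..} t * (ennreal (r * l powr (r - 1)) * indicator {0<..} l *
             (indicator {t. t < (D / l) powr (q / n)} t * (ennreal (2 * A / l) * tail l))) \<partial>lborel)
        = ennreal (r * l powr (r - 1)) * indicator {0<..} l * (ennreal (2 * A / l) * tail l) *
         (\<integral>\<^sup>+t. ennreal (t powr \<gamma>) * indicator {0<..<(D / l) powr (q / n)} t \<partial>lborel)" .
    qed
    also have "\<dots> = (\<integral>\<^sup>+l. ennreal K * (ennreal (l powr (q - 2)) * indicator {0<..} l *
       (\<integral>\<^sup>+y. g y * indicator {y. ennreal ((1 / (2 * A)) * l powr 1) < g y} y \<partial>lborel)) \<partial>lborel)"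
    proof (intro nn_integral_cong)
      fix l :: real
      show "ennreal (r * l powr (r - 1)) * indicator {0<..} l * (ennreal (2 * A / l) * tail l) *
         (\<integral>\<^sup>+t. ennreal (t powr \<gamma>) * indicator {0<..<(D / l) powr (q / n)} t \<partial>lborel)
       = ennreal K * (ennreal (l powr (q - 2)) * indicator {0<..} l *
       (\<integral>\<^sup>+y. g y * indicator {y. ennreal ((1 / (2 * A)) * l powr 1) < g y} y \<partial>lborel))"
      proof (cases "0 < l")
        case True
        have T: "max 0 ((D / l) powr (q / n)) powr (\<gamma> + 1) = D powr (q * (\<gamma> + 1) / n) * l powr (- (q * (\<gamma> + 1) / n))"
          using True D by (simp add: powr_powr powr_divide powr_minus_divide)
        \<comment> \<open>Power count: the layer cake, Markov's inequality and the time integral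
          contribute r - 1, -1 and -q(\<gamma>+1)/n, and r = q + q(\<gamma>+1)/n.\<close>
        have "l powr (r - 1) * (1 / l) * l powr (- (q * (\<gamma> + 1) / n)) = l powr (q - 2)"
        proof -
          have "l powr (r - 1) * (1 / l) * l powr (- (q * (\<gamma> + 1) / n)) = l powr (r - 1) * l powr (-1) * l powr (- (q * (\<gamma> + 1) / n))"
            using True by (simp add: powr_minus_divide)
          also have "\<dots> = l powr (q - 2)" unfolding powr_add[symmetric] r' by (rule arg_cong[where f="\<lambda>z. l powr z"]) simp
          finally show ?thesis .
        qed
        moreover have "r * l powr (r - 1) * (2 * A / l) * (max 0 ((D / l) powr (q / n)) powr (\<gamma> + 1) / (\<gamma> + 1))
            = K * (l powr (r - 1) * (1 / l) * l powr (- (q * (\<gamma> + 1) / n)))"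
          unfolding T K_def by (simp add: mult_ac)
        ultimately have e: "r * l powr (r - 1) * (2 * A / l) * (max 0 ((D / l) powr (q / n)) powr (\<gamma> + 1) / (\<gamma> + 1)) = K * l powr (q - 2)"
          by simp
        have "ennreal (r * l powr (r - 1)) * indicator {0<..} l * (ennreal (2 * A / l) * tail l) *
          (\<integral>\<^sup>+t. ennreal (t powr \<gamma>) * indicator {0<..<(D / l) powr (q / n)} t \<partial>lborel)
          = (ennreal (r * l powr (r - 1)) * ennreal (2 * A / l) * ennreal (max 0 ((D / l) powr (q / n)) powr (\<gamma> + 1) / (\<gamma> + 1))) * tail l"
          using True unfolding nn_integral_powr_less'[OF \<gamma>] by (simp add: mult_ac)
        also have "\<dots> = ennreal (K * l powr (q - 2)) * tail l"
          unfolding e[symmetric] using True r_pos A_pos \<gamma> by (subst ennreal_mult3) auto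
        finally show ?thesis using True K by (simp add: tail_def ennreal_mult mult.assoc)
      qed simp
    qed
    also have "\<dots> = ennreal K * (\<integral>\<^sup>+l. (ennreal (l powr (q - 2)) * indicator {0<..} l *
       (\<integral>\<^sup>+y. g y * indicator {y. ennreal ((1 / (2 * A)) * l powr 1) < g y} y \<partial>lborel)) \<partial>lborel)"
      by (rule nn_integral_cmult) measurable
    \<comment> \<open>Used with e = q - 2 and m = 1, which returns the power q of g; e > -1 holds
      because q > 1.\<close>
    also have "\<dots> = ennreal K * (ennreal ((1 / (2 * A)) powr (- (q - 1)) / (q - 1)) * (\<integral>\<^sup>+y. epowr (g y) q \<partial>lborel))"
      using A_pos q by (subst nn_integral_tail_powr) auto
    also have "\<dots> \<le> ennreal K * (ennreal ((1 / (2 * A)) powr (- (q - 1)) / (q - 1)) * 1)"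
      by (intro mult_left_mono F) auto
    also have "\<dots> = ennreal C" using K q unfolding C_def mult_1_right by (intro ennreal_mult[symmetric]) auto
    finally show ?thesis .
  qed
  have "(\<integral>\<^sup>+t. ennreal (t powr \<gamma>) * indicator {0<..} t * (\<integral>\<^sup>+x. epowr (avg t g x) r \<partial>lborel) \<partial>lborel)
      \<le> ennreal C * epowr (\<integral>\<^sup>+y. epowr (g y) q \<partial>lborel) (r / q)"
    if g[measurable]: "g \<in> borel_measurable borel" for g
  proof (rule homogeneous_epowr_bound)
    fix c :: real assume c: "0 < c" and "ennreal (c powr q) * (\<integral>\<^sup>+y. epowr (g y) q \<partial>lborel) \<le> 1"
    then have "(\<integral>\<^sup>+y. epowr (ennreal c * g y) q \<partial>lborel) \<le> 1"
      by (simp add: epowr_mult epowr_ennreal nn_integral_cmult)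
    from main[OF _ this] have "(\<integral>\<^sup>+t. ennreal (t powr \<gamma>) * indicator {0<..} t * (\<integral>\<^sup>+x. epowr (ennreal c * avg t g x) r \<partial>lborel) \<partial>lborel) \<le> ennreal C"
      by (simp add: avg_cmult)
    also have "(\<integral>\<^sup>+t. ennreal (t powr \<gamma>) * indicator {0<..} t * (\<integral>\<^sup>+x. epowr (ennreal c * avg t g x) r \<partial>lborel) \<partial>lborel)
      = ennreal (c powr r) * (\<integral>\<^sup>+t. ennreal (t powr \<gamma>) * indicator {0<..} t * (\<integral>\<^sup>+x. epowr (avg t g x) r \<partial>lborel) \<partial>lborel)"
    proof -
      have "ennreal (t powr \<gamma>) * indicator {0<..} t * (\<integral>\<^sup>+x. epowr (ennreal c * avg t g x) r \<partial>lborel)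
        = ennreal (c powr r) * (ennreal (t powr \<gamma>) * indicator {0<..} t * (\<integral>\<^sup>+x. epowr (avg t g x) r \<partial>lborel))" for t
        using c by (simp add: epowr_mult epowr_ennreal nn_integral_cmult mult_ac)
      then show ?thesis by (simp add: nn_integral_cmult)
    qed
    finally show "ennreal (c powr r) * (\<integral>\<^sup>+t. ennreal (t powr \<gamma>) * indicator {0<..} t * (\<integral>\<^sup>+x. epowr (avg t g x) r \<partial>lborel) \<partial>lborel) \<le> ennreal C" .
  qed (use q r_pos C in auto)
  then show ?thesis using C by blast
qed

text \<open>The Hardy-Littlewood-Sobolev inequality for a potential written as a superposition of
  averages. At a level l the integral over s is cut at a point S. Beyond S the decay s^(-n/p) of the
  averages leaves at most l/4; before S the part of g below a truncation level \<tau> leaves at most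
  l/4. The remaining piece, the tail of g averaged over s < S, has an L^1 bound, so the level set is
  controlled by Markov's inequality.\<close>

lemma riesz_potential_bound:
  fixes p q \<beta> :: real
  assumes p: "1 < p" and \<beta>: "0 < \<beta>" "p * \<beta> < real DIM('a)" and q: "q = p * real DIM('a) / (real DIM('a) - p * \<beta>)"
  shows "\<exists>C>0. \<forall>g\<in>borel_measurable borel.
    (\<integral>\<^sup>+x. epowr (\<integral>\<^sup>+s. ennreal (s powr (\<beta> - 1)) * indicator {0<..} s * avg s g x \<partial>lborel) q \<partial>lborel)
      \<le> ennreal C * epowr (\<integral>\<^sup>+y. epowr (g y) p \<partial>lborel) (q / p)"
proof -
  define n where "n = real DIM('a)"
  have n: "0 < n" by (simp add: n_def)
  \<comment> \<open>w equals n/q. It is the decay exponent left over when s^(\<beta>-1) meets the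
    sup bound s^(-n/p): the product is s^(-w-1), integrable at infinity.\<close>
  define w where "w = n / p - \<beta>"
  have w: "0 < w" using \<beta> p by (simp add: w_def n_def field_simps)
  have qw: "q = n / w" using w p unfolding q n_def[symmetric] w_def by (simp add: field_simps)
  have qp: "q / p = 1 + \<beta> / w" using w p unfolding qw by (simp add: w_def field_simps)
  have q_gt: "q / p > 1" using \<beta> w by (simp add: qp)
  have q1: "1 < q" using q_gt p by (simp add: field_simps)
  have qp2: "0 < q - q / p" using p q1 by (simp add: field_simps)
  define D where "D = sup_const p"
  have D: "0 < D" by (simp add: D_def sup_const_pos)
  \<comment> \<open>For the S and \<tau> fixed below, K is 2 A S^\<beta> / (\<beta> l) and c0 is
    \<tau>, each with its power of l removed.\<close>
  define K where "K = 2 * A / \<beta> * (4 * D / w) powr (\<beta> / w)"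
  define c0 where "c0 = \<beta> / (4 * A) * (4 * D / w) powr (- (\<beta> / w))"
  have K: "0 < K" using A_pos \<beta> D w by (simp add: K_def)
  have c0: "0 < c0" using A_pos \<beta> D w by (simp add: c0_def)
  define C where "C = q * K * (c0 powr (- ((q - q / p) / (q / p))) / (q - q / p))"
  have C: "0 < C" using q1 K c0 qp2 by (simp add: C_def)
  define R where "R g x = (\<integral>\<^sup>+s. ennreal (s powr (\<beta> - 1)) * indicator {0<..} s * avg s g x \<partial>lborel)" for g x
  have [measurable]: "R g \<in> borel_measurable borel" if [measurable]: "g \<in> borel_measurable borel" for g
    unfolding R_def by measurable
  have main: "(\<integral>\<^sup>+x. epowr (R g x) q \<partial>lborel) \<le> ennreal C"
    if g[measurable]: "g \<in> borel_measurable borel" and F: "(\<integral>\<^sup>+y. epowr (g y) p \<partial>lborel) \<le> 1" for g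
  proof -
    define tail where "tail l = (\<integral>\<^sup>+y. g y * indicator {y. ennreal (c0 * l powr (q / p)) < g y} y \<partial>lborel)" for l :: real
    have tail[measurable]: "tail \<in> borel_measurable borel" unfolding tail_def by measurable
    have level: "emeasure lborel {x\<in>space lborel. ennreal l < R g x} \<le> ennreal (K * l powr (- (q / p))) * tail l"
      if l: "0 < l" for l
    proof -
      \<comment> \<open>Chosen so that the integral of D s^(-w-1) from S to infinity, D S^(-w) / w,
        is exactly l/4. The level \<tau> below makes the contribution of the small values of g, A
        \<tau> S^\<beta> / \<beta>, equal to l/4 as well.\<close>
      define S where "S = (4 * D / (w * l)) powr (1 / w)"
      have S: "0 < S" using D w l by (simp add: S_def)
      have S\<beta>: "S powr \<beta> = (4 * D / w) powr (\<beta> / w) * l powr (- (\<beta> / w))"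
        using D w l by (simp add: S_def powr_powr powr_mult powr_divide powr_minus_divide)
      have Sw: "S powr (- w) = w * l / (4 * D)"
        using D w l by (simp add: S_def powr_powr powr_minus_divide)
      define \<tau> where "\<tau> = c0 * l powr (q / p)"
      have \<tau>: "0 < \<tau>" using c0 l by (simp add: \<tau>_def)
      have \<tau>_eq: "A * \<tau> * (S powr \<beta> / \<beta>) = l / 4"
      proof -
        have "(4 * D / w) powr (- (\<beta> / w)) * (4 * D / w) powr (\<beta> / w) = 1"
          using D w by (simp add: powr_add[symmetric])
        moreover have "l powr (q / p) * l powr (- (\<beta> / w)) = l"
          using l by (simp add: powr_add[symmetric] qp)
        moreover have "A * \<tau> * (S powr \<beta> / \<beta>) = (1 / 4) * (((4 * D / w) powr (- (\<beta> / w)) * (4 * D / w) powr (\<beta> / w)) * (l powr (q / p) * l powr (- (\<beta> / w))))"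
          unfolding \<tau>_def c0_def S\<beta> using A_pos \<beta> by simp
        ultimately show ?thesis by simp
      qed
      define h where "h = (\<lambda>y. g y * indicator {y. ennreal \<tau> < g y} y)"
      have h[measurable]: "h \<in> borel_measurable borel" unfolding h_def by measurable
      have inth: "(\<integral>\<^sup>+y. h y \<partial>lborel) = tail l" by (simp add: h_def tail_def \<tau>_def)
      define V where "V x = (\<integral>\<^sup>+s. ennreal (s powr (\<beta> - 1)) * indicator {0<..<S} s * avg s h x \<partial>lborel)" for x
      have V[measurable]: "V \<in> borel_measurable borel" unfolding V_def by measurable
      have split: "R g x \<le> ennreal (l / 2) + V x" for x
      proof -
        have "R g x \<le> (\<integral>\<^sup>+s. (ennreal (A * \<tau>) * (ennreal (s powr (\<beta> - 1)) * indicator {0<..<S} s)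
            + ennreal D * (ennreal (s powr (- w - 1)) * indicator {S..} s))
            + ennreal (s powr (\<beta> - 1)) * indicator {0<..<S} s * avg s h x \<partial>lborel)"
          unfolding R_def
        proof (rule nn_integral_mono)
          fix s :: real
          consider "s \<le> 0" | "0 < s" "s < S" | "0 < s" "S \<le> s" by linarith
          then show "ennreal (s powr (\<beta> - 1)) * indicator {0<..} s * avg s g x
             \<le> (ennreal (A * \<tau>) * (ennreal (s powr (\<beta> - 1)) * indicator {0<..<S} s)
            + ennreal D * (ennreal (s powr (- w - 1)) * indicator {S..} s))
            + ennreal (s powr (\<beta> - 1)) * indicator {0<..<S} s * avg s h x"
          proof cases
            case 2
            have "ennreal (s powr (\<beta> - 1)) * avg s g x \<le> ennreal (s powr (\<beta> - 1)) * (ennreal (A * \<tau>) + avg s h x)"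
              using avg_split_level[OF g, of s \<tau> x] 2 \<tau> by (intro mult_left_mono) (auto simp: h_def)
            then show ?thesis using 2 by (simp add: distrib_left mult_ac)
          next
            case 3
            have "s powr (\<beta> - 1) * s powr (- (n / p)) = s powr (- w - 1)"
              unfolding powr_add[symmetric] w_def by (rule arg_cong[where f="\<lambda>z. s powr z"]) simp
            then have e: "s powr (\<beta> - 1) * (D * s powr (- (n / p))) = D * s powr (- w - 1)"
              by (simp add: mult.left_commute)
            have "ennreal (s powr (\<beta> - 1)) * avg s g x \<le> ennreal (s powr (\<beta> - 1)) * ennreal (D * s powr (- (n / p)))"
              using avg_sup_bound[OF g, of s p x] 3 p F by (intro mult_left_mono) (auto simp: D_def n_def)
            also have "\<dots> = ennreal (D * s powr (- w - 1))"
              using D by (subst ennreal_mult[symmetric]) (auto simp: e)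
            finally show ?thesis using 3 D by (simp add: ennreal_mult)
          qed simp
        qed
        also have "\<dots> = (ennreal (A * \<tau>) * ennreal (S powr \<beta> / \<beta>) + ennreal D * ennreal (S powr (- w) / w)) + V x"
          unfolding V_def using \<beta> w S nn_integral_powr_less'[of "\<beta> - 1" S] nn_integral_powr_ge[of "- w - 1" S]
          by (simp add: nn_integral_add nn_integral_cmult)
        also have "ennreal (A * \<tau>) * ennreal (S powr \<beta> / \<beta>) + ennreal D * ennreal (S powr (- w) / w) = ennreal (l / 4) + ennreal (l / 4)"
        proof -
          have "D * (S powr (- w) / w) = l / 4" unfolding Sw using D w by simp
          moreover have "ennreal D * ennreal (S powr (- w) / w) = ennreal (D * (S powr (- w) / w))"
            using D w by (intro ennreal_mult[symmetric]) auto
          moreover have "ennreal (A * \<tau>) * ennreal (S powr \<beta> / \<beta>) = ennreal (A * \<tau> * (S powr \<beta> / \<beta>))"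
            using A_pos \<tau> \<beta> by (intro ennreal_mult[symmetric]) auto
          ultimately show ?thesis by (simp only: \<tau>_eq)
        qed
        also have "\<dots> = ennreal (l / 2)" using l by (subst ennreal_plus[symmetric]) auto
        finally show ?thesis .
      qed
      have "(\<integral>\<^sup>+x. V x \<partial>lborel) = (\<integral>\<^sup>+s. (\<integral>\<^sup>+x. ennreal (s powr (\<beta> - 1)) * indicator {0<..<S} s * avg s h x \<partial>lborel) \<partial>lborel)"
        unfolding V_def by (rule lborel_pair.Fubini') measurable
      also have "\<dots> \<le> (\<integral>\<^sup>+s. (ennreal A * tail l) * (ennreal (s powr (\<beta> - 1)) * indicator {0<..<S} s) \<partial>lborel)"
      proof (rule nn_integral_mono)
        fix s :: real
        have "ennreal (s powr (\<beta> - 1)) * (\<integral>\<^sup>+x. avg s h x \<partial>lborel) \<le> ennreal (s powr (\<beta> - 1)) * (ennreal A * tail l)" if "0 < s"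
          using nn_integral_avg[OF h that] by (intro mult_left_mono) (auto simp: inth)
        then show "(\<integral>\<^sup>+x. ennreal (s powr (\<beta> - 1)) * indicator {0<..<S} s * avg s h x \<partial>lborel)
          \<le> (ennreal A * tail l) * (ennreal (s powr (\<beta> - 1)) * indicator {0<..<S} s)"
          by (cases "0 < s \<and> s < S") (auto simp: nn_integral_cmult mult.commute[of "ennreal A * tail l"])
      qed
      also have "\<dots> = (ennreal A * tail l) * ennreal (S powr \<beta> / \<beta>)"
        using \<beta> S nn_integral_powr_less'[of "\<beta> - 1" S] by (simp add: nn_integral_cmult)
      finally have intV: "(\<integral>\<^sup>+x. V x \<partial>lborel) \<le> (ennreal A * tail l) * ennreal (S powr \<beta> / \<beta>)" .
      have "emeasure lborel {x\<in>space lborel. ennreal l < R g x} \<le> ennreal (2 / l) * (\<integral>\<^sup>+x. V x \<partial>lborel)"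
        by (rule emeasure_level_bound) (use l split in auto)
      also have "\<dots> \<le> ennreal (2 / l) * ((ennreal A * tail l) * ennreal (S powr \<beta> / \<beta>))"
        by (intro mult_left_mono intV) simp
      also have "\<dots> = (ennreal (2 / l) * ennreal A * ennreal (S powr \<beta> / \<beta>)) * tail l" by (simp add: mult_ac)
      also have "ennreal (2 / l) * ennreal A * ennreal (S powr \<beta> / \<beta>) = ennreal (2 / l * A * (S powr \<beta> / \<beta>))"
        using l A_pos \<beta> by (simp add: ennreal_mult[symmetric])
      also have "2 / l * A * (S powr \<beta> / \<beta>) = K * (l powr (-1) * l powr (- (\<beta> / w)))"
        unfolding S\<beta> K_def using l by (simp add: powr_minus_divide)
      also have "l powr (-1) * l powr (- (\<beta> / w)) = l powr (- (q / p))"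
        unfolding powr_add[symmetric] qp by simp
      finally show ?thesis .
    qed
    have "(\<integral>\<^sup>+x. epowr (R g x) q \<partial>lborel)
      = (\<integral>\<^sup>+l. ennreal (q * l powr (q - 1)) * indicator {0<..} l * emeasure lborel {x\<in>space lborel. ennreal l < R g x} \<partial>lborel)"
      by (rule lborel.nn_integral_layer_cake) (use q1 in auto)
    also have "\<dots> \<le> (\<integral>\<^sup>+l. ennreal (q * K) * (ennreal (l powr (q - q / p - 1)) * indicator {0<..} l * tail l) \<partial>lborel)"
    proof (rule nn_integral_mono)
      fix l :: real
      show "ennreal (q * l powr (q - 1)) * indicator {0<..} l * emeasure lborel {x\<in>space lborel. ennreal l < R g x}
        \<le> ennreal (q * K) * (ennreal (l powr (q - q / p - 1)) * indicator {0<..} l * tail l)"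
      proof (cases "0 < l")
        case True
        have "l powr (q - 1) * l powr (- (q / p)) = l powr (q - q / p - 1)"
          unfolding powr_add[symmetric] by (rule arg_cong[where f="\<lambda>z. l powr z"]) simp
        then have e: "q * l powr (q - 1) * (K * l powr (- (q / p))) = q * K * l powr (q - q / p - 1)" by simp
        have "ennreal (q * l powr (q - 1)) * emeasure lborel {x\<in>space lborel. ennreal l < R g x}
          \<le> ennreal (q * l powr (q - 1)) * (ennreal (K * l powr (- (q / p))) * tail l)"
          by (intro mult_left_mono level True) auto
        also have "\<dots> = ennreal (q * l powr (q - 1) * (K * l powr (- (q / p)))) * tail l"
          using q1 K by (simp add: ennreal_mult mult.assoc)
        finally show ?thesis using True q1 K unfolding e by (simp add: ennreal_mult mult.assoc)
      qed simp
    qed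
    also have "\<dots> = ennreal (q * K) * (\<integral>\<^sup>+l. ennreal (l powr (q - q / p - 1)) * indicator {0<..} l * tail l \<partial>lborel)"
      by (rule nn_integral_cmult) measurable
    also have "\<dots> = ennreal (q * K) * (ennreal (c0 powr (- ((q - q / p) / (q / p))) / (q - q / p)) * (\<integral>\<^sup>+y. epowr (g y) p \<partial>lborel))"
    proof -
      \<comment> \<open>The tail integral with m = q/p therefore gives back the p-th power of g,
        whose integral is at most 1.\<close>
      have "1 + (q - q / p) / (q / p) = p" using q1 p by (simp add: field_simps)
      then show ?thesis unfolding tail_def using c0 q_gt qp2 by (subst nn_integral_tail_powr) auto
    qed
    also have "\<dots> \<le> ennreal (q * K) * (ennreal (c0 powr (- ((q - q / p) / (q / p))) / (q - q / p)) * 1)"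
      by (intro mult_left_mono F) auto
    also have "\<dots> = ennreal C" using K q1 qp2 unfolding C_def mult_1_right by (intro ennreal_mult[symmetric]) auto
    finally show ?thesis .
  qed
  have "(\<integral>\<^sup>+x. epowr (R g x) q \<partial>lborel) \<le> ennreal C * epowr (\<integral>\<^sup>+y. epowr (g y) p \<partial>lborel) (q / p)"
    if g[measurable]: "g \<in> borel_measurable borel" for g
  proof (rule homogeneous_epowr_bound)
    fix c :: real assume c: "0 < c" and "ennreal (c powr p) * (\<integral>\<^sup>+y. epowr (g y) p \<partial>lborel) \<le> 1"
    then have "(\<integral>\<^sup>+y. epowr (ennreal c * g y) p \<partial>lborel) \<le> 1"
      by (simp add: epowr_mult epowr_ennreal nn_integral_cmult)
    from main[OF _ this] have "(\<integral>\<^sup>+x. epowr (R (\<lambda>y. ennreal c * g y) x) q \<partial>lborel) \<le> ennreal C" by simp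
    also have "(\<lambda>x. R (\<lambda>y. ennreal c * g y) x) = (\<lambda>x. ennreal c * R g x)"
      unfolding R_def by (simp add: avg_cmult mult.left_commute[of _ "ennreal c"] nn_integral_cmult)
    finally show "ennreal (c powr q) * (\<integral>\<^sup>+x. epowr (R g x) q \<partial>lborel) \<le> ennreal C"
      using c by (simp add: epowr_mult epowr_ennreal nn_integral_cmult)
  qed (use p q1 C in auto)
  then show ?thesis using C unfolding R_def by blast
qed

end

subsection \<open>Gaussians\<close>

lemma borel_measurable_cis [measurable]:
  assumes [measurable]: "f \<in> borel_measurable M"
  shows "(\<lambda>x. cis (f x)) \<in> borel_measurable M"
proof -
  have "continuous_on UNIV cis" unfolding cis_conv_exp by (intro continuous_intros)
  then have "cis \<in> borel_measurable borel" by (rule borel_measurable_continuous_onI)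
  then show ?thesis by measurable
qed

lemma
  fixes f :: "'a::euclidean_space \<Rightarrow> real \<Rightarrow> 'b::{real_normed_field, banach, second_countable_topology}"
  assumes f: "\<And>b. b \<in> Basis \<Longrightarrow> integrable lborel (f b)"
  shows integrable_lborel_prod: "integrable lborel (\<lambda>x::'a. \<Prod>b\<in>Basis. f b (x \<bullet> b))"
    and integral_lborel_prod: "(LINT x|lborel. (\<Prod>b\<in>Basis. f b (x \<bullet> b))) = (\<Prod>b\<in>Basis. (LINT u|lborel. f b u))"
proof -
  interpret product_sigma_finite "\<lambda>_::'a. lborel :: real measure" ..
  have [measurable]: "b \<in> Basis \<Longrightarrow> f b \<in> borel_measurable borel" for b
    using borel_measurable_integrable[OF f] by simp
  have m: "(\<lambda>g::'a \<Rightarrow> real. \<Sum>b\<in>Basis. g b *\<^sub>R b) \<in> (\<Pi>\<^sub>M b\<in>Basis. lborel) \<rightarrow>\<^sub>M borel"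
    by measurable
  have e: "(\<Prod>b\<in>Basis. f b ((\<Sum>c\<in>Basis. g c *\<^sub>R c) \<bullet> b)) = (\<Prod>b\<in>Basis. f b (g b))" for g
    by (intro prod.cong refl) simp
  show "integrable lborel (\<lambda>x::'a. \<Prod>b\<in>Basis. f b (x \<bullet> b))"
    unfolding lborel_eq[where 'a='a]
    by (subst integrable_distr_eq[OF m]) (simp_all add: e product_integrable_prod f)
  show "(LINT x|lborel. (\<Prod>b\<in>Basis. f b (x \<bullet> b))) = (\<Prod>b\<in>Basis. (LINT u|lborel. f b u))"
    by (subst lborel_eq, subst integral_distr[OF m]) (simp_all add: e product_integral_prod f)
qed

text \<open>Rescaled from the characteristic function of the standard normal distribution; c = sqrt
  (2 s) turns exp (-s u^2) into exp (-(c u)^2 / 2).\<close>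

lemma
  fixes s a :: real
  assumes s: "0 < s"
  shows integrable_gauss_1: "integrable lborel (\<lambda>u. cis (a * u) * complex_of_real (exp (- s * u\<^sup>2)))"
    and integral_gauss_1: "(LINT u|lborel. cis (a * u) * complex_of_real (exp (- s * u\<^sup>2)))
      = complex_of_real (sqrt (pi / s) * exp (- a\<^sup>2 / (4 * s)))"
proof -
  define c where "c = sqrt (2 * s)"
  have c: "0 < c" "c\<^sup>2 = 2 * s" using s by (simp_all add: c_def)
  have int: "integrable lborel (\<lambda>v. complex_of_real (std_normal_density v) * cis (t * v))" for t
    by (rule Bochner_Integration.integrable_bound[of _ "\<lambda>v. complex_of_real (std_normal_density v)"])
       (auto intro!: integrable_of_real integrable_normal_density simp: norm_mult)
  have "(LINT v|lborel. complex_of_real (std_normal_density v) * cis (t * v)) = complex_of_real (exp (- (t\<^sup>2) / 2))" for t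
  proof -
    have "complex_of_real (exp (- (t\<^sup>2) / 2)) = char std_normal_distribution t"
      by (simp add: char_std_normal_distribution)
    also have "\<dots> = (LINT v|lborel. complex_of_real (std_normal_density v) * cis (t * v))"
      unfolding char_def by (subst integral_density) (auto simp: cis_conv_exp scaleR_conv_of_real)
    finally show ?thesis ..
  qed
  from this[of "a / c"]
  have I: "(LINT v|lborel. complex_of_real (std_normal_density v) * cis (a / c * v)) = complex_of_real (exp (- a\<^sup>2 / (4 * s)))"
    using c by (simp add: power_divide)
  have eq: "cis (a * u) * complex_of_real (exp (- s * u\<^sup>2))
     = complex_of_real (sqrt (2 * pi)) * (complex_of_real (std_normal_density (0 + c * u)) * cis (a / c * (0 + c * u)))" for u
    using c by (simp add: std_normal_density_def power_mult_distrib)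
  show "integrable lborel (\<lambda>u. cis (a * u) * complex_of_real (exp (- s * u\<^sup>2)))"
    unfolding eq using lborel_integrable_real_affine[OF int[of "a / c"], of c 0] c by (intro integrable_mult_right) auto
  have "(LINT u|lborel. cis (a * u) * complex_of_real (exp (- s * u\<^sup>2)))
    = complex_of_real (sqrt (2 * pi)) * (LINT u|lborel. (complex_of_real (std_normal_density (0 + c * u)) * cis (a / c * (0 + c * u))))"
    unfolding eq by (rule integral_mult_right_zero)
  also have "\<dots> = complex_of_real (sqrt (2 * pi)) * (complex_of_real (exp (- a\<^sup>2 / (4 * s))) / complex_of_real c)"
    using lborel_integral_real_affine[of c "\<lambda>v. complex_of_real (std_normal_density v) * cis (a / c * v)" 0] I c
    by (simp add: scaleR_conv_of_real field_simps)
  also have "\<dots> = complex_of_real (sqrt (2 * pi) / c * exp (- a\<^sup>2 / (4 * s)))" by simp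
  also have "sqrt (2 * pi) / c = sqrt (pi / s)" unfolding c_def real_sqrt_divide[symmetric] using s by simp
  finally show "(LINT u|lborel. cis (a * u) * complex_of_real (exp (- s * u\<^sup>2)))
      = complex_of_real (sqrt (pi / s) * exp (- a\<^sup>2 / (4 * s)))" .
qed

lemma norm_power2_eq_sum: "(norm (x::'a::euclidean_space))\<^sup>2 = (\<Sum>b\<in>Basis. (x \<bullet> b)\<^sup>2)"
  unfolding power2_norm_eq_inner by (subst euclidean_inner) (simp add: power2_eq_square)

lemma cis_sum: "finite A \<Longrightarrow> cis (\<Sum>a\<in>A. f a) = (\<Prod>a\<in>A. cis (f a))"
  by (induction A rule: finite_induct) (auto simp: cis_mult[symmetric])

lemma
  fixes x :: "'a::euclidean_space"
  assumes s: "0 < s"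
  shows integrable_gauss_cis: "integrable lborel (\<lambda>\<xi>::'a. cis (x \<bullet> \<xi>) * complex_of_real (exp (- s * (norm \<xi>)\<^sup>2)))"
    and integral_gauss_cis: "(LINT \<xi>|lborel. cis (x \<bullet> \<xi>) * complex_of_real (exp (- s * (norm \<xi>)\<^sup>2)))
      = complex_of_real (sqrt (pi / s) ^ DIM('a) * exp (- (norm x)\<^sup>2 / (4 * s)))"
proof -
  have eq: "(\<lambda>\<xi>::'a. cis (x \<bullet> \<xi>) * complex_of_real (exp (- s * (norm \<xi>)\<^sup>2)))
     = (\<lambda>\<xi>. \<Prod>b\<in>Basis. cis ((x \<bullet> b) * (\<xi> \<bullet> b)) * complex_of_real (exp (- s * (\<xi> \<bullet> b)\<^sup>2)))"
  proof
    fix \<xi> :: 'a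
    show "cis (x \<bullet> \<xi>) * complex_of_real (exp (- s * (norm \<xi>)\<^sup>2))
      = (\<Prod>b\<in>Basis. cis ((x \<bullet> b) * (\<xi> \<bullet> b)) * complex_of_real (exp (- s * (\<xi> \<bullet> b)\<^sup>2)))"
      unfolding norm_power2_eq_sum prod.distrib sum_distrib_left
      by (subst euclidean_inner) (simp add: cis_sum exp_sum)
  qed
  show "integrable lborel (\<lambda>\<xi>::'a. cis (x \<bullet> \<xi>) * complex_of_real (exp (- s * (norm \<xi>)\<^sup>2)))"
    unfolding eq by (intro integrable_lborel_prod integrable_gauss_1 s)
  show "(LINT \<xi>|lborel. cis (x \<bullet> \<xi>) * complex_of_real (exp (- s * (norm \<xi>)\<^sup>2)))
      = complex_of_real (sqrt (pi / s) ^ DIM('a) * exp (- (norm x)\<^sup>2 / (4 * s)))"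
    unfolding eq integral_lborel_prod[OF integrable_gauss_1[OF s]] integral_gauss_1[OF s]
    by (simp add: prod.distrib norm_power2_eq_sum exp_sum[symmetric] sum_negf sum_divide_distrib flip: of_real_prod)
qed

lemma
  assumes s: "0 < s"
  shows integrable_gauss: "integrable lborel (\<lambda>x::'a::euclidean_space. exp (- s * (norm x)\<^sup>2))"
    and integral_gauss: "(LINT x|lborel. exp (- s * (norm (x::'a))\<^sup>2)) = sqrt (pi / s) ^ DIM('a)"
proof -
  have "integrable lborel (\<lambda>x::'a. complex_of_real (exp (- s * (norm x)\<^sup>2)))"
    using integrable_gauss_cis[OF s, of "0::'a"] by simp
  then show "integrable lborel (\<lambda>x::'a. exp (- s * (norm x)\<^sup>2))"
    by (simp only: complex_of_real_integrable_eq)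
  have "complex_of_real (LINT x|lborel. exp (- s * (norm (x::'a))\<^sup>2)) = complex_of_real (sqrt (pi / s) ^ DIM('a))"
    using integral_gauss_cis[OF s, of "0::'a"] by (simp flip: integral_complex_of_real)
  then show "(LINT x|lborel. exp (- s * (norm (x::'a))\<^sup>2)) = sqrt (pi / s) ^ DIM('a)"
    by (simp only: of_real_eq_iff)
qed

lemma nn_integral_gauss:
  "0 < s \<Longrightarrow> (\<integral>\<^sup>+x. ennreal (exp (- s * (norm (x::'a::euclidean_space))\<^sup>2)) \<partial>lborel) = ennreal (sqrt (pi / s) ^ DIM('a))"
  by (subst nn_integral_eq_integral[OF integrable_gauss]) (simp_all only: integral_gauss, auto)

subsection \<open>Integrability of rapidly decreasing functions\<close>

lemma integrable_inverse_one_plus_square: "integrable lborel (\<lambda>u::real. inverse (1 + u\<^sup>2))"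
  using Sinc_Integral.integrable_inverse_1_plus_square by (simp add: set_integrable_def)

text \<open>Each factor 1 + x_b^2 is at most 1 + |x|^2, so a product of n one-dimensional integrable
  functions dominates.\<close>

lemma integrable_inverse_poly:
  "integrable lborel (\<lambda>x::'a::euclidean_space. inverse ((1 + (norm x)\<^sup>2) ^ DIM('a)))"
proof (rule Bochner_Integration.integrable_bound)
  show "integrable lborel (\<lambda>x::'a. \<Prod>b\<in>Basis. inverse (1 + (x \<bullet> b)\<^sup>2))"
    by (intro integrable_lborel_prod integrable_inverse_one_plus_square)
  show "AE x in lborel. norm (inverse ((1 + (norm (x::'a))\<^sup>2) ^ DIM('a))) \<le> norm (\<Prod>b\<in>Basis. inverse (1 + (x \<bullet> b)\<^sup>2))"
  proof (rule AE_I2)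
    fix x :: 'a
    have "(x \<bullet> b)\<^sup>2 \<le> (norm x)\<^sup>2" if "b \<in> Basis" for b
      using Basis_le_norm[OF that, of x] by (metis power2_abs abs_ge_zero power_mono)
    then have "(\<Prod>b\<in>Basis. 1 + (x \<bullet> b)\<^sup>2) \<le> (\<Prod>b\<in>(Basis::'a set). 1 + (norm x)\<^sup>2)"
      by (intro prod_mono) (auto simp: add_nonneg_nonneg)
    then have "(\<Prod>b\<in>Basis. 1 + (x \<bullet> b)\<^sup>2) \<le> (1 + (norm x)\<^sup>2) ^ DIM('a)" by simp
    moreover have "0 < (\<Prod>b\<in>Basis. 1 + (x \<bullet> b)\<^sup>2)" by (intro prod_pos) (auto simp: add_pos_nonneg)
    ultimately have "inverse ((1 + (norm x)\<^sup>2) ^ DIM('a)) \<le> inverse (\<Prod>b\<in>Basis. 1 + (x \<bullet> b)\<^sup>2)"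
      by (intro le_imp_inverse_le)
    then show "norm (inverse ((1 + (norm x)\<^sup>2) ^ DIM('a))) \<le> norm (\<Prod>b\<in>Basis. inverse (1 + (x \<bullet> b)\<^sup>2))"
      by (simp add: prod_inversef[symmetric] o_def abs_prod)
  qed
qed auto

lemma integrable_rapid_decay:
  fixes f :: "'a::euclidean_space \<Rightarrow> 'b::{banach, second_countable_topology}"
  assumes [measurable]: "f \<in> borel_measurable borel"
    and f: "\<And>x. norm (f x) \<le> C" "\<And>x. norm x ^ (2 * DIM('a)) * norm (f x) \<le> C"
  shows "integrable lborel f"
proof (rule Bochner_Integration.integrable_bound)
  have "0 \<le> C" using f(1) norm_ge_zero order_trans by blast
  show "integrable lborel (\<lambda>x::'a. 2 ^ DIM('a) * C * inverse ((1 + (norm x)\<^sup>2) ^ DIM('a)))"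
    by (intro integrable_mult_right integrable_inverse_poly)
  show "AE x in lborel. norm (f x) \<le> norm (2 ^ DIM('a) * C * inverse ((1 + (norm (x::'a))\<^sup>2) ^ DIM('a)))"
  proof (rule AE_I2)
    fix x :: 'a
    have "(1 + (norm x)\<^sup>2) ^ DIM('a) * norm (f x) \<le> 2 ^ DIM('a) * C"
    proof (cases "norm x \<le> 1")
      case True
      then have "(norm x)\<^sup>2 \<le> 1" by (simp add: power_le_one)
      then have "(1 + (norm x)\<^sup>2) ^ DIM('a) \<le> 2 ^ DIM('a)" by (intro power_mono) auto
      then show ?thesis using f(1)[of x] by (intro mult_mono) auto
    next
      case False
      then have "1 \<le> (norm x)\<^sup>2" by simp
      then have "(1 + (norm x)\<^sup>2) ^ DIM('a) \<le> (2 * (norm x)\<^sup>2) ^ DIM('a)" by (intro power_mono) auto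
      then have "(1 + (norm x)\<^sup>2) ^ DIM('a) * norm (f x) \<le> (2 * (norm x)\<^sup>2) ^ DIM('a) * norm (f x)"
        by (intro mult_right_mono) auto
      also have "\<dots> = 2 ^ DIM('a) * (norm x ^ (2 * DIM('a)) * norm (f x))"
        by (simp add: power_mult_distrib power_mult)
      also have "\<dots> \<le> 2 ^ DIM('a) * C" by (intro mult_left_mono f(2)) auto
      finally show ?thesis .
    qed
    moreover have "0 < (1 + (norm x)\<^sup>2) ^ DIM('a)" by (intro zero_less_power) (simp add: add_pos_nonneg)
    ultimately have "norm (f x) \<le> 2 ^ DIM('a) * C * inverse ((1 + (norm x)\<^sup>2) ^ DIM('a))"
      by (simp add: field_simps)
    then show "norm (f x) \<le> norm (2 ^ DIM('a) * C * inverse ((1 + (norm x)\<^sup>2) ^ DIM('a)))"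
      using \<open>0 \<le> C\<close> by simp
  qed
qed auto

lemma integrable_exp_neg_powr:
  assumes \<alpha>: "0 < \<alpha>"
  shows "integrable lborel (\<lambda>\<xi>::'a::euclidean_space. exp (- (norm \<xi> powr (2 * \<alpha>))))"
proof -
  \<comment> \<open>For |\<xi>| \<ge> 1 this makes |\<xi>|^(2n) at most the k-th power of
    |\<xi>|^(2\<alpha>), which the exponential absorbs.\<close>
  define k where "k = nat \<lceil>real DIM('a) / \<alpha>\<rceil>"
  have k: "real DIM('a) \<le> \<alpha> * real k" "0 < k"
  proof -
    have "real DIM('a) / \<alpha> \<le> real k" unfolding k_def by (simp add: of_nat_ceiling)
    then show "real DIM('a) \<le> \<alpha> * real k" using \<alpha> by (simp add: field_simps)
    then show "0 < k" by (cases k) auto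
  qed
  have exp_le: "exp (- u) * u ^ k \<le> real k ^ k" if "0 \<le> u" for u
  proof -
    have "(u / k) ^ k \<le> (1 + u / k) ^ k" using that by (intro power_mono) auto
    also have "\<dots> \<le> exp u" using that k by (intro exp_ge_one_plus_x_over_n_power_n) auto
    finally show ?thesis using k by (simp add: exp_minus field_simps power_divide)
  qed
  show ?thesis
  proof (rule integrable_rapid_decay[where C = "1 + real k ^ k"])
    show "norm (exp (- (norm \<xi> powr (2 * \<alpha>)))) \<le> 1 + real k ^ k" for \<xi> :: 'a
      by (simp add: add_increasing2)
    show "norm \<xi> ^ (2 * DIM('a)) * norm (exp (- (norm \<xi> powr (2 * \<alpha>)))) \<le> 1 + real k ^ k" for \<xi> :: 'a
    proof (cases "norm \<xi> \<le> 1")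
      case True
      then have "norm \<xi> ^ (2 * DIM('a)) * norm (exp (- (norm \<xi> powr (2 * \<alpha>)))) \<le> 1 * 1"
        by (intro mult_mono power_le_one) auto
      then show ?thesis by (simp add: add_increasing2)
    next
      case False
      have "norm \<xi> ^ (2 * DIM('a)) = norm \<xi> powr (2 * real DIM('a))"
        using False by (subst powr_realpow[symmetric]) auto
      also have "\<dots> \<le> norm \<xi> powr (2 * (\<alpha> * real k))" using False k by (intro powr_mono) auto
      also have "\<dots> = (norm \<xi> powr (2 * \<alpha>)) ^ k"
        using False by (subst powr_realpow[symmetric]) (auto simp: powr_powr mult.assoc)
      finally have "norm \<xi> ^ (2 * DIM('a)) * exp (- (norm \<xi> powr (2 * \<alpha>))) \<le> (norm \<xi> powr (2 * \<alpha>)) ^ k * exp (- (norm \<xi> powr (2 * \<alpha>)))"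
        by (intro mult_right_mono) auto
      also have "\<dots> \<le> real k ^ k" using exp_le[of "norm \<xi> powr (2 * \<alpha>)"] by (simp add: mult.commute)
      finally show ?thesis by simp
    qed
  qed measurable
qed

subsection \<open>Positivity of the fractional heat kernel\<close>

lemma integrable_pair_mult:
  fixes f :: "'a::euclidean_space \<Rightarrow> real" and g :: "'b::euclidean_space \<Rightarrow> real"
  assumes f: "integrable lborel f" and g: "integrable lborel g"
  shows "integrable (lborel \<Otimes>\<^sub>M lborel) (\<lambda>(x, y). f x * g y)"
proof (rule lborel_pair.Fubini_integrable)
  have [measurable]: "f \<in> borel_measurable borel" "g \<in> borel_measurable borel"
    using borel_measurable_integrable[OF f] borel_measurable_integrable[OF g] by simp_all
  show "(\<lambda>(x, y). f x * g y) \<in> borel_measurable (lborel \<Otimes>\<^sub>M lborel)" by measurable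
  have "(\<lambda>x. LINT y|lborel. norm (case (x, y) of (x, y) \<Rightarrow> f x * g y)) = (\<lambda>x. \<bar>f x\<bar> * (LINT y|lborel. \<bar>g y\<bar>))"
    by (simp add: abs_mult)
  then show "integrable lborel (\<lambda>x. LINT y|lborel. norm (case (x, y) of (x, y) \<Rightarrow> f x * g y))"
    using f by simp
  show "AE x in lborel. integrable lborel (\<lambda>y. case (x, y) of (x, y) \<Rightarrow> f x * g y)"
    using g by simp
qed

lemma nonneg_Reals_eq_norm: "z \<in> \<real>\<^sub>\<ge>\<^sub>0 \<Longrightarrow> z = complex_of_real (norm z)"
  by (auto elim!: nonneg_Reals_cases)

lemma integral_nonneg_Reals:
  fixes f :: "'a \<Rightarrow> complex"
  assumes "\<And>x. f x \<in> \<real>\<^sub>\<ge>\<^sub>0"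
  shows "integral\<^sup>L M f \<in> \<real>\<^sub>\<ge>\<^sub>0"
proof -
  have "integral\<^sup>L M f = complex_of_real (LINT x|M. norm (f x))"
    unfolding integral_complex_of_real[symmetric]
    by (intro Bochner_Integration.integral_cong refl nonneg_Reals_eq_norm assms)
  then show ?thesis by (simp add: nonneg_Reals_of_real_iff)
qed

text \<open>This class is closed under Gaussian mixtures and bounded pointwise limits, and so contains
  \<open>exp (- \<bar>\<xi>\<bar>\<^sup>2\<^sup>\<alpha>)\<close> for \<open>0 < \<alpha> \<le> 1\<close> by Bochner subordination.\<close>

definition gauss_positive :: "('a::euclidean_space \<Rightarrow> real) \<Rightarrow> bool" where
  "gauss_positive m \<longleftrightarrow> m \<in> borel_measurable borel \<and> (\<exists>B. \<forall>\<xi>. \<bar>m \<xi>\<bar> \<le> B) \<and>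
     (\<forall>s>0. \<forall>y. (LINT \<xi>|lborel. cis (y \<bullet> \<xi>) * complex_of_real (m \<xi> * exp (- s * (norm \<xi>)\<^sup>2))) \<in> \<real>\<^sub>\<ge>\<^sub>0)"

lemma gauss_positive_measurable: "gauss_positive m \<Longrightarrow> m \<in> borel_measurable borel"
  by (simp add: gauss_positive_def)

lemma gauss_positiveD:
  "gauss_positive m \<Longrightarrow> 0 < s \<Longrightarrow>
    (LINT \<xi>|lborel. cis (y \<bullet> \<xi>) * complex_of_real (m \<xi> * exp (- s * (norm \<xi>)\<^sup>2))) \<in> \<real>\<^sub>\<ge>\<^sub>0"
  unfolding gauss_positive_def by blast

lemma gauss_positive_integrable:
  assumes "gauss_positive m" "0 < s"
  shows "integrable lborel (\<lambda>\<xi>. cis (y \<bullet> \<xi>) * complex_of_real (m \<xi> * exp (- s * (norm \<xi>)\<^sup>2)))"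
proof -
  from assms obtain B where B: "\<And>\<xi>. \<bar>m \<xi>\<bar> \<le> B" and [measurable]: "m \<in> borel_measurable borel"
    by (auto simp: gauss_positive_def)
  show ?thesis
  proof (rule Bochner_Integration.integrable_bound)
    show "integrable lborel (\<lambda>\<xi>::'a. B * exp (- s * (norm \<xi>)\<^sup>2))"
      by (intro integrable_mult_right integrable_gauss assms)
    show "AE \<xi> in lborel. norm (cis (y \<bullet> \<xi>) * complex_of_real (m \<xi> * exp (- s * (norm \<xi>)\<^sup>2))) \<le> norm (B * exp (- s * (norm \<xi>)\<^sup>2))"
      by (intro AE_I2) (use B in \<open>auto simp: norm_mult abs_mult intro!: mult_right_mono order_trans[OF B]\<close>)
  qed measurable
qed

text \<open>The starting point of the closure argument. The constant 1 is not integrable, and the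
  Gaussian weight in the definition is what admits it.\<close>

lemma gauss_positive_1: "gauss_positive (\<lambda>_::'a::euclidean_space. 1)"
  unfolding gauss_positive_def
proof (intro conjI allI impI)
  fix s :: real and y :: 'a assume "0 < s"
  then show "(LINT \<xi>|lborel. cis (y \<bullet> \<xi>) * complex_of_real (1 * exp (- s * (norm \<xi>)\<^sup>2))) \<in> \<real>\<^sub>\<ge>\<^sub>0"
    unfolding mult_1 integral_gauss_cis[OF \<open>0 < s\<close>] by (simp only: nonneg_Reals_of_real_iff) simp
qed (auto intro!: exI[of _ 1])

lemma gauss_positive_add:
  assumes "gauss_positive m" "gauss_positive m'"
  shows "gauss_positive (\<lambda>\<xi>. m \<xi> + m' \<xi>)"
  unfolding gauss_positive_def
proof (intro conjI allI impI)
  from assms obtain B B' where "\<And>\<xi>. \<bar>m \<xi>\<bar> \<le> B" "\<And>\<xi>. \<bar>m' \<xi>\<bar> \<le> B'" by (auto simp: gauss_positive_def)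
  then have "\<bar>m \<xi> + m' \<xi>\<bar> \<le> B + B'" for \<xi> by (meson abs_triangle_ineq add_mono order_trans)
  then show "\<exists>B. \<forall>\<xi>. \<bar>m \<xi> + m' \<xi>\<bar> \<le> B" by blast
  fix s :: real and y :: 'a assume s: "0 < s"
  have "(LINT \<xi>|lborel. cis (y \<bullet> \<xi>) * complex_of_real ((m \<xi> + m' \<xi>) * exp (- s * (norm \<xi>)\<^sup>2)))
    = (LINT \<xi>|lborel. cis (y \<bullet> \<xi>) * complex_of_real (m \<xi> * exp (- s * (norm \<xi>)\<^sup>2)))
    + (LINT \<xi>|lborel. cis (y \<bullet> \<xi>) * complex_of_real (m' \<xi> * exp (- s * (norm \<xi>)\<^sup>2)))"
    by (subst Bochner_Integration.integral_add[symmetric])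
       (use assms s gauss_positive_integrable in \<open>auto simp: algebra_simps intro!: Bochner_Integration.integral_cong\<close>)
  also have "\<dots> \<in> \<real>\<^sub>\<ge>\<^sub>0" using assms s by (auto simp: gauss_positive_def)
  finally show "(LINT \<xi>|lborel. cis (y \<bullet> \<xi>) * complex_of_real ((m \<xi> + m' \<xi>) * exp (- s * (norm \<xi>)\<^sup>2))) \<in> \<real>\<^sub>\<ge>\<^sub>0" .
qed (intro borel_measurable_add gauss_positive_measurable assms)

lemma gauss_positive_cmult:
  assumes m: "gauss_positive m" and c: "0 \<le> c"
  shows "gauss_positive (\<lambda>\<xi>. c * m \<xi>)"
  unfolding gauss_positive_def
proof (intro conjI allI impI)
  from m obtain B where "\<And>\<xi>. \<bar>m \<xi>\<bar> \<le> B" by (auto simp: gauss_positive_def)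
  then have "\<bar>c * m \<xi>\<bar> \<le> c * B" for \<xi> using c by (simp add: abs_mult mult_left_mono)
  then show "\<exists>B. \<forall>\<xi>. \<bar>c * m \<xi>\<bar> \<le> B" by blast
  fix s :: real and y :: 'a assume s: "0 < s"
  have "(LINT \<xi>|lborel. cis (y \<bullet> \<xi>) * complex_of_real (c * m \<xi> * exp (- s * (norm \<xi>)\<^sup>2)))
    = complex_of_real c * (LINT \<xi>|lborel. cis (y \<bullet> \<xi>) * complex_of_real (m \<xi> * exp (- s * (norm \<xi>)\<^sup>2)))"
    by (subst integral_mult_right_zero[symmetric]) (simp add: mult_ac)
  also have "\<dots> \<in> \<real>\<^sub>\<ge>\<^sub>0" using m s c by (intro nonneg_Reals_mult_I) (auto simp: gauss_positive_def)
  finally show "(LINT \<xi>|lborel. cis (y \<bullet> \<xi>) * complex_of_real (c * m \<xi> * exp (- s * (norm \<xi>)\<^sup>2))) \<in> \<real>\<^sub>\<ge>\<^sub>0" .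
qed (use gauss_positive_measurable[OF m] in auto)

lemma gauss_positive_lim:
  assumes M: "\<And>j. gauss_positive (M j)" and lim: "\<And>\<xi>. (\<lambda>j. M j \<xi>) \<longlonglongrightarrow> m \<xi>"
    and B: "\<And>j \<xi>. \<bar>M j \<xi>\<bar> \<le> B"
  shows "gauss_positive m"
  unfolding gauss_positive_def
proof (intro conjI allI impI)
  have M_meas[measurable]: "M j \<in> borel_measurable borel" for j by (rule gauss_positive_measurable[OF M])
  show meas[measurable]: "m \<in> borel_measurable borel" by (rule borel_measurable_LIMSEQ_real[OF lim]) simp
  have "\<bar>m \<xi>\<bar> \<le> B" for \<xi> by (rule LIMSEQ_le_const2[OF tendsto_rabs[OF lim]]) (use B in auto)
  then show "\<exists>B. \<forall>\<xi>. \<bar>m \<xi>\<bar> \<le> B" by blast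
  fix s :: real and y :: 'a assume s: "0 < s"
  have "(\<lambda>j. LINT \<xi>|lborel. cis (y \<bullet> \<xi>) * complex_of_real (M j \<xi> * exp (- s * (norm \<xi>)\<^sup>2)))
     \<longlonglongrightarrow> (LINT \<xi>|lborel. cis (y \<bullet> \<xi>) * complex_of_real (m \<xi> * exp (- s * (norm \<xi>)\<^sup>2)))"
  proof (rule integral_dominated_convergence)
    show "integrable lborel (\<lambda>\<xi>::'a. B * exp (- s * (norm \<xi>)\<^sup>2))"
      by (intro integrable_mult_right integrable_gauss s)
    show "AE \<xi> in lborel. norm (cis (y \<bullet> \<xi>) * complex_of_real (M j \<xi> * exp (- s * (norm \<xi>)\<^sup>2))) \<le> B * exp (- s * (norm \<xi>)\<^sup>2)" for j
      by (intro AE_I2) (use B in \<open>auto simp: norm_mult abs_mult intro!: mult_right_mono\<close>)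
    show "AE \<xi> in lborel. (\<lambda>j. cis (y \<bullet> \<xi>) * complex_of_real (M j \<xi> * exp (- s * (norm \<xi>)\<^sup>2)))
       \<longlonglongrightarrow> cis (y \<bullet> \<xi>) * complex_of_real (m \<xi> * exp (- s * (norm \<xi>)\<^sup>2))"
      by (intro AE_I2 tendsto_intros lim)
  qed measurable
  then show "(LINT \<xi>|lborel. cis (y \<bullet> \<xi>) * complex_of_real (m \<xi> * exp (- s * (norm \<xi>)\<^sup>2))) \<in> \<real>\<^sub>\<ge>\<^sub>0"
    by (rule closed_sequentially[OF closed_nonneg_Reals_complex, rotated]) (use M s in \<open>auto simp: gauss_positive_def\<close>)
qed

lemma mixture_bounds:
  fixes w :: "real \<Rightarrow> real" and u :: real
  assumes w: "integrable lborel w" "\<And>\<sigma>. 0 \<le> w \<sigma>" "\<And>\<sigma>. \<sigma> < 0 \<Longrightarrow> w \<sigma> = 0" and u: "0 \<le> u"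
  shows "integrable lborel (\<lambda>\<sigma>. w \<sigma> * exp (- \<sigma> * u))"
    and "0 \<le> (LINT \<sigma>|lborel. w \<sigma> * exp (- \<sigma> * u))"
    and "(LINT \<sigma>|lborel. w \<sigma> * exp (- \<sigma> * u)) \<le> integral\<^sup>L lborel w"
proof -
  have [measurable]: "w \<in> borel_measurable borel" using borel_measurable_integrable[OF w(1)] by simp
  have le: "w \<sigma> * exp (- \<sigma> * u) \<le> w \<sigma>" for \<sigma>
    using w(2,3)[of \<sigma>] u by (cases "\<sigma> < 0") (auto intro!: mult_left_le)
  show int: "integrable lborel (\<lambda>\<sigma>. w \<sigma> * exp (- \<sigma> * u))"
    by (rule Bochner_Integration.integrable_bound[OF w(1)]) (use w(2) le in \<open>auto simp: abs_mult\<close>)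
  show "0 \<le> (LINT \<sigma>|lborel. w \<sigma> * exp (- \<sigma> * u))" by (rule Bochner_Integration.integral_nonneg) (use w in auto)
  show "(LINT \<sigma>|lborel. w \<sigma> * exp (- \<sigma> * u)) \<le> integral\<^sup>L lborel w" by (rule integral_mono[OF int w(1) le])
qed

text \<open>By Fubini the mixture is treated one \<sigma> at a time, and then exp (-\<sigma>
  |\<xi>|^2) merges with the weight exp (-s |\<xi>|^2): the integral for m at s + \<sigma> is
  nonnegative by assumption. This is why positivity is demanded for every s > 0.\<close>

lemma gauss_positive_mixture:
  fixes m :: "'a::euclidean_space \<Rightarrow> real"
  assumes m: "gauss_positive m"
    and w: "integrable lborel w" "\<And>\<sigma>. 0 \<le> w \<sigma>" "\<And>\<sigma>. \<sigma> < 0 \<Longrightarrow> w \<sigma> = 0"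
  shows "gauss_positive (\<lambda>\<xi>. m \<xi> * (LINT \<sigma>|lborel. w \<sigma> * exp (- \<sigma> * (norm \<xi>)\<^sup>2)))"
  unfolding gauss_positive_def
proof (intro conjI allI impI)
  have [measurable]: "w \<in> borel_measurable borel" using borel_measurable_integrable[OF w(1)] by simp
  have [measurable]: "m \<in> borel_measurable borel" by (rule gauss_positive_measurable[OF m])
  show "(\<lambda>\<xi>. m \<xi> * (LINT \<sigma>|lborel. w \<sigma> * exp (- \<sigma> * (norm \<xi>)\<^sup>2))) \<in> borel_measurable borel" by measurable
  from m obtain B where B: "\<And>\<xi>. \<bar>m \<xi>\<bar> \<le> B" by (auto simp: gauss_positive_def)
  have "\<bar>m \<xi> * (LINT \<sigma>|lborel. w \<sigma> * exp (- \<sigma> * (norm \<xi>)\<^sup>2))\<bar> \<le> B * integral\<^sup>L lborel w" for \<xi>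
    unfolding abs_mult using mixture_bounds(2,3)[OF w, of "(norm \<xi>)\<^sup>2"] B[of \<xi>] by (intro mult_mono) auto
  then show "\<exists>B. \<forall>\<xi>. \<bar>m \<xi> * (LINT \<sigma>|lborel. w \<sigma> * exp (- \<sigma> * (norm \<xi>)\<^sup>2))\<bar> \<le> B" by blast
  fix s :: real and y :: 'a assume s: "0 < s"
  define F where "F \<xi> \<sigma> = cis (y \<bullet> \<xi>) * complex_of_real (m \<xi> * exp (- s * (norm \<xi>)\<^sup>2)) * complex_of_real (w \<sigma> * exp (- \<sigma> * (norm \<xi>)\<^sup>2))" for \<xi> \<sigma>
  have int: "integrable (lborel \<Otimes>\<^sub>M lborel) (\<lambda>(\<xi>, \<sigma>). F \<xi> \<sigma>)"
  proof (rule Bochner_Integration.integrable_bound)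
    show "integrable (lborel \<Otimes>\<^sub>M lborel) (\<lambda>(\<xi>::'a, \<sigma>). (B * exp (- s * (norm \<xi>)\<^sup>2)) * w \<sigma>)"
      by (intro integrable_pair_mult integrable_mult_right integrable_gauss s w)
    show "(\<lambda>(\<xi>, \<sigma>). F \<xi> \<sigma>) \<in> borel_measurable (lborel \<Otimes>\<^sub>M lborel)" unfolding F_def by measurable
    have "norm (F \<xi> \<sigma>) \<le> norm ((B * exp (- s * (norm \<xi>)\<^sup>2)) * w \<sigma>)" for \<xi> \<sigma>
    proof -
      have "0 \<le> B" using B[of \<xi>] by linarith
      have "norm (F \<xi> \<sigma>) = (\<bar>m \<xi>\<bar> * exp (- s * (norm \<xi>)\<^sup>2)) * (w \<sigma> * exp (- \<sigma> * (norm \<xi>)\<^sup>2))"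
        using w(2) by (simp add: F_def norm_mult abs_mult)
      also have "\<dots> \<le> (B * exp (- s * (norm \<xi>)\<^sup>2)) * w \<sigma>"
      proof (intro mult_mono)
        show "w \<sigma> * exp (- \<sigma> * (norm \<xi>)\<^sup>2) \<le> w \<sigma>"
          using w(2,3)[of \<sigma>] by (cases "\<sigma> < 0") (auto intro!: mult_left_le)
      qed (use B w \<open>0 \<le> B\<close> in auto)
      also have "\<dots> \<le> norm ((B * exp (- s * (norm \<xi>)\<^sup>2)) * w \<sigma>)" unfolding real_norm_def by (rule abs_ge_self)
      finally show ?thesis .
    qed
    then show "AE z in lborel \<Otimes>\<^sub>M lborel. norm (case z of (\<xi>, \<sigma>) \<Rightarrow> F \<xi> \<sigma>) \<le> norm (case z of (\<xi>::'a, \<sigma>) \<Rightarrow> (B * exp (- s * (norm \<xi>)\<^sup>2)) * w \<sigma>)"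
      by (intro AE_I2) auto
  qed
  have "(LINT \<xi>|lborel. cis (y \<bullet> \<xi>) * complex_of_real (m \<xi> * (LINT \<sigma>|lborel. w \<sigma> * exp (- \<sigma> * (norm \<xi>)\<^sup>2)) * exp (- s * (norm \<xi>)\<^sup>2)))
    = (LINT \<xi>|lborel. (LINT \<sigma>|lborel. F \<xi> \<sigma>))"
    unfolding F_def integral_mult_right_zero integral_complex_of_real
    by (intro Bochner_Integration.integral_cong refl) (simp add: mult_ac)
  also have "\<dots> = (LINT \<sigma>|lborel. (LINT \<xi>|lborel. F \<xi> \<sigma>))" by (rule lborel_pair.Fubini_integral[symmetric, OF int])
  also have "\<dots> \<in> \<real>\<^sub>\<ge>\<^sub>0"
  proof (rule integral_nonneg_Reals)
    fix \<sigma> :: real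
    have F: "F \<xi> \<sigma> = complex_of_real (w \<sigma>) * (cis (y \<bullet> \<xi>) * complex_of_real (m \<xi> * exp (- (s + \<sigma>) * (norm \<xi>)\<^sup>2)))" for \<xi>
    proof -
      have "exp (- (s + \<sigma>) * (norm \<xi>)\<^sup>2) = exp (- s * (norm \<xi>)\<^sup>2) * exp (- \<sigma> * (norm \<xi>)\<^sup>2)"
        unfolding exp_add[symmetric] by (rule arg_cong[where f = exp]) (simp add: algebra_simps)
      then show ?thesis unfolding F_def by (simp only: of_real_mult mult_ac)
    qed
    show "(LINT \<xi>|lborel. F \<xi> \<sigma>) \<in> \<real>\<^sub>\<ge>\<^sub>0"
    proof (cases "\<sigma> < 0")
      case False
      then have "(LINT \<xi>|lborel. cis (y \<bullet> \<xi>) * complex_of_real (m \<xi> * exp (- (s + \<sigma>) * (norm \<xi>)\<^sup>2))) \<in> \<real>\<^sub>\<ge>\<^sub>0"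
        using s by (intro gauss_positiveD m) simp
      then show ?thesis unfolding F integral_mult_right_zero using w(2) by (intro nonneg_Reals_mult_I) auto
    qed (simp add: F w)
  qed
  finally show "(LINT \<xi>|lborel. cis (y \<bullet> \<xi>) * complex_of_real (m \<xi> * (LINT \<sigma>|lborel. w \<sigma> * exp (- \<sigma> * (norm \<xi>)\<^sup>2)) * exp (- s * (norm \<xi>)\<^sup>2))) \<in> \<real>\<^sub>\<ge>\<^sub>0" .
qed

text \<open>With \<phi> the Gaussian mixture and W its total weight, the function is exp (\<phi> -
  W), the limit of the N-th powers of (1 - W/N) + \<phi>/N. Multiplication by such a factor
  preserves the class as soon as N \<ge> W. Probabilistically these are the transforms of compound
  Poisson laws with Gaussian jumps.\<close>

lemma gauss_positive_exp_mixture: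
  assumes w: "integrable lborel w" "\<And>\<sigma>. 0 \<le> w \<sigma>" "\<And>\<sigma>. \<sigma> < 0 \<Longrightarrow> w \<sigma> = 0"
  shows "gauss_positive (\<lambda>\<xi>::'a::euclidean_space. exp (- (LINT \<sigma>|lborel. w \<sigma> * (1 - exp (- \<sigma> * (norm \<xi>)\<^sup>2)))))"
proof -
  define W where "W = integral\<^sup>L lborel w"
  define \<phi> where "\<phi> \<xi> = (LINT \<sigma>|lborel. w \<sigma> * exp (- \<sigma> * (norm \<xi>)\<^sup>2))" for \<xi> :: 'a
  have \<phi>: "0 \<le> \<phi> \<xi>" "\<phi> \<xi> \<le> W" for \<xi> unfolding \<phi>_def W_def by (intro mixture_bounds w; simp)+
  have eq: "(LINT \<sigma>|lborel. w \<sigma> * (1 - exp (- \<sigma> * (norm \<xi>)\<^sup>2))) = W - \<phi> \<xi>" for \<xi> :: 'a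
    unfolding W_def \<phi>_def right_diff_distrib mult_1_right
    by (rule Bochner_Integration.integral_diff) (use w mixture_bounds(1)[OF w, of "(norm \<xi>)\<^sup>2"] in auto)
  have step: "gauss_positive (\<lambda>\<xi>. m \<xi> * (a + b * \<phi> \<xi>))" if "gauss_positive m" "0 \<le> a" "0 \<le> b" for m a b
    using gauss_positive_add[OF gauss_positive_cmult[OF that(1,2)] gauss_positive_cmult[OF gauss_positive_mixture[OF that(1) w] that(3)]]
    by (simp add: \<phi>_def algebra_simps)
  have pow: "gauss_positive (\<lambda>\<xi>. (a + b * \<phi> \<xi>) ^ N)" if "0 \<le> a" "0 \<le> b" for a b and N :: nat
    by (induction N) (use gauss_positive_1 step that in \<open>auto simp: power_Suc2 simp del: power_Suc\<close>)
  \<comment> \<open>The shift by N0 keeps 1 - W/N nonnegative from the start of the sequence, so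
    every base lies between 0 and 1.\<close>
  define N0 where "N0 = Suc (nat \<lceil>W\<rceil>)"
  have N0: "0 < N0" "W \<le> real N0" unfolding N0_def by (simp, linarith)
  define M where "M j \<xi> = ((1 - W / real (j + N0)) + (1 / real (j + N0)) * \<phi> \<xi>) ^ (j + N0)" for j \<xi>
  have W: "0 \<le> 1 - W / real (j + N0)" for j using N0 by (simp add: divide_le_eq)
  have e: "(1 - W / real (j + N0)) + (1 / real (j + N0)) * \<phi> \<xi> = 1 + (\<phi> \<xi> - W) / real (j + N0)" for j \<xi>
    by (simp add: diff_divide_distrib)
  have "gauss_positive (\<lambda>\<xi>. exp (\<phi> \<xi> - W))"
  proof (rule gauss_positive_lim)
    show "gauss_positive (M j)" for j
      unfolding M_def[abs_def] by (rule pow[OF W]) simp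
    show "(\<lambda>j. M j \<xi>) \<longlonglongrightarrow> exp (\<phi> \<xi> - W)" for \<xi>
      unfolding M_def e by (rule LIMSEQ_ignore_initial_segment[OF tendsto_exp_limit_sequentially])
    show "\<bar>M j \<xi>\<bar> \<le> 1" for j \<xi>
    proof -
      have 0: "0 \<le> (1 - W / real (j + N0)) + (1 / real (j + N0)) * \<phi> \<xi>"
        by (intro add_nonneg_nonneg mult_nonneg_nonneg W \<phi>) simp
      have "(\<phi> \<xi> - W) / real (j + N0) \<le> 0" using \<phi>(2)[of \<xi>] by (intro divide_nonpos_nonneg) auto
      then have 1: "(1 - W / real (j + N0)) + (1 / real (j + N0)) * \<phi> \<xi> \<le> 1" unfolding e by simp
      show ?thesis unfolding M_def power_abs abs_of_nonneg[OF 0] by (rule power_le_one[OF 0 1])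
    qed
  qed
  then show ?thesis unfolding eq by simp
qed

text \<open>u^\<alpha> is a multiple of the integral of \<sigma>^(-1-\<alpha>) (1 - exp (-\<sigma>
  u)) over \<sigma> > 0, as the substitution \<sigma> / u shows. The weight \<sigma>^(-1-\<alpha>)
  is not integrable at 0, whereas mixtures need integrable weights; hence the truncation at 1/(j+1)
  and the limit.\<close>

lemma powr_eq_subordination:
  fixes \<alpha> :: real
  assumes \<alpha>: "0 < \<alpha>" "\<alpha> < 1"
  obtains c where "0 < c"
    "\<And>u. 0 \<le> u \<Longrightarrow> (\<lambda>j. LINT \<sigma>|lborel. indicator {1 / real (Suc j)..} \<sigma> * \<sigma> powr (- 1 - \<alpha>) * (1 - exp (- \<sigma> * u))) \<longlonglongrightarrow> c * u powr \<alpha>"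
proof -
  define G where "G u \<sigma> = indicator {0<..} \<sigma> * \<sigma> powr (- 1 - \<alpha>) * (1 - exp (- \<sigma> * u))" for u \<sigma> :: real
  have G_meas[measurable]: "G u \<in> borel_measurable borel" for u unfolding G_def by measurable
  have G_nonneg: "0 \<le> G u \<sigma>" if "0 \<le> u" for u \<sigma>
    using that by (cases "0 < \<sigma>") (auto simp: G_def)
  \<comment> \<open>Near 0 the bound 1 - exp (-\<sigma> u) \<le> \<sigma> u leaves
    \<sigma>^(-\<alpha>), integrable since \<alpha> < 1; beyond 1 the factor is at most 1 and
    \<sigma>^(-1-\<alpha>) is integrable since \<alpha> > 0.\<close>
  define H where "H \<sigma> = indicator {0..1} \<sigma> * \<sigma> powr (- \<alpha>) + indicator {1..} \<sigma> * \<sigma> powr (- 1 - \<alpha>)" for \<sigma> :: real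
  have G_le: "G u \<sigma> \<le> (1 + u) * H \<sigma>" if u: "0 \<le> u" for u \<sigma>
  proof -
    consider "\<sigma> \<le> 0" | "0 < \<sigma>" "\<sigma> \<le> 1" | "1 < \<sigma>" by linarith
    then show ?thesis
    proof cases
      case 1 then show ?thesis using u by (simp add: G_def H_def)
    next
      case 2
      have "1 - exp (- \<sigma> * u) \<le> \<sigma> * u" using exp_ge_add_one_self[of "- \<sigma> * u"] by simp
      then have "G u \<sigma> \<le> \<sigma> powr (- 1 - \<alpha>) * (\<sigma> * u)" using 2 by (auto simp: G_def intro!: mult_left_mono)
      also have "\<dots> = u * \<sigma> powr (- \<alpha>)"
      proof -
        have "\<sigma> powr (- 1 - \<alpha>) * \<sigma> powr 1 = \<sigma> powr (- \<alpha>)" unfolding powr_add[symmetric] by simp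
        then show ?thesis using 2 by (simp add: mult_ac)
      qed
      also have "\<dots> \<le> (1 + u) * H \<sigma>" using u 2 by (intro mult_mono) (auto simp: H_def)
      finally show ?thesis .
    next
      case 3
      have "G u \<sigma> \<le> \<sigma> powr (- 1 - \<alpha>) * 1" unfolding G_def using 3 u by (intro mult_mono) auto
      also have "\<dots> \<le> (1 + u) * H \<sigma>" using u 3 by (simp add: H_def mult_le_cancel_right1)
      finally show ?thesis .
    qed
  qed
  have H_int: "integrable lborel H"
  proof -
    have "(\<lambda>\<sigma>. \<sigma> powr (- \<alpha>)) absolutely_integrable_on {0..1}"
      by (intro nonnegative_absolutely_integrable_1 integrable_on_powr_from_0) (use \<alpha> in auto)
    then have 1: "integrable lborel (\<lambda>\<sigma>. indicator {0..1} \<sigma> * \<sigma> powr (- \<alpha>))"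
      by (simp add: set_integrable_def absolutely_integrable_on_def integrable_completion)
    have "(\<lambda>\<sigma>. \<sigma> powr (- 1 - \<alpha>)) absolutely_integrable_on {1..}"
      by (intro nonnegative_absolutely_integrable_1 has_integral_integrable[OF has_integral_powr_to_inf]) (use \<alpha> in auto)
    then have 2: "integrable lborel (\<lambda>\<sigma>. indicator {1..} \<sigma> * \<sigma> powr (- 1 - \<alpha>))"
      by (simp add: set_integrable_def absolutely_integrable_on_def integrable_completion)
    show ?thesis unfolding H_def using 1 2 by (rule Bochner_Integration.integrable_add)
  qed
  have G_int: "integrable lborel (G u)" if "0 \<le> u" for u
  proof (rule Bochner_Integration.integrable_bound)
    show "integrable lborel (\<lambda>\<sigma>. (1 + u) * H \<sigma>)" using H_int by simp
    show "AE \<sigma> in lborel. norm (G u \<sigma>) \<le> norm ((1 + u) * H \<sigma>)"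
      using order_trans[OF G_le[OF that] abs_ge_self] G_nonneg[OF that] by (intro AE_I2) simp
  qed simp
  \<comment> \<open>The value at u = 1. It is positive because the integrand is positive on (0,1),
    and scaling reduces every other u to it.\<close>
  define c where "c = integral\<^sup>L lborel (G 1)"
  have "0 \<le> c" unfolding c_def using G_nonneg by (intro Bochner_Integration.integral_nonneg) auto
  moreover have "c \<noteq> 0"
  proof
    assume "c = 0"
    then have "AE \<sigma> in lborel. G 1 \<sigma> = 0"
      unfolding c_def using integral_nonneg_eq_0_iff_AE[OF G_int[of 1]] G_nonneg[of 1] by simp
    then have "AE \<sigma> in lborel. \<sigma> \<notin> {0<..<1::real}"
      by eventually_elim (auto simp: G_def)
    then have "{0<..<1::real} \<in> null_sets lborel" by (subst AE_iff_null_sets) auto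
    then show False by (auto simp: null_sets_def)
  qed
  ultimately have c: "0 < c" by simp
  have scale: "integral\<^sup>L lborel (G u) = c * u powr \<alpha>" if "0 \<le> u" for u
  proof (cases "u = 0")
    case False
    then have u: "0 < u" using that by simp
    have eq: "G u (0 + 1 / u * \<sigma>) = u powr (1 + \<alpha>) * G 1 \<sigma>" for \<sigma>
    proof (cases "0 < \<sigma>")
      case True
      have "(1 / u * \<sigma>) powr (- 1 - \<alpha>) = u powr (1 + \<alpha>) * \<sigma> powr (- 1 - \<alpha>)"
        using u True powr_minus_divide[of u "1 + \<alpha>"] by (simp add: powr_divide)
      then show ?thesis using u True by (simp add: G_def)
    next
      case False
      then show ?thesis using u by (simp add: G_def zero_less_divide_iff)
    qed
    have "integral\<^sup>L lborel (G u) = (1 / u) * (u powr (1 + \<alpha>) * c)"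
      using lborel_integral_real_affine[of "1 / u" "G u" 0] u unfolding eq by (simp add: c_def)
    also have "\<dots> = c * u powr \<alpha>" using u by (simp add: powr_add)
    finally show ?thesis .
  qed (simp add: G_def[abs_def])
  have "(\<lambda>j. LINT \<sigma>|lborel. indicator {1 / real (Suc j)..} \<sigma> * \<sigma> powr (- 1 - \<alpha>) * (1 - exp (- \<sigma> * u))) \<longlonglongrightarrow> c * u powr \<alpha>"
    if u: "0 \<le> u" for u
    unfolding scale[OF u, symmetric]
  proof (rule integral_dominated_convergence)
    show "integrable lborel (G u)" by (rule G_int[OF u])
    show "AE \<sigma> in lborel. norm (indicator {1 / real (Suc j)..} \<sigma> * \<sigma> powr (- 1 - \<alpha>) * (1 - exp (- \<sigma> * u))) \<le> G u \<sigma>" for j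
    proof (rule AE_I2)
      fix \<sigma> :: real
      have "0 < \<sigma>" if "1 / real (Suc j) \<le> \<sigma>" using that less_le_trans[of 0 "1 / real (Suc j)" \<sigma>] by simp
      then show "norm (indicator {1 / real (Suc j)..} \<sigma> * \<sigma> powr (- 1 - \<alpha>) * (1 - exp (- \<sigma> * u))) \<le> G u \<sigma>"
        using G_nonneg[OF u, of \<sigma>] u by (auto simp: G_def indicator_def abs_mult)
    qed
    show "AE \<sigma> in lborel. (\<lambda>j. indicator {1 / real (Suc j)..} \<sigma> * \<sigma> powr (- 1 - \<alpha>) * (1 - exp (- \<sigma> * u))) \<longlonglongrightarrow> G u \<sigma>"
    proof (rule AE_I2)
      fix \<sigma> :: real
      have "\<forall>\<^sub>F j in sequentially. indicator {1 / real (Suc j)..} \<sigma> = (indicator {0<..} \<sigma> :: real)"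
      proof (cases "0 < \<sigma>")
        case True
        have "\<forall>\<^sub>F j in sequentially. 1 / real (Suc j) < \<sigma>"
          using LIMSEQ_inverse_real_of_nat True by (auto simp: order_tendsto_iff inverse_eq_divide)
        then show ?thesis by eventually_elim (use True in auto)
      next
        case False
        have "\<not> 1 / real (Suc j) \<le> \<sigma>" for j
          using False less_le_trans[of 0 "1 / real (Suc j)" \<sigma>] by (auto simp del: of_nat_Suc)
        then show ?thesis using False by simp
      qed
      then show "(\<lambda>j. indicator {1 / real (Suc j)..} \<sigma> * \<sigma> powr (- 1 - \<alpha>) * (1 - exp (- \<sigma> * u))) \<longlonglongrightarrow> G u \<sigma>"
        by (intro tendsto_eventually) (auto simp: G_def elim!: eventually_mono)
    qed
  qed measurable
  then show ?thesis using that[OF c] by blast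
qed

text \<open>For \<alpha> < 1 the truncated subordination integrals, divided by c, are exponents of
  compound Poisson type and converge to |\<xi>|^(2\<alpha>). At \<alpha> = 1 the subordination
  integral diverges, but there the symbol is itself a Gaussian and merges with the weight.\<close>

lemma gauss_positive_exp_neg_powr:
  assumes \<alpha>: "0 < \<alpha>" "\<alpha> \<le> 1"
  shows "gauss_positive (\<lambda>\<xi>::'a::euclidean_space. exp (- (norm \<xi> powr (2 * \<alpha>))))"
proof (cases "\<alpha> = 1")
  case True
  have "(\<lambda>\<xi>::'a. exp (- (norm \<xi> powr (2 * \<alpha>)))) = (\<lambda>\<xi>. exp (- 1 * (norm \<xi>)\<^sup>2))"
    using True by (auto simp: powr_numeral)
  moreover have "gauss_positive (\<lambda>\<xi>::'a. exp (- 1 * (norm \<xi>)\<^sup>2))"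
    unfolding gauss_positive_def
  proof (intro conjI allI impI)
    fix s :: real and y :: 'a assume s: "0 < s"
    have eq: "exp (- 1 * (norm \<xi>)\<^sup>2) * exp (- s * (norm \<xi>)\<^sup>2) = 1 * exp (- (1 + s) * (norm \<xi>)\<^sup>2)" for \<xi> :: 'a
      by (simp add: exp_add[symmetric] ring_distribs)
    show "(LINT \<xi>|lborel. cis (y \<bullet> \<xi>) * complex_of_real (exp (- 1 * (norm \<xi>)\<^sup>2) * exp (- s * (norm \<xi>)\<^sup>2))) \<in> \<real>\<^sub>\<ge>\<^sub>0"
      unfolding eq using s by (intro gauss_positiveD gauss_positive_1) simp
  qed (auto intro!: exI[of _ 1])
  ultimately show ?thesis by simp
next
  case False
  then obtain c where c: "0 < c"
    "\<And>u. 0 \<le> u \<Longrightarrow> (\<lambda>j. LINT \<sigma>|lborel. indicator {1 / real (Suc j)..} \<sigma> * \<sigma> powr (- 1 - \<alpha>) * (1 - exp (- \<sigma> * u))) \<longlonglongrightarrow> c * u powr \<alpha>"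
    by (rule_tac powr_eq_subordination[of \<alpha>]) (use \<alpha> in auto)
  define w where "w j \<sigma> = indicator {1 / real (Suc j)..} \<sigma> * \<sigma> powr (- 1 - \<alpha>) / c" for j \<sigma>
  have int: "integrable lborel (w j)" for j
  proof -
    have "(\<lambda>\<sigma>. \<sigma> powr (- 1 - \<alpha>)) absolutely_integrable_on {1 / real (Suc j)..}"
      by (intro nonnegative_absolutely_integrable_1 has_integral_integrable[OF has_integral_powr_to_inf]) (use \<alpha> in auto)
    then have "integrable lborel (\<lambda>\<sigma>. indicator {1 / real (Suc j)..} \<sigma> * \<sigma> powr (- 1 - \<alpha>))"
      by (simp add: set_integrable_def absolutely_integrable_on_def integrable_completion)
    then show ?thesis unfolding w_def by simp
  qed
  have pos: "0 < \<sigma>" if "1 / real (Suc j) \<le> \<sigma>" for j \<sigma>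
    using that less_le_trans[of 0 "1 / real (Suc j)" \<sigma>] by simp
  have w0: "0 \<le> w j \<sigma>" for j \<sigma> using c(1) by (simp add: w_def)
  have w1: "w j \<sigma> = 0" if "\<sigma> < 0" for j \<sigma>
    using pos[of j \<sigma>] that unfolding w_def indicator_def by (cases "1 / real (Suc j) \<le> \<sigma>") simp_all
  define M where "M j \<xi> = exp (- (LINT \<sigma>|lborel. w j \<sigma> * (1 - exp (- \<sigma> * (norm \<xi>)\<^sup>2))))" for j and \<xi> :: 'a
  show ?thesis
  proof (rule gauss_positive_lim)
    show "gauss_positive (M j)" for j unfolding M_def[abs_def] by (rule gauss_positive_exp_mixture[OF int w0 w1])
    show "(\<lambda>j. M j \<xi>) \<longlonglongrightarrow> exp (- (norm \<xi> powr (2 * \<alpha>)))" for \<xi>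
    proof -
      have "(\<lambda>j. (LINT \<sigma>|lborel. indicator {1 / real (Suc j)..} \<sigma> * \<sigma> powr (- 1 - \<alpha>) * (1 - exp (- \<sigma> * (norm \<xi>)\<^sup>2))) / c)
          \<longlonglongrightarrow> c * (norm \<xi>)\<^sup>2 powr \<alpha> / c"
        using c by (intro tendsto_divide tendsto_const c(2)) auto
      moreover have "(LINT \<sigma>|lborel. indicator {1 / real (Suc j)..} \<sigma> * \<sigma> powr (- 1 - \<alpha>) * (1 - exp (- \<sigma> * (norm \<xi>)\<^sup>2))) / c
          = (LINT \<sigma>|lborel. w j \<sigma> * (1 - exp (- \<sigma> * (norm \<xi>)\<^sup>2)))" for j
        unfolding w_def integral_divide_zero[symmetric] by (simp only: times_divide_eq_left)
      moreover have "(norm \<xi>)\<^sup>2 powr \<alpha> = norm \<xi> powr (2 * \<alpha>)"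
      proof -
        have "(norm \<xi>)\<^sup>2 = norm \<xi> powr 2" by simp
        then show ?thesis by (simp only: powr_powr)
      qed
      ultimately show ?thesis unfolding M_def using c(1) by (intro tendsto_exp tendsto_minus) simp
    qed
    show "\<bar>M j \<xi>\<bar> \<le> 1" for j \<xi>
    proof -
      have "0 \<le> (LINT \<sigma>|lborel. w j \<sigma> * (1 - exp (- \<sigma> * (norm \<xi>)\<^sup>2)))"
      proof (rule integral_nonneg_AE, rule AE_I2)
        fix \<sigma> show "0 \<le> w j \<sigma> * (1 - exp (- \<sigma> * (norm \<xi>)\<^sup>2))"
          using w0[of j \<sigma>] w1[of \<sigma> j] by (cases "\<sigma> < 0") auto
      qed
      then show ?thesis by (simp add: M_def)
    qed
  qed
qed

text \<open>For integrable m the Gaussian weight can be removed: it tends to 1 as s = 1/(j+1) tends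
  to 0, with |m| as dominating function.\<close>

lemma fourier_nonneg_of_gauss_positive:
  fixes m :: "'a::euclidean_space \<Rightarrow> real"
  assumes m: "gauss_positive m" "integrable lborel m"
  shows "(LINT \<xi>|lborel. cis (y \<bullet> \<xi>) * complex_of_real (m \<xi>)) \<in> \<real>\<^sub>\<ge>\<^sub>0"
proof -
  have [measurable]: "m \<in> borel_measurable borel" by (rule gauss_positive_measurable[OF m(1)])
  have lim: "(\<lambda>j. LINT \<xi>|lborel. cis (y \<bullet> \<xi>) * complex_of_real (m \<xi> * exp (- (1 / real (Suc j)) * (norm \<xi>)\<^sup>2)))
     \<longlonglongrightarrow> (LINT \<xi>|lborel. cis (y \<bullet> \<xi>) * complex_of_real (m \<xi>))"
  proof (rule integral_dominated_convergence)
    show "integrable lborel (\<lambda>\<xi>. norm (m \<xi>))" using m(2) by simp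
    show "AE \<xi> in lborel. norm (cis (y \<bullet> \<xi>) * complex_of_real (m \<xi> * exp (- (1 / real (Suc j)) * (norm \<xi>)\<^sup>2))) \<le> norm (m \<xi>)" for j
      by (intro AE_I2) (auto simp: norm_mult abs_mult intro!: mult_left_le)
    show "AE \<xi> in lborel. (\<lambda>j. cis (y \<bullet> \<xi>) * complex_of_real (m \<xi> * exp (- (1 / real (Suc j)) * (norm \<xi>)\<^sup>2)))
       \<longlonglongrightarrow> cis (y \<bullet> \<xi>) * complex_of_real (m \<xi>)"
    proof (rule AE_I2)
      fix \<xi> :: 'a
      have *: "(\<lambda>j. exp (- (1 / real (Suc j)) * (norm \<xi>)\<^sup>2)) \<longlonglongrightarrow> exp (- 0 * (norm \<xi>)\<^sup>2)"
        by (intro tendsto_intros LIMSEQ_inverse_real_of_nat[unfolded inverse_eq_divide])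
      have "(\<lambda>j. cis (y \<bullet> \<xi>) * complex_of_real (m \<xi> * exp (- (1 / real (Suc j)) * (norm \<xi>)\<^sup>2)))
       \<longlonglongrightarrow> cis (y \<bullet> \<xi>) * complex_of_real (m \<xi> * exp (- 0 * (norm \<xi>)\<^sup>2))"
        by (intro tendsto_mult tendsto_const tendsto_of_real *)
      then show "(\<lambda>j. cis (y \<bullet> \<xi>) * complex_of_real (m \<xi> * exp (- (1 / real (Suc j)) * (norm \<xi>)\<^sup>2)))
       \<longlonglongrightarrow> cis (y \<bullet> \<xi>) * complex_of_real (m \<xi>)" by simp
    qed
  qed measurable
  show ?thesis
    by (rule closed_sequentially[OF closed_nonneg_Reals_complex _ lim]) (intro gauss_positiveD m, simp)
qed

text \<open>The transform k of m is nonnegative, so its modulus can be integrated against a Gaussian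
  by Fubini, which moves the transform from m to the Gaussian. As m \<le> 1, the result is at most
  the mass of the transformed Gaussian, and this is (2\<pi>)^n for every width. Fatou's lemma then
  removes the Gaussian. Without positivity the modulus could not be exchanged for k itself.\<close>

lemma nn_integral_fourier_le:
  fixes m :: "'a::euclidean_space \<Rightarrow> real"
  assumes m: "gauss_positive m" "integrable lborel m" "\<And>\<xi>. 0 \<le> m \<xi>" "\<And>\<xi>. m \<xi> \<le> 1"
  shows "(\<integral>\<^sup>+y. ennreal (norm (LINT \<xi>|lborel. cis (y \<bullet> \<xi>) * complex_of_real (m \<xi>))) \<partial>lborel) \<le> ennreal ((2 * pi) ^ DIM('a))"
proof -
  have [measurable]: "m \<in> borel_measurable borel" by (rule gauss_positive_measurable[OF m(1)])
  define k where "k y = (LINT \<xi>|lborel. cis (y \<bullet> \<xi>) * complex_of_real (m \<xi>))" for y :: 'a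
  have [measurable]: "k \<in> borel_measurable borel" unfolding k_def by measurable
  have k: "k y = complex_of_real (norm (k y))" for y
    unfolding k_def by (intro nonneg_Reals_eq_norm fourier_nonneg_of_gauss_positive m)
  have k_le: "norm (k y) \<le> integral\<^sup>L lborel m" for y
  proof -
    have "norm (k y) \<le> (LINT \<xi>|lborel. norm (cis (y \<bullet> \<xi>) * complex_of_real (m \<xi>)))"
      unfolding k_def by (rule integral_norm_bound)
    then show ?thesis using m(3) by (simp add: norm_mult)
  qed
  have gauss: "(\<integral>\<^sup>+y. ennreal (norm (k y) * exp (- s * (norm y)\<^sup>2)) \<partial>lborel) \<le> ennreal ((2 * pi) ^ DIM('a))"
    if s: "0 < s" for s
  proof -
    define F where "F y \<xi> = cis (y \<bullet> \<xi>) * complex_of_real (m \<xi>) * complex_of_real (exp (- s * (norm y)\<^sup>2))" for y \<xi> :: 'a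
    have int: "integrable (lborel \<Otimes>\<^sub>M lborel) (\<lambda>(y, \<xi>). F y \<xi>)"
    proof (rule Bochner_Integration.integrable_bound)
      show "integrable (lborel \<Otimes>\<^sub>M lborel) (\<lambda>(y::'a, \<xi>). exp (- s * (norm y)\<^sup>2) * m \<xi>)"
        by (intro integrable_pair_mult integrable_gauss s m)
      show "(\<lambda>(y, \<xi>). F y \<xi>) \<in> borel_measurable (lborel \<Otimes>\<^sub>M lborel)" unfolding F_def by measurable
      show "AE z in lborel \<Otimes>\<^sub>M lborel. norm (case z of (y, \<xi>) \<Rightarrow> F y \<xi>) \<le> norm (case z of (y::'a, \<xi>) \<Rightarrow> exp (- s * (norm y)\<^sup>2) * m \<xi>)"
        by (intro AE_I2) (auto simp: F_def norm_mult abs_mult)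
    qed
    have kint: "integrable lborel (\<lambda>y. norm (k y) * exp (- s * (norm y)\<^sup>2))"
    proof (rule Bochner_Integration.integrable_bound)
      show "integrable lborel (\<lambda>y::'a. integral\<^sup>L lborel m * exp (- s * (norm y)\<^sup>2))"
        by (intro integrable_mult_right integrable_gauss s)
      show "AE y in lborel. norm (norm (k y) * exp (- s * (norm y)\<^sup>2)) \<le> norm (integral\<^sup>L lborel m * exp (- s * (norm y)\<^sup>2))"
        by (intro AE_I2) (auto simp: abs_mult intro!: mult_right_mono order_trans[OF k_le])
    qed measurable
    have "complex_of_real (LINT y|lborel. norm (k y) * exp (- s * (norm y)\<^sup>2))
      = (LINT y|lborel. k y * complex_of_real (exp (- s * (norm y)\<^sup>2)))"
      unfolding integral_complex_of_real[symmetric] by (subst (2) k) simp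
    also have "\<dots> = (LINT y|lborel. (LINT \<xi>|lborel. F y \<xi>))"
      unfolding F_def integral_mult_left_zero k_def ..
    also have "\<dots> = (LINT \<xi>|lborel. (LINT y|lborel. F y \<xi>))"
      by (rule lborel_pair.Fubini_integral[symmetric, OF int])
    also have "\<dots> = (LINT \<xi>|lborel. complex_of_real (m \<xi> * (sqrt (pi / s) ^ DIM('a) * exp (- (norm \<xi>)\<^sup>2 / (4 * s)))))"
    proof (intro Bochner_Integration.integral_cong refl)
      fix \<xi> :: 'a
      have "(LINT y|lborel. F y \<xi>) = (LINT y|lborel. complex_of_real (m \<xi>) * (cis (\<xi> \<bullet> y) * complex_of_real (exp (- s * (norm y)\<^sup>2))))"
        by (intro Bochner_Integration.integral_cong refl) (simp add: F_def inner_commute mult_ac)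
      then show "(LINT y|lborel. F y \<xi>) = complex_of_real (m \<xi> * (sqrt (pi / s) ^ DIM('a) * exp (- (norm \<xi>)\<^sup>2 / (4 * s))))"
        unfolding integral_mult_right_zero integral_gauss_cis[OF s] by simp
    qed
    also have "\<dots> = complex_of_real (LINT \<xi>|lborel. m \<xi> * (sqrt (pi / s) ^ DIM('a) * exp (- (norm \<xi>)\<^sup>2 / (4 * s))))"
      by (rule integral_complex_of_real)
    finally have "(LINT y|lborel. norm (k y) * exp (- s * (norm y)\<^sup>2))
      = (LINT \<xi>|lborel. m \<xi> * (sqrt (pi / s) ^ DIM('a) * exp (- (norm \<xi>)\<^sup>2 / (4 * s))))"
      by (simp only: of_real_eq_iff)
    also have "\<dots> \<le> (LINT \<xi>|lborel. sqrt (pi / s) ^ DIM('a) * exp (- (1 / (4 * s)) * (norm (\<xi>::'a))\<^sup>2))"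
    proof (rule integral_mono)
      have gi: "integrable lborel (\<lambda>\<xi>::'a. sqrt (pi / s) ^ DIM('a) * exp (- (1 / (4 * s)) * (norm \<xi>)\<^sup>2))"
        using s by (intro integrable_mult_right integrable_gauss) simp
      then show "integrable lborel (\<lambda>\<xi>::'a. sqrt (pi / s) ^ DIM('a) * exp (- (1 / (4 * s)) * (norm \<xi>)\<^sup>2))" .
      show le: "m \<xi> * (sqrt (pi / s) ^ DIM('a) * exp (- (norm \<xi>)\<^sup>2 / (4 * s))) \<le> sqrt (pi / s) ^ DIM('a) * exp (- (1 / (4 * s)) * (norm \<xi>)\<^sup>2)" for \<xi>
        using m(3,4)[of \<xi>] s by (simp add: mult_right_le_one_le mult_left_le_one_le)
      show "integrable lborel (\<lambda>\<xi>. m \<xi> * (sqrt (pi / s) ^ DIM('a) * exp (- (norm \<xi>)\<^sup>2 / (4 * s))))"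
        by (rule Bochner_Integration.integrable_bound[OF gi])
           (use le m(3) s in \<open>auto simp del: times_divide_eq_left intro!: AE_I2 order_trans[OF _ le] simp: abs_mult\<close>)
    qed
    \<comment> \<open>The two Gaussian normalisations, per dimension sqrt (\<pi>/s) and sqrt (4
      \<pi> s), multiply to 2\<pi>; the dependence on s cancels.\<close>
    also have "\<dots> = sqrt (pi / s) ^ DIM('a) * sqrt (pi / (1 / (4 * s))) ^ DIM('a)"
      using s by (subst integral_mult_right_zero, subst integral_gauss) auto
    also have "\<dots> = (2 * pi) ^ DIM('a)"
    proof -
      have "sqrt (pi / s) * sqrt (pi / (1 / (4 * s))) = sqrt ((2 * pi)\<^sup>2)"
        unfolding real_sqrt_mult[symmetric] using s by (simp add: power2_eq_square)
      also have "\<dots> = 2 * pi" by (rule real_sqrt_unique) auto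
      finally show ?thesis unfolding power_mult_distrib[symmetric] by (simp only:)
    qed
    finally show ?thesis
      by (subst nn_integral_eq_integral[OF kint]) (auto intro: ennreal_leI)
  qed
  have "(\<integral>\<^sup>+y. ennreal (norm (k y)) \<partial>lborel)
     = (\<integral>\<^sup>+y. liminf (\<lambda>j. ennreal (norm (k y) * exp (- (1 / real (Suc j)) * (norm y)\<^sup>2))) \<partial>lborel)"
  proof (intro nn_integral_cong)
    fix y :: 'a
    have "(\<lambda>j. norm (k y) * exp (- (1 / real (Suc j)) * (norm y)\<^sup>2)) \<longlonglongrightarrow> norm (k y) * exp (- 0 * (norm y)\<^sup>2)"
      by (intro tendsto_intros LIMSEQ_inverse_real_of_nat[unfolded inverse_eq_divide])
    then have "(\<lambda>j. ennreal (norm (k y) * exp (- (1 / real (Suc j)) * (norm y)\<^sup>2))) \<longlonglongrightarrow> ennreal (norm (k y))"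
      by (intro tendsto_ennrealI) simp
    then show "ennreal (norm (k y)) = liminf (\<lambda>j. ennreal (norm (k y) * exp (- (1 / real (Suc j)) * (norm y)\<^sup>2)))"
      by (intro lim_imp_Liminf[symmetric]) auto
  qed
  also have "\<dots> \<le> liminf (\<lambda>j. \<integral>\<^sup>+y. ennreal (norm (k y) * exp (- (1 / real (Suc j)) * (norm y)\<^sup>2)) \<partial>lborel)"
    by (rule nn_integral_liminf) measurable
  also have "\<dots> \<le> ennreal ((2 * pi) ^ DIM('a))"
    by (rule order_trans[OF Liminf_le_Limsup Limsup_bounded], simp, rule always_eventually, rule allI, rule gauss) simp
  finally show ?thesis unfolding k_def .
qed

lemma integral_lborel_affine:
  fixes f :: "'a::euclidean_space \<Rightarrow> 'b::{banach, second_countable_topology}"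
  assumes c: "c \<noteq> 0" and [measurable]: "f \<in> borel_measurable borel"
  shows "(LINT x|lborel. f (t + c *\<^sub>R x)) = (1 / \<bar>c\<bar> ^ DIM('a)) *\<^sub>R (LINT x|lborel. f x)"
proof -
  have "(LINT x|lborel. f x) = (LINT x|density (distr lborel borel (\<lambda>x. t + c *\<^sub>R x)) (\<lambda>_. \<bar>c\<bar> ^ DIM('a)). f x)"
    using lborel_affine[OF c, of t] by simp
  also have "\<dots> = \<bar>c\<bar> ^ DIM('a) *\<^sub>R (LINT x|lborel. f (t + c *\<^sub>R x))"
    using c by (subst integral_density) (simp_all add: integral_distr)
  finally show ?thesis using c by simp
qed

subsection \<open>The heat semigroup as an averaging operator\<close>

lemma heat_kernel_bounded_kernel:
  assumes \<alpha>: "0 < \<alpha>" "\<alpha> \<le> 1"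
  obtains A B where "bounded_kernel (\<lambda>x::'a::euclidean_space. norm (heat_kernel \<alpha> 1 x)) A B"
proof -
  define m where "m \<xi> = exp (- (norm \<xi> powr (2 * \<alpha>)))" for \<xi> :: 'a
  define c where "c = (2 * pi) powr (- (real DIM('a) / 2))"
  have c: "0 < c" by (simp add: c_def)
  have m: "gauss_positive m" "integrable lborel m" "\<And>\<xi>. 0 \<le> m \<xi>" "\<And>\<xi>. m \<xi> \<le> 1"
    using gauss_positive_exp_neg_powr[OF \<alpha>] integrable_exp_neg_powr[OF \<alpha>(1)] by (auto simp: m_def[abs_def])
  have [measurable]: "m \<in> borel_measurable borel" by (rule gauss_positive_measurable[OF m(1)])
  define k where "k y = (LINT \<xi>|lborel. cis (y \<bullet> \<xi>) * complex_of_real (m \<xi>))" for y :: 'a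
  have k[measurable]: "k \<in> borel_measurable borel" unfolding k_def by measurable
  have hk: "norm (heat_kernel \<alpha> 1 x) = c * norm (k x)" for x :: 'a
    unfolding heat_kernel_def inv_fourier_def k_def m_def c_def by (simp add: norm_mult)
  have le: "norm (k y) \<le> integral\<^sup>L lborel m" for y
  proof -
    have "norm (k y) \<le> (LINT \<xi>|lborel. norm (cis (y \<bullet> \<xi>) * complex_of_real (m \<xi>)))"
      unfolding k_def by (rule integral_norm_bound)
    then show ?thesis using m(3) by (simp add: norm_mult)
  qed
  \<comment> \<open>The summand 1 makes the sup bound positive without a lower bound for the
    integral of m.\<close>
  have "bounded_kernel (\<lambda>x::'a. c * norm (k x)) (c * (2 * pi) ^ DIM('a)) (c * integral\<^sup>L lborel m + 1)"
  proof
    show "(\<lambda>x. c * norm (k x)) \<in> borel_measurable borel" by measurable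
    show "0 \<le> c * norm (k x)" for x using c by simp
    show "c * norm (k x) \<le> c * integral\<^sup>L lborel m + 1" for x
      using mult_left_mono[OF le[of x], of c] c by linarith
    have "(\<integral>\<^sup>+x. ennreal (c * norm (k x)) \<partial>lborel) = ennreal c * (\<integral>\<^sup>+x. ennreal (norm (k x)) \<partial>lborel)"
      using c by (simp add: ennreal_mult nn_integral_cmult)
    also have "\<dots> \<le> ennreal c * ennreal ((2 * pi) ^ DIM('a))"
      using nn_integral_fourier_le[OF m] unfolding k_def by (intro mult_left_mono) auto
    finally show "(\<integral>\<^sup>+x. ennreal (c * norm (k x)) \<partial>lborel) \<le> ennreal (c * (2 * pi) ^ DIM('a))"
      using c by (simp add: ennreal_mult)
    show "0 < c * (2 * pi) ^ DIM('a)" using c by simp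
    have "0 \<le> integral\<^sup>L lborel m" using m(3) by (intro Bochner_Integration.integral_nonneg)
    then show "0 < c * integral\<^sup>L lborel m + 1" using c by (intro add_nonneg_pos mult_nonneg_nonneg) auto
  qed
  then show ?thesis using that by (simp add: hk)
qed

text \<open>The substitution \<eta> = t \<xi>. It is the reason for evaluating at t^(2\<alpha>): the
  kernel at that time is the dilate by t of the kernel at time 1.\<close>

lemma heat_kernel_scale:
  assumes t: "0 < t"
  shows "heat_kernel \<alpha> (t powr (2 * \<alpha>)) (x::'a::euclidean_space) = (1 / t ^ DIM('a)) *\<^sub>R heat_kernel \<alpha> 1 (x /\<^sub>R t)"
proof -
  define f where "f \<eta> = cis ((x /\<^sub>R t) \<bullet> \<eta>) * complex_of_real (exp (- 1 * norm \<eta> powr (2 * \<alpha>)))" for \<eta>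
  have [measurable]: "f \<in> borel_measurable borel" unfolding f_def by measurable
  have "cis (x \<bullet> \<xi>) * complex_of_real (exp (- (t powr (2 * \<alpha>)) * norm \<xi> powr (2 * \<alpha>))) = f (t *\<^sub>R \<xi>)" for \<xi>
    using t by (simp add: f_def powr_mult mult.assoc[symmetric])
  then have "(LINT \<xi>|lborel. cis (x \<bullet> \<xi>) * complex_of_real (exp (- (t powr (2 * \<alpha>)) * norm \<xi> powr (2 * \<alpha>))))
     = (1 / t ^ DIM('a)) *\<^sub>R (LINT \<eta>|lborel. f \<eta>)"
    using integral_lborel_affine[of t f 0] t by simp
  then show ?thesis unfolding heat_kernel_def inv_fourier_def f_def by (simp add: scaleR_conv_of_real)
qed

lemma norm_heat_semigroup_le:
  fixes f :: "'a::euclidean_space \<Rightarrow> complex"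
  assumes k: "bounded_kernel (\<lambda>x::'a. norm (heat_kernel \<alpha> 1 x)) A B" and t: "0 < t"
  shows "ennreal (norm (heat_semigroup \<alpha> (t powr (2 * \<alpha>)) f x))
    \<le> bounded_kernel.avg (\<lambda>x. norm (heat_kernel \<alpha> 1 x)) t (\<lambda>y. ennreal (norm (f y))) x"
proof -
  interpret bounded_kernel "\<lambda>x::'a. norm (heat_kernel \<alpha> 1 x)" A B by (rule k)
  let ?I = "\<lambda>y. heat_kernel \<alpha> (t powr (2 * \<alpha>)) (x - y) * f y"
  \<comment> \<open>A divergent Bochner integral is 0 by convention, so the bound is trivial in that
    case.\<close>
  have "ennreal (norm (integral\<^sup>L lborel ?I)) \<le> (\<integral>\<^sup>+y. ennreal (norm (?I y)) \<partial>lborel)"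
    by (cases "integrable lborel ?I") (simp_all add: integral_norm_bound_ennreal not_integrable_integral_eq)
  also have "\<dots> = avg t (\<lambda>y. ennreal (norm (f y))) x"
    unfolding avg_def heat_kernel_scale[OF t]
    by (intro nn_integral_cong) (use t in \<open>simp add: norm_mult ennreal_mult[symmetric]\<close>)
  finally show ?thesis unfolding heat_semigroup_def .
qed

subsection \<open>Test functions and Fourier inversion\<close>

abbreviation partial :: "('a::euclidean_space \<Rightarrow> complex) \<Rightarrow> 'a \<Rightarrow> 'a \<Rightarrow> complex" where
  "partial f v \<equiv> \<lambda>x. frechet_derivative f (at x) v"

lemma test_functions_Ck: "f \<in> test_functions \<Longrightarrow> Ck k f"
  by (simp add: test_functions_def)

lemma test_functions_continuous: "f \<in> test_functions \<Longrightarrow> continuous_on UNIV f"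
  using test_functions_Ck[of f 0] by simp

lemma test_functions_differentiable: "f \<in> test_functions \<Longrightarrow> f differentiable (at x)"
  using test_functions_Ck[of f "Suc 0"] by simp

lemma test_functions_measurable [measurable_dest]: "f \<in> test_functions \<Longrightarrow> f \<in> borel_measurable borel"
  by (intro borel_measurable_continuous_onI test_functions_continuous)

lemma test_functions_support:
  assumes "f \<in> test_functions"
  obtains R where "0 < R" "\<And>x. R < norm x \<Longrightarrow> f x = 0"
proof -
  have "bounded (closure {x. f x \<noteq> 0})" using assms by (simp add: test_functions_def compact_imp_bounded)
  then obtain R where R: "0 < R" "\<And>x. x \<in> closure {x. f x \<noteq> 0} \<Longrightarrow> norm x \<le> R"
    by (auto simp: bounded_pos)
  have "f x = 0" if "R < norm x" for x
    using R(2)[of x] that closure_subset[of "{x. f x \<noteq> 0}"] by force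
  then show ?thesis using that R(1) by blast
qed

lemma test_functions_bounded:
  assumes "f \<in> test_functions"
  obtains B where "\<And>x. norm (f x) \<le> B"
proof -
  obtain R where R: "\<And>x. R < norm x \<Longrightarrow> f x = 0" using test_functions_support[OF assms] by blast
  have "compact (f ` cball 0 R)"
    by (intro compact_continuous_image continuous_on_subset[OF test_functions_continuous[OF assms]]) auto
  then obtain B where B: "0 < B" "\<And>x. x \<in> cball 0 R \<Longrightarrow> norm (f x) \<le> B"
    using compact_imp_bounded[of "f ` cball 0 R"] unfolding bounded_pos by auto
  have "norm (f x) \<le> B" for x
    using R[of x] B by (cases "norm x \<le> R") auto
  then show ?thesis using that by blast
qed

lemma integrable_bounded_support:
  fixes f :: "'a::euclidean_space \<Rightarrow> 'b::{banach, second_countable_topology}"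
  assumes [measurable]: "f \<in> borel_measurable borel" and B: "\<And>x. norm (f x) \<le> B"
    and R: "\<And>x. R < norm x \<Longrightarrow> f x = 0"
  shows "integrable lborel f"
proof (rule Bochner_Integration.integrable_bound)
  show "integrable lborel (\<lambda>x::'a. B * indicator (cball 0 R) x)"
    by (intro integrable_mult_right integrable_real_indicator) (use emeasure_lborel_cball_finite in \<open>auto simp: less_top\<close>)
  show "AE x in lborel. norm (f x) \<le> norm (B * indicator (cball 0 R) x)"
  proof (rule AE_I2)
    fix x show "norm (f x) \<le> norm (B * indicator (cball 0 R) x)"
      using B[of x] R[of x] by (cases "norm x \<le> R") auto
  qed
qed simp

lemma test_functions_integrable:
  assumes "f \<in> test_functions" shows "integrable lborel f"
proof -
  obtain B where B: "\<And>x. norm (f x) \<le> B" using test_functions_bounded[OF assms] by blast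
  obtain R where R: "\<And>x. R < norm x \<Longrightarrow> f x = 0" using test_functions_support[OF assms] by blast
  show ?thesis by (rule integrable_bounded_support[OF test_functions_measurable[OF assms] B R])
qed

lemma Ck_diff: "Ck k f \<Longrightarrow> Ck k g \<Longrightarrow> Ck k (\<lambda>x. f x - g x)"
proof (induction k arbitrary: f g)
  case (Suc k)
  have d: "frechet_derivative (\<lambda>x. f x - g x) (at x) = (\<lambda>v. frechet_derivative f (at x) v - frechet_derivative g (at x) v)" for x
    using Suc.prems by (intro frechet_derivative_at[symmetric] has_derivative_diff) (auto simp: frechet_derivative_works[symmetric])
  show ?case using Suc by (auto simp: d intro!: differentiable_diff)
qed (auto intro: continuous_intros)

lemma test_functions_diff:
  assumes "f \<in> test_functions" "g \<in> test_functions"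
  shows "(\<lambda>x. f x - g x) \<in> test_functions"
proof -
  have "closure {x. f x - g x \<noteq> 0} \<subseteq> closure {x. f x \<noteq> 0} \<union> closure {x. g x \<noteq> 0}"
    unfolding closure_Un[symmetric] by (intro closure_mono) auto
  moreover have "compact (closure {x. f x \<noteq> 0} \<union> closure {x. g x \<noteq> 0})"
    using assms by (intro compact_Un) (auto simp: test_functions_def)
  ultimately have "compact (closure {x. f x - g x \<noteq> 0})"
    unfolding compact_eq_bounded_closed using bounded_subset by blast
  then show ?thesis using assms unfolding test_functions_def mem_Collect_eq by (blast intro: Ck_diff)
qed

lemma test_functions_partial:
  assumes "f \<in> test_functions"
  shows "partial f v \<in> test_functions"
proof -
  have "{x. partial f v x \<noteq> 0} \<subseteq> closure {x. f x \<noteq> 0}"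
  proof (rule ccontr)
    assume "\<not> ?thesis"
    then obtain x where x: "partial f v x \<noteq> 0" "x \<in> - closure {x. f x \<noteq> 0}" by blast
    have "(f has_derivative (\<lambda>_. 0)) (at x)"
    proof (rule has_derivative_transform_within_open[OF has_derivative_const[of 0]])
      show "open (- closure {x. f x \<noteq> 0})" by auto
      show "x \<in> - closure {x. f x \<noteq> 0}" by (rule x)
      show "0 = f y" if "y \<in> - closure {x. f x \<noteq> 0}" for y
        using that closure_subset[of "{x. f x \<noteq> 0}"] by force
    qed
    then have "frechet_derivative f (at x) = (\<lambda>_. 0)" by (rule frechet_derivative_at[symmetric])
    then show False using x(1) by simp
  qed
  then have "closure {x. partial f v x \<noteq> 0} \<subseteq> closure {x. f x \<noteq> 0}" by (simp add: closure_minimal)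
  then have "compact (closure {x. partial f v x \<noteq> 0})"
    using assms bounded_subset unfolding test_functions_def compact_eq_bounded_closed by blast
  moreover have "Ck k (partial f v)" for k
    using test_functions_Ck[OF assms, of "Suc k"] by simp
  ultimately show ?thesis by (simp add: test_functions_def)
qed

section \<open>Fourier integrals of test functions: decay and inversion\<close>

definition fint :: "('a::euclidean_space \<Rightarrow> complex) \<Rightarrow> 'a \<Rightarrow> complex" where
  "fint f \<xi> = (LINT x|lborel. cis (- (x \<bullet> \<xi>)) * f x)"

text \<open>The integral without its normalising factor keeps the powers of 2\<pi> out of the
  computations; they return only through this equation.\<close>

lemma fourier_eq_fint: "fourier f \<xi> = complex_of_real ((2 * pi) powr (- (real DIM('a) / 2))) * fint f (\<xi>::'a::euclidean_space)"
  by (simp add: fourier_def fint_def)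

lemma fint_measurable [measurable]:
  assumes [measurable]: "f \<in> borel_measurable borel"
  shows "fint f \<in> borel_measurable borel"
  unfolding fint_def[abs_def] by measurable

lemma fourier_measurable [measurable]:
  "f \<in> borel_measurable borel \<Longrightarrow> fourier f \<in> borel_measurable borel"
  unfolding fourier_eq_fint[abs_def] by simp

lemma integrable_cis_mult:
  fixes f :: "'a::euclidean_space \<Rightarrow> complex"
  assumes f: "integrable lborel f" and [measurable]: "g \<in> borel_measurable borel"
  shows "integrable lborel (\<lambda>x. cis (g x) * f x)"
proof (rule Bochner_Integration.integrable_bound[OF f])
  have [measurable]: "f \<in> borel_measurable borel" using borel_measurable_integrable[OF f] by simp
  show "(\<lambda>x. cis (g x) * f x) \<in> borel_measurable lborel" by measurable
qed (simp add: norm_mult)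

lemma norm_fint_le:
  assumes f: "integrable lborel f"
  shows "norm (fint f \<xi>) \<le> (LINT x|lborel. norm (f x))"
  unfolding fint_def using integral_norm_bound[of lborel "\<lambda>x. cis (- (x \<bullet> \<xi>)) * f x"] by (simp add: norm_mult)

lemma fint_translate:
  fixes f :: "'a::euclidean_space \<Rightarrow> complex"
  assumes [measurable]: "f \<in> borel_measurable borel"
  shows "fint (\<lambda>x. f (x + h)) \<xi> = cis (h \<bullet> \<xi>) * fint f \<xi>"
proof -
  have "fint f \<xi> = (LINT x|lborel. cis (- ((h + 1 *\<^sub>R x) \<bullet> \<xi>)) * f (h + 1 *\<^sub>R x))"
    unfolding fint_def by (subst integral_lborel_affine) auto
  also have "\<dots> = cis (- (h \<bullet> \<xi>)) * fint (\<lambda>x. f (x + h)) \<xi>"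
    unfolding fint_def integral_mult_right_zero[symmetric]
  proof (intro Bochner_Integration.integral_cong refl)
    fix x
    have "cis (- ((h + 1 *\<^sub>R x) \<bullet> \<xi>)) = cis (- (h \<bullet> \<xi>)) * cis (- (x \<bullet> \<xi>))"
      by (simp add: inner_add_left cis_mult)
    then show "cis (- ((h + 1 *\<^sub>R x) \<bullet> \<xi>)) * f (h + 1 *\<^sub>R x) = cis (- (h \<bullet> \<xi>)) * (cis (- (x \<bullet> \<xi>)) * f (x + h))"
      by (simp only: mult.assoc scaleR_one add.commute[of h x])
  qed
  finally have "cis (h \<bullet> \<xi>) * fint f \<xi> = (cis (h \<bullet> \<xi>) * cis (- (h \<bullet> \<xi>))) * fint (\<lambda>x. f (x + h)) \<xi>"
    by (simp add: mult.assoc)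
  then show ?thesis by (simp add: cis_mult)
qed

lemma inverse_Suc_at_0: "filterlim (\<lambda>j. inverse (real (Suc j)) *\<^sub>R (v::'a::real_normed_vector)) (at 0) sequentially" if "v \<noteq> 0"
proof -
  have "(\<lambda>j. inverse (real (Suc j)) *\<^sub>R v) \<longlonglongrightarrow> 0 *\<^sub>R v"
    by (intro tendsto_intros LIMSEQ_inverse_real_of_nat)
  then show ?thesis using that by (simp add: filterlim_at)
qed

lemma difference_quotient_tendsto:
  fixes f :: "'a::euclidean_space \<Rightarrow> complex"
  assumes f: "f differentiable (at x)" and v: "norm v = 1"
  shows "(\<lambda>j. real (Suc j) *\<^sub>R (f (x + inverse (real (Suc j)) *\<^sub>R v) - f x)) \<longlonglongrightarrow> partial f v x"
proof -
  define D where "D = frechet_derivative f (at x)"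
  have D: "(f has_derivative D) (at x)" using f by (simp add: D_def frechet_derivative_works)
  then have lim: "(\<lambda>h. norm (f (x + h) - f x - D h) / norm h) \<midarrow>0\<rightarrow> 0" by (simp add: has_derivative_at)
  interpret bounded_linear D using D by (rule has_derivative_bounded_linear)
  have v0: "v \<noteq> 0" using v by auto
  have "(\<lambda>j. norm (real (Suc j) *\<^sub>R (f (x + inverse (real (Suc j)) *\<^sub>R v) - f x) - D v)) \<longlonglongrightarrow> 0"
  proof (rule Lim_transform_eventually[OF filterlim_compose[OF lim inverse_Suc_at_0[OF v0]]], rule always_eventually, rule allI)
    fix j
    have "real (Suc j) *\<^sub>R (f (x + inverse (real (Suc j)) *\<^sub>R v) - f x) - D v
      = real (Suc j) *\<^sub>R (f (x + inverse (real (Suc j)) *\<^sub>R v) - f x - D (inverse (real (Suc j)) *\<^sub>R v))"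
      by (simp add: scaleR scaleR_diff_right del: of_nat_Suc)
    then show "norm (f (x + inverse (real (Suc j)) *\<^sub>R v) - f x - D (inverse (real (Suc j)) *\<^sub>R v)) / norm (inverse (real (Suc j)) *\<^sub>R v)
      = norm (real (Suc j) *\<^sub>R (f (x + inverse (real (Suc j)) *\<^sub>R v) - f x) - D v)"
      using v by (simp add: divide_inverse mult.commute del: of_nat_Suc)
  qed
  then show ?thesis unfolding D_def[symmetric] by (simp add: tendsto_norm_zero_cancel Lim_null[of _ "D v"])
qed

lemma difference_quotient_le:
  fixes f :: "'a::euclidean_space \<Rightarrow> complex"
  assumes f: "\<And>x. f differentiable (at x)" and v: "norm v = 1"
    and B: "\<And>x. norm (partial f v x) \<le> B" and t: "0 < t"
  shows "norm (f (x + t *\<^sub>R v) - f x) \<le> t * B"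
proof -
  define g where "g s = f (x + s *\<^sub>R v)" for s :: real
  have g: "(g has_derivative (\<lambda>h. frechet_derivative f (at (x + s *\<^sub>R v)) (h *\<^sub>R v))) (at s)" for s
    unfolding g_def
    by (rule has_derivative_compose[where g = f and f = "\<lambda>s. x + s *\<^sub>R v"])
       (auto intro!: derivative_eq_intros simp: frechet_derivative_works[symmetric] f)
  have "norm (g t - g 0) \<le> B * norm (t - 0)"
  proof (rule differentiable_bound[of "{0..t}"])
    show "(g has_derivative (\<lambda>h. frechet_derivative f (at (x + s *\<^sub>R v)) (h *\<^sub>R v))) (at s within {0..t})" for s
      using g by (rule has_derivative_at_withinI)
    show "onorm (\<lambda>h. frechet_derivative f (at (x + s *\<^sub>R v)) (h *\<^sub>R v)) \<le> B" for s
    proof (rule onorm_bound)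
      show "0 \<le> B" using B[of x] norm_ge_zero order_trans by blast
      fix h :: real
      have "linear (frechet_derivative f (at (x + s *\<^sub>R v)))" using f by (simp add: linear_frechet_derivative)
      then show "norm (frechet_derivative f (at (x + s *\<^sub>R v)) (h *\<^sub>R v)) \<le> B * norm h"
        using mult_left_mono[OF B, of "\<bar>h\<bar>" "x + s *\<^sub>R v"] by (simp add: linear_scale mult.commute[of B])
    qed
  qed (use t in auto)
  then show ?thesis using t by (simp add: g_def mult.commute)
qed

lemma cis_quotient_tendsto:
  "(\<lambda>j. real (Suc j) *\<^sub>R (cis (inverse (real (Suc j)) * a) - 1)) \<longlonglongrightarrow> \<i> * complex_of_real a"
proof -
  have "((\<lambda>z. exp (\<i> * complex_of_real a * z)) has_field_derivative \<i> * complex_of_real a) (at 0)"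
    by (auto intro!: derivative_eq_intros)
  then have lim: "(\<lambda>h. (exp (\<i> * complex_of_real a * (0 + h)) - exp (\<i> * complex_of_real a * 0)) / h) \<midarrow>0\<rightarrow> \<i> * complex_of_real a"
    unfolding DERIV_def .
  show ?thesis
    by (rule Lim_transform_eventually[OF filterlim_compose[OF lim inverse_Suc_at_0[of "1::complex"]]])
       (auto intro!: always_eventually simp: cis_conv_exp scaleR_conv_of_real divide_inverse mult_ac simp del: of_nat_Suc)
qed

text \<open>Derived from difference quotients instead of integration by parts. A translation
  multiplies the Fourier integral by a character, so the quotient of f along v becomes
  multiplication by the difference quotient of \<open>cis\<close>; both sides converge as the step
  1/(j+1) tends to 0.\<close>

lemma fint_partial:
  fixes f :: "'a::euclidean_space \<Rightarrow> complex"
  assumes f: "f \<in> test_functions" and v: "norm v = 1"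
  shows "fint (partial f v) \<xi> = \<i> * complex_of_real (v \<bullet> \<xi>) * fint f \<xi>"
proof -
  have [measurable]: "f \<in> borel_measurable borel" using f by simp
  have D: "partial f v \<in> test_functions" by (rule test_functions_partial[OF f])
  have [measurable]: "partial f v \<in> borel_measurable borel" using D by (rule test_functions_measurable)
  obtain B where B: "\<And>x. norm (partial f v x) \<le> B" using test_functions_bounded[OF D] by blast
  obtain R where R: "0 < R" "\<And>x. R < norm x \<Longrightarrow> f x = 0" using test_functions_support[OF f] by blast
  have "0 \<le> B" using B[of 0] norm_ge_zero order_trans by blast
  define t where "t j = inverse (real (Suc j))" for j
  have t: "0 < t j" "t j \<le> 1" "real (Suc j) * t j = 1" for j by (auto simp: t_def inverse_le_1_iff)
  define Q where "Q j x = real (Suc j) *\<^sub>R (f (x + t j *\<^sub>R v) - f x)" for j x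
  \<comment> \<open>The dominating function for the limit. The steps are at most 1, so all
    difference quotients vanish outside the ball of radius R + 1.\<close>
  have Q_le: "norm (Q j x) \<le> B * indicator (cball 0 (R + 1)) x" for j x
  proof (cases "norm x \<le> R + 1")
    case True
    have "norm (Q j x) \<le> real (Suc j) * (t j * B)"
      unfolding Q_def norm_scaleR using difference_quotient_le[OF test_functions_differentiable[OF f] v B t(1)]
      by (auto intro!: mult_left_mono)
    also have "\<dots> = B" using t(3)[of j] by (simp add: mult.assoc[symmetric])
    finally show ?thesis using True by simp
  next
    case False
    have "norm x \<le> norm (x + t j *\<^sub>R v) + norm (t j *\<^sub>R v)" using norm_triangle_ineq4[of "x + t j *\<^sub>R v" "t j *\<^sub>R v"] by simp
    then have "R < norm (x + t j *\<^sub>R v)" using False t(1,2)[of j] v by simp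
    then show ?thesis using R False \<open>0 \<le> B\<close> by (simp add: Q_def)
  qed
  have "(\<lambda>j. LINT x|lborel. cis (- (x \<bullet> \<xi>)) * Q j x) \<longlonglongrightarrow> (LINT x|lborel. cis (- (x \<bullet> \<xi>)) * partial f v x)"
  proof (rule integral_dominated_convergence)
    show "integrable lborel (\<lambda>x::'a. B * indicator (cball 0 (R + 1)) x)"
      by (intro integrable_mult_right integrable_real_indicator) (use emeasure_lborel_cball_finite in \<open>auto simp: less_top\<close>)
    show "AE x in lborel. norm (cis (- (x \<bullet> \<xi>)) * Q j x) \<le> B * indicator (cball 0 (R + 1)) x" for j
      by (intro AE_I2) (simp add: norm_mult Q_le)
    show "AE x in lborel. (\<lambda>j. cis (- (x \<bullet> \<xi>)) * Q j x) \<longlonglongrightarrow> cis (- (x \<bullet> \<xi>)) * partial f v x"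
      unfolding Q_def t_def
      by (intro AE_I2 tendsto_mult tendsto_const difference_quotient_tendsto test_functions_differentiable f v)
    show "(\<lambda>x. cis (- (x \<bullet> \<xi>)) * Q j x) \<in> borel_measurable lborel" for j unfolding Q_def by measurable
  qed measurable
  moreover have "(LINT x|lborel. cis (- (x \<bullet> \<xi>)) * Q j x) = real (Suc j) *\<^sub>R (cis (t j * (v \<bullet> \<xi>)) - 1) * fint f \<xi>" for j
  proof -
    have i1: "integrable lborel (\<lambda>x. cis (- (x \<bullet> \<xi>)) * f x)"
      by (intro integrable_cis_mult test_functions_integrable f) measurable
    obtain B' where B': "\<And>x. norm (f x) \<le> B'" using test_functions_bounded[OF f] by blast
    have "integrable lborel (\<lambda>x. f (x + t j *\<^sub>R v))"
    proof (rule integrable_bounded_support)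
      show "norm (f (x + t j *\<^sub>R v)) \<le> B'" for x by (rule B')
      show "f (x + t j *\<^sub>R v) = 0" if "R + 1 < norm x" for x
      proof -
        have "norm x \<le> norm (x + t j *\<^sub>R v) + norm (t j *\<^sub>R v)" using norm_triangle_ineq4[of "x + t j *\<^sub>R v" "t j *\<^sub>R v"] by simp
        then show ?thesis using that t(1,2)[of j] v by (intro R) simp
      qed
    qed measurable
    then have i2: "integrable lborel (\<lambda>x. cis (- (x \<bullet> \<xi>)) * f (x + t j *\<^sub>R v))"
      by (intro integrable_cis_mult) measurable
    have "(LINT x|lborel. cis (- (x \<bullet> \<xi>)) * Q j x)
      = (LINT x|lborel. real (Suc j) *\<^sub>R (cis (- (x \<bullet> \<xi>)) * f (x + t j *\<^sub>R v) - cis (- (x \<bullet> \<xi>)) * f x))"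
      by (intro Bochner_Integration.integral_cong refl) (simp add: Q_def right_diff_distrib)
    also have "\<dots> = real (Suc j) *\<^sub>R (fint (\<lambda>x. f (x + t j *\<^sub>R v)) \<xi> - fint f \<xi>)"
      unfolding fint_def by (subst integral_scaleR_right, subst Bochner_Integration.integral_diff[OF i2 i1]) (rule refl)
    also have "\<dots> = real (Suc j) *\<^sub>R (cis (t j * (v \<bullet> \<xi>)) - 1) * fint f \<xi>"
      by (subst fint_translate) (simp_all add: left_diff_distrib)
    finally show ?thesis .
  qed
  moreover have "(\<lambda>j. real (Suc j) *\<^sub>R (cis (t j * (v \<bullet> \<xi>)) - 1) * fint f \<xi>) \<longlonglongrightarrow> \<i> * complex_of_real (v \<bullet> \<xi>) * fint f \<xi>"
    unfolding t_def by (intro tendsto_mult tendsto_const cis_quotient_tendsto)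
  ultimately show ?thesis unfolding fint_def[of "partial f v"] using LIMSEQ_unique by simp
qed

lemma fint_directional_decay:
  fixes f :: "'a::euclidean_space \<Rightarrow> complex"
  assumes v: "norm v = 1" and "f \<in> test_functions"
  shows "\<exists>C. \<forall>\<xi>. \<bar>v \<bullet> \<xi>\<bar> ^ m * norm (fint f \<xi>) \<le> C"
  using assms(2)
proof (induction m arbitrary: f)
  case 0
  then show ?case using norm_fint_le[OF test_functions_integrable] by auto
next
  case (Suc m)
  from Suc.IH[OF test_functions_partial[OF Suc.prems, of v]]
  obtain C where "\<And>\<xi>. \<bar>v \<bullet> \<xi>\<bar> ^ m * norm (fint (partial f v) \<xi>) \<le> C" by blast
  then have "\<bar>v \<bullet> \<xi>\<bar> ^ Suc m * norm (fint f \<xi>) \<le> C" for \<xi>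
    unfolding fint_partial[OF Suc.prems v] by (simp add: norm_mult mult_ac)
  then show ?case by blast
qed

lemma fourier_decay:
  fixes f :: "'a::euclidean_space \<Rightarrow> complex"
  assumes f: "f \<in> test_functions"
  obtains C where "\<And>\<xi>. norm \<xi> ^ m * norm (fourier f \<xi>) \<le> C"
proof -
  have "\<forall>b\<in>(Basis::'a set). \<exists>C. \<forall>\<xi>. \<bar>b \<bullet> \<xi>\<bar> ^ m * norm (fint f \<xi>) \<le> C"
    using fint_directional_decay[OF _ f] by simp
  then obtain C where C: "\<And>b \<xi>. b \<in> Basis \<Longrightarrow> \<bar>b \<bullet> \<xi>\<bar> ^ m * norm (fint f \<xi>) \<le> C b" by metis
  have C0: "0 \<le> C b" if "b \<in> Basis" for b
    by (rule order_trans[OF _ C[OF that, of 0]]) simp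
  define K where "K = (2 * pi) powr (- (real DIM('a) / 2))"
  have "norm \<xi> ^ m * norm (fourier f \<xi>) \<le> K * (real DIM('a) ^ m * (\<Sum>b\<in>Basis. C b))" for \<xi>
  proof -
    \<comment> \<open>Since |\<xi>| is at most the sum of its n coordinates in modulus, one
      coordinate is at least |\<xi>|/n. Decay in that basis direction bounds the decay in
      |\<xi>|.\<close>
    have "\<exists>b\<in>Basis. norm \<xi> \<le> real DIM('a) * \<bar>b \<bullet> \<xi>\<bar>"
    proof (rule ccontr)
      assume "\<not> ?thesis"
      then have "\<bar>\<xi> \<bullet> b\<bar> < norm \<xi> / real DIM('a)" if "b \<in> Basis" for b
        using that by (auto simp: field_simps inner_commute not_le)
      then have "(\<Sum>b\<in>Basis. \<bar>\<xi> \<bullet> b\<bar>) < (\<Sum>b\<in>(Basis::'a set). norm \<xi> / real DIM('a))"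
        by (intro sum_strict_mono) auto
      then show False using norm_le_l1[of \<xi>] by simp
    qed
    then obtain b where b: "b \<in> Basis" "norm \<xi> \<le> real DIM('a) * \<bar>b \<bullet> \<xi>\<bar>" by blast
    have "norm \<xi> ^ m * norm (fint f \<xi>) \<le> (real DIM('a) * \<bar>b \<bullet> \<xi>\<bar>) ^ m * norm (fint f \<xi>)"
      by (intro mult_right_mono power_mono b) auto
    also have "\<dots> = real DIM('a) ^ m * (\<bar>b \<bullet> \<xi>\<bar> ^ m * norm (fint f \<xi>))" by (simp add: power_mult_distrib)
    also have "\<dots> \<le> real DIM('a) ^ m * (\<Sum>b\<in>Basis. C b)"
      using order_trans[OF C[OF b(1), of \<xi>] member_le_sum[of b Basis C]] b(1) C0 by (intro mult_left_mono) auto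
    finally have "K * (norm \<xi> ^ m * norm (fint f \<xi>)) \<le> K * (real DIM('a) ^ m * (\<Sum>b\<in>Basis. C b))"
      by (intro mult_left_mono) (auto simp: K_def)
    then show ?thesis by (simp add: fourier_eq_fint norm_mult K_def mult_ac)
  qed
  then show ?thesis using that by blast
qed

lemma integrable_fourier_powr:
  fixes f :: "'a::euclidean_space \<Rightarrow> complex"
  assumes f: "f \<in> test_functions" and a: "0 \<le> a"
  shows "integrable lborel (\<lambda>\<xi>. complex_of_real (norm \<xi> powr a) * fourier f \<xi>)"
proof -
  have [measurable]: "f \<in> borel_measurable borel" using f by simp
  define N where "N = nat \<lceil>a\<rceil>"
  have N: "a \<le> real N" by (simp add: N_def of_nat_ceiling)
  \<comment> \<open>|\<xi>|^a is bounded by 1 + |\<xi>|^N, and each of the two summands needs a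
    bound with and without the factor |\<xi>|^(2n).\<close>
  obtain C0 where C0: "\<And>\<xi>. norm \<xi> ^ 0 * norm (fourier f \<xi>) \<le> C0" using fourier_decay[OF f] by blast
  obtain C1 where C1: "\<And>\<xi>. norm \<xi> ^ N * norm (fourier f \<xi>) \<le> C1" using fourier_decay[OF f] by blast
  obtain C2 where C2: "\<And>\<xi>. norm \<xi> ^ (2 * DIM('a)) * norm (fourier f \<xi>) \<le> C2" using fourier_decay[OF f] by blast
  obtain C3 where C3: "\<And>\<xi>. norm \<xi> ^ (2 * DIM('a) + N) * norm (fourier f \<xi>) \<le> C3" using fourier_decay[OF f] by blast
  have nn: "0 \<le> C0" "0 \<le> C1" "0 \<le> C2" "0 \<le> C3"
    using C0[of 0] C1[of 0] C2[of 0] C3[of 0] by (auto intro: order_trans[rotated])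
  have powr_le: "norm \<xi> powr a \<le> 1 + norm \<xi> ^ N" for \<xi> :: 'a
  proof (cases "norm \<xi> \<le> 1")
    case True
    then have "norm \<xi> powr a \<le> 1 powr a" using a by (intro powr_mono2) auto
    then show ?thesis by (simp add: add_increasing2)
  next
    case False
    then have "norm \<xi> powr a \<le> norm \<xi> powr real N" using N by (intro powr_mono) auto
    also have "\<dots> = norm \<xi> ^ N" using False by (intro powr_realpow) auto
    finally show ?thesis by simp
  qed
  have le: "norm (complex_of_real (norm \<xi> powr a) * fourier f \<xi>) \<le> (1 + norm \<xi> ^ N) * norm (fourier f \<xi>)" for \<xi>
    unfolding norm_mult using powr_le[of \<xi>] by (intro mult_right_mono) auto
  show ?thesis
  proof (rule integrable_rapid_decay[where C = "C0 + C1 + C2 + C3"])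
    show "norm (complex_of_real (norm \<xi> powr a) * fourier f \<xi>) \<le> C0 + C1 + C2 + C3" for \<xi>
      using le[of \<xi>] C0[of \<xi>] C1[of \<xi>] nn by (simp add: ring_distribs)
    show "norm \<xi> ^ (2 * DIM('a)) * norm (complex_of_real (norm \<xi> powr a) * fourier f \<xi>) \<le> C0 + C1 + C2 + C3" for \<xi>
    proof -
      have "norm \<xi> ^ (2 * DIM('a)) * norm (complex_of_real (norm \<xi> powr a) * fourier f \<xi>)
        \<le> norm \<xi> ^ (2 * DIM('a)) * ((1 + norm \<xi> ^ N) * norm (fourier f \<xi>))"
        by (intro mult_left_mono le) auto
      also have "\<dots> = norm \<xi> ^ (2 * DIM('a)) * norm (fourier f \<xi>) + norm \<xi> ^ (2 * DIM('a) + N) * norm (fourier f \<xi>)"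
        by (simp add: algebra_simps power_add)
      also have "\<dots> \<le> C2 + C3" by (intro add_mono C2 C3)
      finally show ?thesis using nn by simp
    qed
  qed measurable
qed

text \<open>Proved apart from the preceding lemma, whose case \<open>a = 0\<close> has the value 0
  at the origin because \<open>0 powr 0 = 0\<close>.\<close>

lemma integrable_fourier:
  fixes f :: "'a::euclidean_space \<Rightarrow> complex"
  assumes f: "f \<in> test_functions"
  shows "integrable lborel (fourier f)"
proof -
  have [measurable]: "f \<in> borel_measurable borel" using f by simp
  obtain C0 where C0: "\<And>\<xi>. norm \<xi> ^ 0 * norm (fourier f \<xi>) \<le> C0" using fourier_decay[OF f] by blast
  obtain C2 where C2: "\<And>\<xi>. norm \<xi> ^ (2 * DIM('a)) * norm (fourier f \<xi>) \<le> C2" using fourier_decay[OF f] by blast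
  show ?thesis
    by (rule integrable_rapid_decay[where C = "max C0 C2"])
       (use C0 C2 in \<open>auto simp: le_max_iff_disj\<close>)
qed

lemma integrable_pair_cis:
  fixes f :: "'a::euclidean_space \<Rightarrow> complex" and g :: "'b::euclidean_space \<Rightarrow> complex"
  assumes f: "integrable lborel f" and g: "integrable lborel g"
    and h: "(\<lambda>(x, y). h x y) \<in> borel_measurable (lborel \<Otimes>\<^sub>M lborel)" "\<And>x y. norm (h x y) \<le> 1"
  shows "integrable (lborel \<Otimes>\<^sub>M lborel) (\<lambda>(x, y). h x y * (f x * g y))"
proof (rule Bochner_Integration.integrable_bound)
  have [measurable]: "f \<in> borel_measurable borel" "g \<in> borel_measurable borel"
    using borel_measurable_integrable[OF f] borel_measurable_integrable[OF g] by simp_all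
  show "integrable (lborel \<Otimes>\<^sub>M lborel) (\<lambda>(x, y). norm (f x) * norm (g y))"
    by (intro integrable_pair_mult integrable_norm f g)
  show "(\<lambda>(x, y). h x y * (f x * g y)) \<in> borel_measurable (lborel \<Otimes>\<^sub>M lborel)"
    using h(1) by measurable
  show "AE z in lborel \<Otimes>\<^sub>M lborel. norm (case z of (x, y) \<Rightarrow> h x y * (f x * g y)) \<le> norm (case z of (x, y) \<Rightarrow> norm (f x) * norm (g y))"
  proof (rule AE_I2)
    fix z :: "'a \<times> 'b"
    show "norm (case z of (x, y) \<Rightarrow> h x y * (f x * g y)) \<le> norm (case z of (x, y) \<Rightarrow> norm (f x) * norm (g y))"
      using mult_right_mono[OF h(2)[of "fst z" "snd z"], of "norm (f (fst z)) * norm (g (snd z))"]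
      by (cases z) (simp add: norm_mult)
  qed
qed

text \<open>Damping the Fourier integral by a Gaussian amounts to convolving f with the transformed
  Gaussian, by Fubini. In this form inversion becomes a statement about an approximate
  identity.\<close>

lemma gauss_mult_fint:
  fixes f :: "'a::euclidean_space \<Rightarrow> complex"
  assumes f: "integrable lborel f" and s: "0 < s"
  shows "(LINT \<xi>|lborel. cis (x \<bullet> \<xi>) * complex_of_real (exp (- s * (norm \<xi>)\<^sup>2)) * fint f \<xi>)
    = complex_of_real (sqrt (pi / s) ^ DIM('a)) * (LINT y|lborel. complex_of_real (exp (- (norm (x - y))\<^sup>2 / (4 * s))) * f y)"
proof -
  have [measurable]: "f \<in> borel_measurable borel" using borel_measurable_integrable[OF f] by simp
  have gi: "integrable lborel (\<lambda>\<xi>::'a. complex_of_real (exp (- s * (norm \<xi>)\<^sup>2)))"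
    by (intro integrable_of_real integrable_gauss s)
  have m: "(\<lambda>(\<xi>, y). cis (x \<bullet> \<xi> - y \<bullet> \<xi>)) \<in> borel_measurable ((lborel::'a measure) \<Otimes>\<^sub>M (lborel::'a measure))"
    by measurable
  have int: "integrable (lborel \<Otimes>\<^sub>M lborel) (\<lambda>(\<xi>, y). cis (x \<bullet> \<xi> - y \<bullet> \<xi>) * (complex_of_real (exp (- s * (norm \<xi>)\<^sup>2)) * f y))"
    by (rule integrable_pair_cis[OF gi f m]) simp
  have "(LINT \<xi>|lborel. cis (x \<bullet> \<xi>) * complex_of_real (exp (- s * (norm \<xi>)\<^sup>2)) * fint f \<xi>)
    = (LINT \<xi>|lborel. (LINT y|lborel. cis (x \<bullet> \<xi> - y \<bullet> \<xi>) * (complex_of_real (exp (- s * (norm \<xi>)\<^sup>2)) * f y)))"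
    unfolding fint_def integral_mult_right_zero[symmetric]
  proof (intro Bochner_Integration.integral_cong refl)
    fix \<xi> y :: 'a
    have "cis (x \<bullet> \<xi> - y \<bullet> \<xi>) = cis (x \<bullet> \<xi>) * cis (- (y \<bullet> \<xi>))" by (simp add: cis_mult)
    then show "cis (x \<bullet> \<xi>) * complex_of_real (exp (- s * (norm \<xi>)\<^sup>2)) * (cis (- (y \<bullet> \<xi>)) * f y)
      = cis (x \<bullet> \<xi> - y \<bullet> \<xi>) * (complex_of_real (exp (- s * (norm \<xi>)\<^sup>2)) * f y)"
      by (simp only: mult_ac)
  qed
  also have "\<dots> = (LINT y|lborel. (LINT \<xi>|lborel. cis (x \<bullet> \<xi> - y \<bullet> \<xi>) * (complex_of_real (exp (- s * (norm \<xi>)\<^sup>2)) * f y)))"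
    by (rule lborel_pair.Fubini_integral[symmetric, OF int])
  also have "\<dots> = (LINT y|lborel. complex_of_real (sqrt (pi / s) ^ DIM('a)) * (complex_of_real (exp (- (norm (x - y))\<^sup>2 / (4 * s))) * f y))"
  proof (intro Bochner_Integration.integral_cong refl)
    fix y :: 'a
    have "(LINT \<xi>|lborel. cis (x \<bullet> \<xi> - y \<bullet> \<xi>) * (complex_of_real (exp (- s * (norm \<xi>)\<^sup>2)) * f y))
      = (LINT \<xi>|lborel. cis ((x - y) \<bullet> \<xi>) * complex_of_real (exp (- s * (norm \<xi>)\<^sup>2))) * f y"
      unfolding integral_mult_left_zero[symmetric] by (simp add: inner_diff_left mult.assoc)
    then show "(LINT \<xi>|lborel. cis (x \<bullet> \<xi> - y \<bullet> \<xi>) * (complex_of_real (exp (- s * (norm \<xi>)\<^sup>2)) * f y))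
      = complex_of_real (sqrt (pi / s) ^ DIM('a)) * (complex_of_real (exp (- (norm (x - y))\<^sup>2 / (4 * s))) * f y)"
      unfolding integral_gauss_cis[OF s] by (simp add: mult.assoc)
  qed
  also have "\<dots> = complex_of_real (sqrt (pi / s) ^ DIM('a)) * (LINT y|lborel. complex_of_real (exp (- (norm (x - y))\<^sup>2 / (4 * s))) * f y)"
    by (rule integral_mult_right_zero)
  finally show ?thesis .
qed

text \<open>The damped inversion integral J has two limits. Dominated convergence with the
  integrable Fourier integral of f removes the damping; the convolution form tends to a multiple of
  f(x) by continuity of f.\<close>

lemma fourier_inversion:
  fixes f :: "'a::euclidean_space \<Rightarrow> complex"
  assumes f: "f \<in> test_functions"
  shows "inv_fourier (fourier f) x = f x"
proof -
  have [measurable]: "f \<in> borel_measurable borel" using f by simp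
  define K where "K = (2 * pi) powr (- (real DIM('a) / 2))"
  have K: "0 < K" by (simp add: K_def)
  have KK: "K * K * (2 * pi) ^ DIM('a) = 1"
  proof -
    have "K * K = (2 * pi) powr (- real DIM('a))" unfolding K_def powr_add[symmetric] by simp
    then have "K * K = inverse ((2 * pi) ^ DIM('a))" by (simp only: powr_minus powr_realpow[OF mult_pos_pos[OF _ pi_gt_zero]] zero_less_numeral)
    then show ?thesis by (rule ssubst) (rule left_inverse, simp)
  qed
  have fi: "integrable lborel (fint f)"
  proof -
    have "fint f = (\<lambda>\<xi>. complex_of_real (1 / K) * fourier f \<xi>)" using K by (simp add: fourier_eq_fint K_def[symmetric])
    then show ?thesis using integrable_fourier[OF f] by simp
  qed
  define e where "e j = inverse (real (Suc j))" for j
  have e: "0 < e j" for j by (simp add: e_def)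
  have e0: "e \<longlonglongrightarrow> 0" unfolding e_def by (rule LIMSEQ_inverse_real_of_nat)
  \<comment> \<open>Damping by exp (-(e_j^2/4) |\<xi>|^2) corresponds to convolution with exp
    (-|x-y|^2 / e_j^2), a Gaussian of width e_j; substituting y = x - e_j z then moves e_j from the
    kernel into the argument of f.\<close>
  define J where "J j = (LINT \<xi>|lborel. cis (x \<bullet> \<xi>) * complex_of_real (exp (- ((e j)\<^sup>2 / 4) * (norm \<xi>)\<^sup>2)) * fint f \<xi>)" for j
  have lim1: "J \<longlonglongrightarrow> (LINT \<xi>|lborel. cis (x \<bullet> \<xi>) * fint f \<xi>)"
    unfolding J_def
  proof (rule integral_dominated_convergence)
    show "integrable lborel (\<lambda>\<xi>. norm (fint f \<xi>))" using fi by simp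
    show "AE \<xi> in lborel. norm (cis (x \<bullet> \<xi>) * complex_of_real (exp (- ((e j)\<^sup>2 / 4) * (norm \<xi>)\<^sup>2)) * fint f \<xi>) \<le> norm (fint f \<xi>)" for j
      by (intro AE_I2) (auto simp: norm_mult intro!: mult_left_le_one_le)
    show "AE \<xi> in lborel. (\<lambda>j. cis (x \<bullet> \<xi>) * complex_of_real (exp (- ((e j)\<^sup>2 / 4) * (norm \<xi>)\<^sup>2)) * fint f \<xi>) \<longlonglongrightarrow> cis (x \<bullet> \<xi>) * fint f \<xi>"
    proof (rule AE_I2)
      fix \<xi> :: 'a
      have *: "(\<lambda>j. exp (- ((e j)\<^sup>2 / 4) * (norm \<xi>)\<^sup>2)) \<longlonglongrightarrow> exp (- (0\<^sup>2 / 4) * (norm \<xi>)\<^sup>2)"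
        by (intro tendsto_intros e0) simp
      have "(\<lambda>j. cis (x \<bullet> \<xi>) * complex_of_real (exp (- ((e j)\<^sup>2 / 4) * (norm \<xi>)\<^sup>2)) * fint f \<xi>)
         \<longlonglongrightarrow> cis (x \<bullet> \<xi>) * complex_of_real (exp (- (0\<^sup>2 / 4) * (norm \<xi>)\<^sup>2)) * fint f \<xi>"
        by (intro tendsto_mult tendsto_const tendsto_of_real *)
      then show "(\<lambda>j. cis (x \<bullet> \<xi>) * complex_of_real (exp (- ((e j)\<^sup>2 / 4) * (norm \<xi>)\<^sup>2)) * fint f \<xi>) \<longlonglongrightarrow> cis (x \<bullet> \<xi>) * fint f \<xi>"
        by simp
    qed
  qed measurable
  have J_eq: "J j = complex_of_real ((2 * sqrt pi) ^ DIM('a)) * (LINT z|lborel. complex_of_real (exp (- 1 * (norm z)\<^sup>2)) * f (x - e j *\<^sub>R z))" for j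
  proof -
    define F where "F y = complex_of_real (exp (- (norm (x - y))\<^sup>2 / (4 * ((e j)\<^sup>2 / 4)))) * f y" for y
    have [measurable]: "F \<in> borel_measurable borel" unfolding F_def by measurable
    have "(LINT y|lborel. F y) = complex_of_real (e j ^ DIM('a)) * (LINT z|lborel. F (x + (- e j) *\<^sub>R z))"
      using e[of j] by (subst integral_lborel_affine) (simp_all add: scaleR_conv_of_real)
    also have "(\<lambda>z. F (x + (- e j) *\<^sub>R z)) = (\<lambda>z. complex_of_real (exp (- 1 * (norm z)\<^sup>2)) * f (x - e j *\<^sub>R z))"
      using e[of j] by (simp add: F_def power_mult_distrib)
    finally have F: "(LINT y|lborel. F y) = complex_of_real (e j ^ DIM('a)) * (LINT z|lborel. complex_of_real (exp (- 1 * (norm z)\<^sup>2)) * f (x - e j *\<^sub>R z))" .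
    have "J j = complex_of_real (sqrt (pi / ((e j)\<^sup>2 / 4)) ^ DIM('a)) * (LINT y|lborel. F y)"
      unfolding J_def F_def by (rule gauss_mult_fint[OF test_functions_integrable[OF f]]) (use e[of j] in simp)
    moreover have "sqrt (pi / ((e j)\<^sup>2 / 4)) * e j = 2 * sqrt pi"
      using e[of j] by (simp add: real_sqrt_divide real_sqrt_mult)
    then have "sqrt (pi / ((e j)\<^sup>2 / 4)) ^ DIM('a) * e j ^ DIM('a) = (2 * sqrt pi) ^ DIM('a)"
      by (simp only: power_mult_distrib[symmetric])
    ultimately show ?thesis unfolding F by (simp only: mult.assoc[symmetric] of_real_mult[symmetric])
  qed
  obtain B where B: "\<And>x. norm (f x) \<le> B" using test_functions_bounded[OF f] by blast
  have "(\<lambda>j. LINT z|lborel. complex_of_real (exp (- 1 * (norm z)\<^sup>2)) * f (x - e j *\<^sub>R z)) \<longlonglongrightarrow> (LINT z|lborel. complex_of_real (exp (- 1 * (norm (z::'a))\<^sup>2)) * f x)"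
  proof (rule integral_dominated_convergence)
    show "integrable lborel (\<lambda>z::'a. exp (- 1 * (norm z)\<^sup>2) * B)"
      by (intro integrable_mult_left integrable_gauss) simp
    show "AE z in lborel. norm (complex_of_real (exp (- 1 * (norm z)\<^sup>2)) * f (x - e j *\<^sub>R z)) \<le> exp (- 1 * (norm z)\<^sup>2) * B" for j
      by (intro AE_I2) (simp add: norm_mult B)
    show "AE z in lborel. (\<lambda>j. complex_of_real (exp (- 1 * (norm z)\<^sup>2)) * f (x - e j *\<^sub>R z)) \<longlonglongrightarrow> complex_of_real (exp (- 1 * (norm z)\<^sup>2)) * f x"
    proof (intro AE_I2 tendsto_mult tendsto_const)
      fix z
      have "(\<lambda>j. x - e j *\<^sub>R z) \<longlonglongrightarrow> x - 0 *\<^sub>R z" by (intro tendsto_intros e0)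
      moreover have "isCont f x" using test_functions_continuous[OF f] by (simp add: continuous_on_eq_continuous_at)
      ultimately show "(\<lambda>j. f (x - e j *\<^sub>R z)) \<longlonglongrightarrow> f x"
        by (intro isCont_tendsto_compose[of x f]) simp_all
    qed
  qed measurable
  then have lim2: "J \<longlonglongrightarrow> complex_of_real ((2 * sqrt pi) ^ DIM('a)) * (LINT z|lborel. complex_of_real (exp (- 1 * (norm (z::'a))\<^sup>2)) * f x)"
    unfolding J_eq by (intro tendsto_mult tendsto_const)
  have g1: "(LINT z|lborel. complex_of_real (exp (- 1 * (norm (z::'a))\<^sup>2)) * f x) = complex_of_real (sqrt pi ^ DIM('a)) * f x"
    unfolding integral_mult_left_zero integral_complex_of_real by (subst integral_gauss) auto
  have "(2 * sqrt pi) ^ DIM('a) * sqrt pi ^ DIM('a) = (2 * pi) ^ DIM('a)"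
  proof -
    have "2 * sqrt pi * sqrt pi = 2 * pi" by simp
    then show ?thesis unfolding power_mult_distrib[symmetric] by (simp only:)
  qed
  then have "(LINT \<xi>|lborel. cis (x \<bullet> \<xi>) * fint f \<xi>) = complex_of_real ((2 * pi) ^ DIM('a)) * f x"
    using LIMSEQ_unique[OF lim1 lim2] unfolding g1 by (simp only: mult.assoc[symmetric] of_real_mult[symmetric])
  moreover have "inv_fourier (fourier f) x = complex_of_real (K * K) * (LINT \<xi>|lborel. cis (x \<bullet> \<xi>) * fint f \<xi>)"
  proof -
    have "cis (x \<bullet> \<xi>) * fourier f \<xi> = complex_of_real K * (cis (x \<bullet> \<xi>) * fint f \<xi>)" for \<xi>
      by (simp add: fourier_eq_fint K_def)
    then have "(\<lambda>\<xi>. cis (x \<bullet> \<xi>) * fourier f \<xi>) = (\<lambda>\<xi>. complex_of_real K * (cis (x \<bullet> \<xi>) * fint f \<xi>))" by (rule ext)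
    then show ?thesis unfolding inv_fourier_def by (simp only: integral_mult_right_zero K_def[symmetric] of_real_mult mult.assoc)
  qed
  ultimately show ?thesis using KK by (simp only: mult.assoc[symmetric] of_real_mult[symmetric]) simp
qed

subsection \<open>The Sobolev embedding for exponents greater than one\<close>

text \<open>The coefficient 1/4 is chosen so that averaging at scale s multiplies the Fourier
  transform by exp (-s^2 |\<xi>|^2), up to a constant.\<close>

lemma gauss_bounded_kernel:
  "bounded_kernel (\<lambda>x::'a::euclidean_space. exp (- (1 / 4) * (norm x)\<^sup>2)) (sqrt (pi / (1 / 4)) ^ DIM('a)) 1"
proof
  show "(\<integral>\<^sup>+x. ennreal (exp (- (1 / 4) * (norm (x::'a))\<^sup>2)) \<partial>lborel) \<le> ennreal (sqrt (pi / (1 / 4)) ^ DIM('a))"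
    by (subst nn_integral_gauss) auto
qed auto

lemma integrable_powr_gauss:
  assumes b: "0 < b"
  shows "integrable lborel (\<lambda>s::real. indicator {0<..} s * s powr (b - 1) * exp (- s\<^sup>2))"
proof (rule integrableI_nonneg)
  have "(\<integral>\<^sup>+s. ennreal (indicator {0<..} s * s powr (b - 1) * exp (- s\<^sup>2)) \<partial>lborel)
    \<le> (\<integral>\<^sup>+s. ennreal (exp 1) * ennreal (indicator {0..} s * s powr (b - 1) / exp s) \<partial>lborel)"
  proof (rule nn_integral_mono)
    fix s :: real
    \<comment> \<open>Completing the square replaces the Gaussian by a multiple of exp (-s), for
      which the integral is the Gamma function at b.\<close>
    have "0 \<le> (s - 1/2)\<^sup>2" by simp
    then have "- s\<^sup>2 \<le> 1 - s" by (simp add: power2_eq_square algebra_simps)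
    then have "exp (- s\<^sup>2) \<le> exp 1 / exp s" unfolding exp_diff[symmetric] by simp
    then have "s powr (b - 1) * exp (- s\<^sup>2) \<le> s powr (b - 1) * (exp 1 / exp s)" by (intro mult_left_mono) auto
    then show "ennreal (indicator {0<..} s * s powr (b - 1) * exp (- s\<^sup>2)) \<le> ennreal (exp 1) * ennreal (indicator {0..} s * s powr (b - 1) / exp s)"
      by (cases "0 < s") (auto simp: ennreal_mult[symmetric] mult.commute intro!: ennreal_leI)
  qed
  also have "\<dots> = ennreal (exp 1) * ennreal (Gamma b)"
    using Gamma_conv_nn_integral_real[OF b] by (subst nn_integral_cmult) (auto simp: mult.commute)
  finally show "(\<integral>\<^sup>+s. ennreal (indicator {0<..} s * s powr (b - 1) * exp (- s\<^sup>2)) \<partial>lborel) < \<infinity>"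
    by (rule order_le_less_trans) (simp add: ennreal_mult[symmetric] less_top[symmetric] ennreal_mult_eq_top_iff)
qed auto

text \<open>The substitution of r s for s. With r = |\<xi>| it expresses |\<xi>|^(-b) as a
  superposition of Gaussian symbols over the scale s; this is the symbol that inverts the fractional
  Laplacian of order b.\<close>

lemma powr_gauss_scale:
  fixes b r :: real
  assumes b: "0 < b" and r: "0 < r"
  shows "(LINT s|lborel. indicator {0<..} s * s powr (b - 1) * exp (- s\<^sup>2 * r\<^sup>2)) * r powr b
    = (LINT s|lborel. indicator {0<..} s * s powr (b - 1) * exp (- s\<^sup>2))"
    and "integrable lborel (\<lambda>s. indicator {0<..} s * s powr (b - 1) * exp (- s\<^sup>2 * r\<^sup>2))"
proof -
  define G where "G s = indicator {0<..} s * s powr (b - 1) * exp (- s\<^sup>2)" for s :: real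
  have G: "integrable lborel G" unfolding G_def by (rule integrable_powr_gauss[OF b])
  have eq: "indicator {0<..} s * s powr (b - 1) * exp (- s\<^sup>2 * r\<^sup>2) = r powr (1 - b) * G (0 + r * s)" for s
  proof (cases "0 < s")
    case True
    have "r powr (1 - b) * r powr (b - 1) = 1" using r by (simp add: powr_add[symmetric])
    then have "r powr (1 - b) * (r * s) powr (b - 1) = s powr (b - 1)" using r True by (simp add: powr_mult mult.assoc[symmetric])
    then show ?thesis using True r by (simp add: G_def power_mult_distrib mult.commute mult.assoc[symmetric])
  next
    case False
    then show ?thesis using r by (simp add: G_def zero_less_mult_iff)
  qed
  show "integrable lborel (\<lambda>s. indicator {0<..} s * s powr (b - 1) * exp (- s\<^sup>2 * r\<^sup>2))"
    unfolding eq using r by (intro integrable_mult_right lborel_integrable_real_affine G) simp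
  have "r powr (1 - b) * r powr b = r" using r by (simp add: powr_add[symmetric])
  moreover have "integral\<^sup>L lborel G = r * (LINT s|lborel. G (0 + r * s))"
    using lborel_integral_real_affine[of r G 0] r by simp
  ultimately show "(LINT s|lborel. indicator {0<..} s * s powr (b - 1) * exp (- s\<^sup>2 * r\<^sup>2)) * r powr b
    = (LINT s|lborel. indicator {0<..} s * s powr (b - 1) * exp (- s\<^sup>2))"
    unfolding eq G_def[symmetric] integral_mult_right_zero by (simp add: mult.commute mult.left_commute mult.assoc[symmetric])
qed

text \<open>On the Fourier side the factor |\<xi>|^\<beta> of g is cancelled, for each \<xi>
  \<noteq> 0, by the integral over s of s^(\<beta>-1) exp (-s^2 |\<xi>|^2), which leaves a constant
  times the transform of f. Exchanging the two integrals displays f(x) as an integral over s of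
  Gaussian averages of g. Taking moduli inside yields the inequality, and nothing needs to be known
  about the integrability of g.\<close>

lemma gauss_potential_representation:
  fixes f :: "'a::euclidean_space \<Rightarrow> complex"
  assumes f: "f \<in> test_functions" and \<beta>: "0 < \<beta>"
  defines "k \<equiv> \<lambda>x::'a. exp (- (1 / 4) * (norm x)\<^sup>2)" and "g \<equiv> frac_laplacian (\<beta> / 2) f"
  shows "ennreal ((LINT s|lborel. indicator {0<..} s * s powr (\<beta> - 1) * exp (- s\<^sup>2)) * sqrt (4 * pi) ^ DIM('a)) * ennreal (norm (f x))
    \<le> (\<integral>\<^sup>+s. ennreal (s powr (\<beta> - 1)) * indicator {0<..} s * bounded_kernel.avg k s (\<lambda>y. ennreal (norm (g y))) x \<partial>lborel)"
proof -
  have [measurable]: "f \<in> borel_measurable borel" using f by simp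
  interpret bounded_kernel k "sqrt (pi / (1 / 4)) ^ DIM('a)" 1 unfolding k_def by (rule gauss_bounded_kernel)
  define K where "K = (2 * pi) powr (- (real DIM('a) / 2))"
  have K: "0 < K" by (simp add: K_def)
  define W where "W s = indicator {0<..} s * s powr (\<beta> - 1)" for s :: real
  have W0: "0 \<le> W s" for s by (simp add: W_def)
  have [measurable]: "W \<in> borel_measurable borel" unfolding W_def by measurable
  \<comment> \<open>This is half the value of the Gamma function at \<beta>/2.\<close>
  define \<Gamma> where "\<Gamma> = (LINT s|lborel. W s * exp (- s\<^sup>2))"
  have \<Gamma>0: "0 \<le> \<Gamma>" unfolding \<Gamma>_def using W0 by (intro Bochner_Integration.integral_nonneg) simp
  define h where "h \<xi> = complex_of_real (norm \<xi> powr \<beta>) * fourier f \<xi>" for \<xi>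
  have h: "integrable lborel h" unfolding h_def using \<beta> by (intro integrable_fourier_powr f) simp
  have [measurable]: "h \<in> borel_measurable borel" unfolding h_def by measurable
  have g: "g y = complex_of_real K * (LINT \<xi>|lborel. cis (y \<bullet> \<xi>) * h \<xi>)" for y
    by (simp add: g_def frac_laplacian_def inv_fourier_def h_def K_def)
  have g_fint: "g y = complex_of_real K * fint (\<lambda>\<xi>. h (- \<xi>)) y" for y
  proof -
    have "(LINT \<xi>|lborel. cis (y \<bullet> \<xi>) * h \<xi>) = (LINT \<xi>|lborel. cis (y \<bullet> (0 + (- 1) *\<^sub>R \<xi>)) * h (0 + (- 1) *\<^sub>R \<xi>))"
      by (subst integral_lborel_affine) simp_all
    then show ?thesis unfolding g fint_def by (simp add: inner_commute)
  qed
  define P where "P s = (LINT \<xi>|lborel. cis (x \<bullet> \<xi>) * complex_of_real (exp (- s\<^sup>2 * (norm \<xi>)\<^sup>2)) * h \<xi>)" for s :: real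
  \<comment> \<open>P s is, up to a constant, the Gaussian average of g at x with scale s: insert g
    as an inverse transform and evaluate the inner Gaussian integral. Passing to moduli bounds it by
    \<open>avg\<close>.\<close>
  have P_le: "ennreal (K * sqrt (4 * pi) ^ DIM('a)) * ennreal (norm (P s)) \<le> avg s (\<lambda>y. ennreal (norm (g y))) x"
    if s: "0 < s" for s
  proof -
    have h': "integrable lborel h" by (rule h)
    have s4: "0 < 1 / (4 * s\<^sup>2)" using s by simp
    have id: "sqrt (pi / (1 / (4 * s\<^sup>2))) ^ DIM('a) = sqrt (4 * pi) ^ DIM('a) * s ^ DIM('a)"
    proof -
      have "sqrt (pi / (1 / (4 * s\<^sup>2))) = sqrt (4 * pi) * s" using s by (simp add: real_sqrt_mult)
      then show ?thesis by (simp only: power_mult_distrib)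
    qed
    define q where "q y = complex_of_real (k ((x - y) /\<^sub>R s) / s ^ DIM('a)) * g y" for y
    have q_eq: "q y = complex_of_real (K / s ^ DIM('a)) * (LINT \<xi>|lborel. cis (y \<bullet> \<xi>) * (complex_of_real (k ((x - y) /\<^sub>R s)) * h \<xi>))" for y
    proof -
      have "(LINT \<xi>|lborel. cis (y \<bullet> \<xi>) * (complex_of_real (k ((x - y) /\<^sub>R s)) * h \<xi>))
         = (LINT \<xi>|lborel. complex_of_real (k ((x - y) /\<^sub>R s)) * (cis (y \<bullet> \<xi>) * h \<xi>))"
        by (intro Bochner_Integration.integral_cong refl) (rule mult.left_commute)
      then show ?thesis by (simp add: q_def g)
    qed
    have k_scale: "k (z /\<^sub>R s) = exp (- (1 / (4 * s\<^sup>2)) * (norm z)\<^sup>2)" for z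
    proof -
      have "norm (z /\<^sub>R s) = norm z / s" using s by (simp add: divide_inverse mult.commute)
      then have "k (z /\<^sub>R s) = exp (- (1 / 4) * (norm z / s)\<^sup>2)" unfolding k_def by (simp only:)
      then show ?thesis by (simp add: power_divide)
    qed
    have ki: "integrable lborel (\<lambda>y. complex_of_real (k ((x - y) /\<^sub>R s)))"
    proof -
      have "integrable lborel (\<lambda>y::'a. exp (- (1 / (4 * s\<^sup>2)) * (norm y)\<^sup>2))" by (intro integrable_gauss s4)
      then have "integrable lborel (\<lambda>y::'a. exp (- (1 / (4 * s\<^sup>2)) * (norm (x + (- 1) *\<^sub>R y))\<^sup>2))"
        by (subst (asm) lborel_affine[of "-1" x]) (simp_all add: integrable_density integrable_distr_eq density_1)
      moreover have "exp (- (1 / (4 * s\<^sup>2)) * (norm (x + (- 1) *\<^sub>R y))\<^sup>2) = k ((x - y) /\<^sub>R s)" for y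
        unfolding k_scale by simp
      ultimately show ?thesis by (intro integrable_of_real) simp
    qed
    have m: "(\<lambda>(y, \<xi>). cis (y \<bullet> \<xi>)) \<in> borel_measurable ((lborel::'a measure) \<Otimes>\<^sub>M (lborel::'a measure))"
      by measurable
    have "integrable (lborel \<Otimes>\<^sub>M lborel) (\<lambda>(y, \<xi>). cis (y \<bullet> \<xi>) * (complex_of_real (k ((x - y) /\<^sub>R s)) * h \<xi>))"
      by (rule integrable_pair_cis[OF ki h m]) simp
    note fub = lborel_pair.Fubini_integral[OF this]
    have "(LINT y|lborel. q y) = complex_of_real (K / s ^ DIM('a)) * (LINT y|lborel. (LINT \<xi>|lborel. cis (y \<bullet> \<xi>) * (complex_of_real (k ((x - y) /\<^sub>R s)) * h \<xi>)))"
      unfolding q_eq by (rule integral_mult_right_zero)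
    also have "(LINT y|lborel. (LINT \<xi>|lborel. cis (y \<bullet> \<xi>) * (complex_of_real (k ((x - y) /\<^sub>R s)) * h \<xi>)))
      = (LINT \<xi>|lborel. (LINT y|lborel. cis (y \<bullet> \<xi>) * (complex_of_real (k ((x - y) /\<^sub>R s)) * h \<xi>)))"
      by (rule fub[symmetric])
    also have "\<dots> = (LINT \<xi>|lborel. complex_of_real (sqrt (4 * pi) ^ DIM('a) * s ^ DIM('a)) * (cis (x \<bullet> \<xi>) * complex_of_real (exp (- s\<^sup>2 * (norm \<xi>)\<^sup>2)) * h \<xi>))"
    proof (intro Bochner_Integration.integral_cong refl)
      fix \<xi> :: 'a
      define u where "u y = cis (y \<bullet> \<xi>) * complex_of_real (k ((x - y) /\<^sub>R s))" for y
      have [measurable]: "u \<in> borel_measurable borel" unfolding u_def by measurable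
      have "(LINT y|lborel. u y) = (LINT z|lborel. u (x + (- 1) *\<^sub>R z))" by (subst integral_lborel_affine) simp_all
      also have "\<dots> = (LINT z|lborel. cis (x \<bullet> \<xi>) * (cis ((- \<xi>) \<bullet> z) * complex_of_real (exp (- (1 / (4 * s\<^sup>2)) * (norm z)\<^sup>2))))"
      proof (intro Bochner_Integration.integral_cong refl)
        fix z
        have "cis ((x + (- 1) *\<^sub>R z) \<bullet> \<xi>) = cis (x \<bullet> \<xi>) * cis ((- \<xi>) \<bullet> z)"
          by (simp add: cis_mult inner_diff_left inner_diff_right inner_commute)
        moreover have "k ((x - (x + (- 1) *\<^sub>R z)) /\<^sub>R s) = exp (- (1 / (4 * s\<^sup>2)) * (norm z)\<^sup>2)"
          unfolding k_scale by simp
        ultimately show "u (x + (- 1) *\<^sub>R z) = cis (x \<bullet> \<xi>) * (cis ((- \<xi>) \<bullet> z) * complex_of_real (exp (- (1 / (4 * s\<^sup>2)) * (norm z)\<^sup>2)))"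
          unfolding u_def by (simp only: mult.assoc)
      qed
      also have "\<dots> = cis (x \<bullet> \<xi>) * complex_of_real (sqrt (4 * pi) ^ DIM('a) * s ^ DIM('a) * exp (- s\<^sup>2 * (norm \<xi>)\<^sup>2))"
      proof -
        have "- (norm (- \<xi>))\<^sup>2 / (4 * (1 / (4 * s\<^sup>2))) = - s\<^sup>2 * (norm \<xi>)\<^sup>2" using s by simp
        then show ?thesis unfolding integral_mult_right_zero integral_gauss_cis[OF s4] id by (simp only:)
      qed
      finally have "(LINT y|lborel. u y) = cis (x \<bullet> \<xi>) * complex_of_real (sqrt (4 * pi) ^ DIM('a) * s ^ DIM('a) * exp (- s\<^sup>2 * (norm \<xi>)\<^sup>2))" .
      then show "(LINT y|lborel. cis (y \<bullet> \<xi>) * (complex_of_real (k ((x - y) /\<^sub>R s)) * h \<xi>))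
         = complex_of_real (sqrt (4 * pi) ^ DIM('a) * s ^ DIM('a)) * (cis (x \<bullet> \<xi>) * complex_of_real (exp (- s\<^sup>2 * (norm \<xi>)\<^sup>2)) * h \<xi>)"
        unfolding u_def mult.assoc[symmetric] integral_mult_left_zero by (simp only: of_real_mult mult_ac)
    qed
    also have "\<dots> = complex_of_real (sqrt (4 * pi) ^ DIM('a) * s ^ DIM('a)) * P s" unfolding P_def by (rule integral_mult_right_zero)
    finally have "(LINT y|lborel. q y) = complex_of_real (K * sqrt (4 * pi) ^ DIM('a)) * P s"
      using s by (simp add: field_simps)
    then have "ennreal (K * sqrt (4 * pi) ^ DIM('a)) * ennreal (norm (P s)) = ennreal (norm (LINT y|lborel. q y))"
      using K by (simp add: norm_mult norm_power ennreal_mult[symmetric] abs_mult)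
    also have "\<dots> \<le> (\<integral>\<^sup>+y. ennreal (norm (q y)) \<partial>lborel)"
      by (cases "integrable lborel q") (simp_all add: integral_norm_bound_ennreal not_integrable_integral_eq)
    also have "\<dots> = avg s (\<lambda>y. ennreal (norm (g y))) x"
      unfolding avg_def q_def using s k_nonneg
      by (intro nn_integral_cong) (simp add: norm_mult norm_divide norm_power ennreal_mult[symmetric])
    finally show ?thesis .
  qed
  have fi: "integrable lborel (fourier f)" by (rule integrable_fourier[OF f])
  define F where "F \<xi> s = complex_of_real (W s * exp (- s\<^sup>2 * (norm \<xi>)\<^sup>2)) * (cis (x \<bullet> \<xi>) * h \<xi>)" for \<xi> s
  have F_meas[measurable]: "(\<lambda>(\<xi>, s). F \<xi> s) \<in> borel_measurable (lborel \<Otimes>\<^sub>M lborel)" unfolding F_def by measurable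
  have inner: "(LINT s|lborel. W s * exp (- s\<^sup>2 * (norm \<xi>)\<^sup>2)) * norm \<xi> powr \<beta> = \<Gamma>"
    and inner_int: "integrable lborel (\<lambda>s. W s * exp (- s\<^sup>2 * (norm \<xi>)\<^sup>2))" if "\<xi> \<noteq> 0" for \<xi> :: 'a
    using powr_gauss_scale[OF \<beta>, of "norm \<xi>"] that by (simp_all add: W_def \<Gamma>_def)
  have h0: "h 0 = 0" by (simp add: h_def)
  \<comment> \<open>The integral of |F| over s is \<Gamma> times the modulus of the transform of f
    for \<xi> \<noteq> 0, because the power of |\<xi>| cancels. Absolute convergence thus rests only
    on the integrability of that transform.\<close>
  have intF: "integrable (lborel \<Otimes>\<^sub>M lborel) (\<lambda>(\<xi>, s). F \<xi> s)"
  proof (rule lborel_pair.Fubini_integrable[OF F_meas])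
    have "(LINT s|lborel. norm (F \<xi> s)) = \<Gamma> * norm (fourier f \<xi>)" if "\<xi> \<noteq> 0" for \<xi>
    proof -
      have "(LINT s|lborel. norm (F \<xi> s)) = (LINT s|lborel. (W s * exp (- s\<^sup>2 * (norm \<xi>)\<^sup>2)) * (norm \<xi> powr \<beta> * norm (fourier f \<xi>)))"
        by (intro Bochner_Integration.integral_cong refl) (simp add: F_def h_def norm_mult W0 abs_mult)
      also have "\<dots> = ((LINT s|lborel. W s * exp (- s\<^sup>2 * (norm \<xi>)\<^sup>2)) * norm \<xi> powr \<beta>) * norm (fourier f \<xi>)"
        unfolding integral_mult_left_zero by (simp only: mult.assoc)
      finally show ?thesis unfolding inner[OF that] .
    qed
    then have ae: "AE \<xi> in lborel. \<Gamma> * norm (fourier f \<xi>) = (LINT s|lborel. norm (case (\<xi>, s) of (\<xi>, s) \<Rightarrow> F \<xi> s))"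
      using AE_lborel_singleton[of "0::'a"] by (auto elim: eventually_mono)
    show "integrable lborel (\<lambda>\<xi>. LINT s|lborel. norm (case (\<xi>, s) of (\<xi>, s) \<Rightarrow> F \<xi> s))"
      by (rule integrable_cong_AE_imp[OF _ _ ae]) (use fi in auto)
    show "AE \<xi> in lborel. integrable lborel (\<lambda>s. case (\<xi>, s) of (\<xi>, s) \<Rightarrow> F \<xi> s)"
    proof (rule AE_I2)
      fix \<xi> :: 'a
      show "integrable lborel (\<lambda>s. case (\<xi>, s) of (\<xi>, s) \<Rightarrow> F \<xi> s)"
      proof (cases "\<xi> = 0")
        case False
        then show ?thesis unfolding F_def prod.case by (intro integrable_mult_left integrable_of_real inner_int)
      qed (simp add: F_def h0)
    qed
  qed
  have "complex_of_real \<Gamma> * f x = complex_of_real K * (LINT \<xi>|lborel. complex_of_real \<Gamma> * (cis (x \<bullet> \<xi>) * fourier f \<xi>))"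
    unfolding fourier_inversion[OF f, of x, symmetric] inv_fourier_def K_def integral_mult_right_zero by (simp add: mult_ac)
  also have "(LINT \<xi>|lborel. complex_of_real \<Gamma> * (cis (x \<bullet> \<xi>) * fourier f \<xi>)) = (LINT \<xi>|lborel. (LINT s|lborel. F \<xi> s))"
  proof (rule integral_cong_AE)
    have "complex_of_real \<Gamma> * (cis (x \<bullet> \<xi>) * fourier f \<xi>) = (LINT s|lborel. F \<xi> s)" if "\<xi> \<noteq> 0" for \<xi>
      unfolding F_def integral_mult_left_zero integral_complex_of_real inner[OF that, symmetric] h_def
      by (simp add: mult_ac)
    then show "AE \<xi> in lborel. complex_of_real \<Gamma> * (cis (x \<bullet> \<xi>) * fourier f \<xi>) = (LINT s|lborel. F \<xi> s)"
      using AE_lborel_singleton[of "0::'a"] by (auto elim: eventually_mono)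
  qed measurable
  also have "\<dots> = (LINT s|lborel. (LINT \<xi>|lborel. F \<xi> s))" by (rule lborel_pair.Fubini_integral[symmetric, OF intF])
  also have "\<dots> = (LINT s|lborel. complex_of_real (W s) * P s)"
    unfolding P_def integral_mult_right_zero[symmetric]
    by (intro Bochner_Integration.integral_cong refl) (simp add: F_def mult_ac)
  finally have eq: "complex_of_real \<Gamma> * f x = complex_of_real K * (LINT s|lborel. complex_of_real (W s) * P s)" .
  have "ennreal \<Gamma> * ennreal (norm (f x)) = ennreal (norm (complex_of_real \<Gamma> * f x))"
    using \<Gamma>0 by (simp add: norm_mult ennreal_mult)
  also have "\<dots> = ennreal K * ennreal (norm (LINT s|lborel. complex_of_real (W s) * P s))"
    unfolding eq using K by (simp add: norm_mult ennreal_mult)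
  also have "\<dots> \<le> ennreal K * (\<integral>\<^sup>+s. ennreal (norm (complex_of_real (W s) * P s)) \<partial>lborel)"
    by (intro mult_left_mono, cases "integrable lborel (\<lambda>s. complex_of_real (W s) * P s)")
       (simp_all add: integral_norm_bound_ennreal not_integrable_integral_eq)
  finally have le: "ennreal \<Gamma> * ennreal (norm (f x)) \<le> ennreal K * (\<integral>\<^sup>+s. ennreal (norm (complex_of_real (W s) * P s)) \<partial>lborel)" .
  have [measurable]: "P \<in> borel_measurable borel" unfolding P_def by measurable
  have "ennreal (\<Gamma> * sqrt (4 * pi) ^ DIM('a)) * ennreal (norm (f x))
     = ennreal (sqrt (4 * pi) ^ DIM('a)) * (ennreal \<Gamma> * ennreal (norm (f x)))"
    using \<Gamma>0 by (simp add: ennreal_mult mult_ac)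
  also have "\<dots> \<le> ennreal (sqrt (4 * pi) ^ DIM('a)) * (ennreal K * (\<integral>\<^sup>+s. ennreal (norm (complex_of_real (W s) * P s)) \<partial>lborel))"
    by (intro mult_left_mono le) simp
  also have "\<dots> = ennreal (K * sqrt (4 * pi) ^ DIM('a)) * (\<integral>\<^sup>+s. ennreal (norm (complex_of_real (W s) * P s)) \<partial>lborel)"
    using K by (simp add: ennreal_mult mult_ac)
  also have "\<dots> = (\<integral>\<^sup>+s. ennreal (K * sqrt (4 * pi) ^ DIM('a)) * ennreal (norm (complex_of_real (W s) * P s)) \<partial>lborel)"
    by (rule nn_integral_cmult[symmetric]) measurable
  also have "\<dots> \<le> (\<integral>\<^sup>+s. ennreal (s powr (\<beta> - 1)) * indicator {0<..} s * avg s (\<lambda>y. ennreal (norm (g y))) x \<partial>lborel)"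
  proof (rule nn_integral_mono)
    fix s :: real
    show "ennreal (K * sqrt (4 * pi) ^ DIM('a)) * ennreal (norm (complex_of_real (W s) * P s))
      \<le> ennreal (s powr (\<beta> - 1)) * indicator {0<..} s * avg s (\<lambda>y. ennreal (norm (g y))) x"
    proof (cases "0 < s")
      case True
      then show ?thesis
        using mult_left_mono[OF P_le[OF True], of "ennreal (s powr (\<beta> - 1))"]
        by (simp add: W_def norm_mult ennreal_mult mult_ac)
    qed (simp add: W_def)
  qed
  finally show ?thesis unfolding \<Gamma>_def W_def .
qed

lemma sobolev_embedding_gt_1:
  fixes p q \<beta> :: real
  assumes p: "1 < p" and \<beta>: "0 < \<beta>" "p * \<beta> < real DIM('a::euclidean_space)"
    and q: "q = p * real DIM('a) / (real DIM('a) - p * \<beta>)"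
  obtains C where "0 < C"
    "\<And>f. f \<in> (test_functions :: ('a \<Rightarrow> complex) set) \<Longrightarrow> Lp_norm q f \<le> ennreal C * Lp_norm p (frac_laplacian (\<beta> / 2) f)"
proof -
  interpret bounded_kernel "\<lambda>x::'a. exp (- (1 / 4) * (norm x)\<^sup>2)" "sqrt (pi / (1 / 4)) ^ DIM('a)" 1
    by (rule gauss_bounded_kernel)
  define \<Gamma> where "\<Gamma> = (LINT s|lborel. indicator {0<..} s * s powr (\<beta> - 1) * exp (- s\<^sup>2))"
  define c where "c = \<Gamma> * sqrt (4 * pi) ^ DIM('a)"
  have "0 \<le> \<Gamma>" unfolding \<Gamma>_def by (intro Bochner_Integration.integral_nonneg) simp
  moreover have "\<Gamma> \<noteq> 0"
  proof
    assume "\<Gamma> = 0"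
    then have "AE s in lborel. indicator {0<..} s * s powr (\<beta> - 1) * exp (- s\<^sup>2) = (0::real)"
      unfolding \<Gamma>_def by (subst (asm) integral_nonneg_eq_0_iff_AE[OF integrable_powr_gauss[OF \<beta>(1)]]) auto
    then have "AE s in lborel. s \<notin> {0<..<1::real}" by eventually_elim auto
    then have "{0<..<1::real} \<in> null_sets lborel" by (subst AE_iff_null_sets) auto
    then show False by (auto simp: null_sets_def)
  qed
  ultimately have c: "0 < c" by (simp add: c_def)
  have n: "0 < real DIM('a) - p * \<beta>" using \<beta> by simp
  have q0: "0 < q" using p n by (simp add: q)
  obtain C where C: "0 < C" "\<And>g. g \<in> borel_measurable borel \<Longrightarrow>
      (\<integral>\<^sup>+x. epowr (\<integral>\<^sup>+s. ennreal (s powr (\<beta> - 1)) * indicator {0<..} s * avg s g x \<partial>lborel) q \<partial>lborel)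
      \<le> ennreal C * epowr (\<integral>\<^sup>+y. epowr (g y) p \<partial>lborel) (q / p)"
    using riesz_potential_bound[OF p \<beta> q] by blast
  have "Lp_norm q f \<le> ennreal ((1 / c) * C powr (1 / q)) * Lp_norm p (frac_laplacian (\<beta> / 2) f)" if f: "f \<in> test_functions" for f :: "'a \<Rightarrow> complex"
  proof -
    have f_meas[measurable]: "f \<in> borel_measurable borel" using f by simp
    define g where "g = frac_laplacian (\<beta> / 2) f"
    have g_meas[measurable]: "g \<in> borel_measurable borel"
      unfolding g_def frac_laplacian_def inv_fourier_def[abs_def] by measurable
    define R where "R x = (\<integral>\<^sup>+s. ennreal (s powr (\<beta> - 1)) * indicator {0<..} s * avg s (\<lambda>y. ennreal (norm (g y))) x \<partial>lborel)" for x
    have [measurable]: "R \<in> borel_measurable borel" unfolding R_def by measurable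
    have le: "ennreal (norm (f x)) \<le> ennreal (1 / c) * R x" for x
    proof -
      have "ennreal (1 / c) * (ennreal c * ennreal (norm (f x))) \<le> ennreal (1 / c) * R x"
        using gauss_potential_representation[OF f \<beta>(1), of x]
        unfolding c_def \<Gamma>_def R_def g_def by (intro mult_left_mono) auto
      then show ?thesis using c by (simp add: mult.assoc[symmetric] ennreal_mult[symmetric])
    qed
    have "(\<integral>\<^sup>+x. ennreal (norm (f x) powr q) \<partial>lborel) \<le> (\<integral>\<^sup>+x. ennreal ((1 / c) powr q) * epowr (R x) q \<partial>lborel)"
    proof (rule nn_integral_mono)
      fix x
      show "ennreal (norm (f x) powr q) \<le> ennreal ((1 / c) powr q) * epowr (R x) q"
        using epowr_mono[OF le[of x], of q] q0 c by (simp add: epowr_mult epowr_ennreal)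
    qed
    also have "\<dots> = ennreal ((1 / c) powr q) * (\<integral>\<^sup>+x. epowr (R x) q \<partial>lborel)" by (rule nn_integral_cmult) measurable
    also have "\<dots> \<le> ennreal ((1 / c) powr q) * (ennreal C * epowr (\<integral>\<^sup>+y. epowr (ennreal (norm (g y))) p \<partial>lborel) (q / p))"
      unfolding R_def by (intro mult_left_mono C(2)) auto
    finally have "Lp_norm q f \<le> epowr (ennreal ((1 / c) powr q) * (ennreal C * epowr (\<integral>\<^sup>+y. epowr (ennreal (norm (g y))) p \<partial>lborel) (q / p))) (1 / q)"
      unfolding Lp_norm_def using q0 by (intro epowr_mono) auto
    also have "\<dots> = ennreal ((1 / c) * C powr (1 / q)) * Lp_norm p g"
      using q0 c C(1) p powr_mult[of "(1 / c) powr q" C "1 / q"] by (simp add: epowr_mult epowr_ennreal powr_powr epowr_epowr powr_powr Lp_norm_def ennreal_mult[symmetric] mult.assoc[symmetric])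
    finally show ?thesis unfolding g_def .
  qed
  moreover have "0 < (1 / c) * C powr (1 / q)" using c C(1) by simp
  ultimately show ?thesis using that by blast
qed

subsection \<open>The Sobolev embedding for exponent one\<close>

lemma fdiff_funpow_Suc: "(fdiff h ^^ Suc k) f x = (fdiff h ^^ k) f (x + h) - (fdiff h ^^ k) f x"
  by (simp add: fdiff_def[of h "(fdiff h ^^ k) f"])

lemma fdiff_funpow_measurable [measurable]:
  fixes f :: "'a::euclidean_space \<Rightarrow> complex"
  assumes [measurable]: "f \<in> borel_measurable borel" "a \<in> borel_measurable M" "b \<in> borel_measurable M"
  shows "(\<lambda>z. (fdiff (a z) ^^ k) f (b z)) \<in> borel_measurable M"
  using assms(3)
proof (induction k arbitrary: b)
  case (Suc k)
  have [measurable]: "b \<in> borel_measurable M" by (rule Suc.prems)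
  have "(\<lambda>z. (fdiff (a z) ^^ k) f (b z + a z)) \<in> borel_measurable M"
    by (rule Suc.IH) measurable
  then show ?case using Suc.IH[OF Suc.prems] unfolding fdiff_funpow_Suc by measurable
qed simp

lemma norm_fdiff_funpow_le: "norm ((fdiff h ^^ k) f x) \<le> 2 ^ k * (\<Sum>j\<le>k. norm (f (x + real j *\<^sub>R h)))"
proof (induction k arbitrary: x)
  case (Suc k)
  have shift: "(\<Sum>j\<le>k. norm (f (x + h + real j *\<^sub>R h))) \<le> (\<Sum>j\<le>Suc k. norm (f (x + real j *\<^sub>R h)))"
    unfolding sum.atMost_Suc_shift[of _ k] by (simp add: scaleR_add_left add.assoc)
  have "norm ((fdiff h ^^ Suc k) f x) \<le> norm ((fdiff h ^^ k) f (x + h)) + norm ((fdiff h ^^ k) f x)"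
    unfolding fdiff_funpow_Suc by (rule norm_triangle_ineq4)
  also have "\<dots> \<le> 2 ^ k * (\<Sum>j\<le>k. norm (f (x + h + real j *\<^sub>R h))) + 2 ^ k * (\<Sum>j\<le>k. norm (f (x + real j *\<^sub>R h)))"
    by (intro add_mono Suc.IH)
  also have "\<dots> \<le> 2 ^ k * (\<Sum>j\<le>Suc k. norm (f (x + real j *\<^sub>R h))) + 2 ^ k * (\<Sum>j\<le>Suc k. norm (f (x + real j *\<^sub>R h)))"
    by (intro add_mono mult_left_mono shift) auto
  finally show ?case by simp
qed simp

text \<open>In the k-th difference at x the value f(x) has coefficient 1 or -1, and all other values
  are taken at x + j h with j \<ge> 1. The induction carries a crude constant in place of the
  binomial coefficients. That j starts at 1 is essential: averaging over h then smooths every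
  remaining term.\<close>

lemma norm_le_fdiff_funpow:
  obtains C where "0 < C"
    "\<And>f h x. norm (f x :: complex) \<le> norm ((fdiff h ^^ k) f x) + C * (\<Sum>j=1..k. norm (f (x + real j *\<^sub>R (h :: 'a::euclidean_space))))"
proof -
  have "\<exists>C>0. \<forall>f h x. norm (f x :: complex) \<le> norm ((fdiff h ^^ k) f x) + C * (\<Sum>j=1..k. norm (f (x + real j *\<^sub>R (h :: 'a))))"
  proof (induction k)
    case 0
    then show ?case by (auto intro: exI[of _ 1])
  next
    case (Suc k)
    then obtain C where C: "0 < C" "\<And>f h x. norm (f x :: complex) \<le> norm ((fdiff h ^^ k) f x) + C * (\<Sum>j=1..k. norm (f (x + real j *\<^sub>R (h :: 'a))))"
      by blast
    have "norm (f x) \<le> norm ((fdiff h ^^ Suc k) f x) + (C + 2 ^ k) * (\<Sum>j=1..Suc k. norm (f (x + real j *\<^sub>R h)))"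
      for f :: "'a \<Rightarrow> complex" and h x
    proof -
      have 1: "norm ((fdiff h ^^ k) f x) \<le> norm ((fdiff h ^^ Suc k) f x) + norm ((fdiff h ^^ k) f (x + h))"
        using norm_triangle_ineq4[of "(fdiff h ^^ k) f (x + h)" "(fdiff h ^^ k) f (x + h) - (fdiff h ^^ k) f x"]
        unfolding fdiff_funpow_Suc by simp
      have "(\<Sum>j\<le>k. norm (f (x + h + real j *\<^sub>R h))) = (\<Sum>j=1..Suc k. norm (f (x + real j *\<^sub>R h)))"
        unfolding One_nat_def sum.shift_bounds_cl_Suc_ivl atMost_atLeast0 by (simp add: scaleR_add_left add.assoc)
      then have 2: "norm ((fdiff h ^^ k) f (x + h)) \<le> 2 ^ k * (\<Sum>j=1..Suc k. norm (f (x + real j *\<^sub>R h)))"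
        using norm_fdiff_funpow_le[of k h f "x + h"] by simp
      have 3: "C * (\<Sum>j=1..k. norm (f (x + real j *\<^sub>R h))) \<le> C * (\<Sum>j=1..Suc k. norm (f (x + real j *\<^sub>R h)))"
        using C(1) by (intro mult_left_mono sum_mono2) auto
      show ?thesis using C(2)[of f x h] 1 2 3 by (simp only: distrib_right)
    qed
    then show ?case using C(1) by (intro exI[of _ "C + 2 ^ k"]) (auto simp: add_pos_pos)
  qed
  then show ?thesis using that by blast
qed

text \<open>The variable of integration is the step h of a difference, not a point of the domain of
  f. The factor normalises the mass to 1, so that a term free of h is its own average.\<close>

definition ball_avg :: "real \<Rightarrow> ('a::euclidean_space \<Rightarrow> ennreal) \<Rightarrow> ennreal" where
  "ball_avg S g = (\<integral>\<^sup>+h. ennreal (1 / (unit_ball_vol (real DIM('a)) * S ^ DIM('a))) * indicator {h. norm h < S} h * g h \<partial>lborel)"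

lemma ball_avg_const: "0 < S \<Longrightarrow> ball_avg S (\<lambda>_::'a::euclidean_space. c) = c"
proof -
  assume S: "0 < S"
  have v: "0 < unit_ball_vol (real DIM('a)) * S ^ DIM('a)" using S by simp
  have "ball_avg S (\<lambda>_::'a. c) = (\<integral>\<^sup>+h. (ennreal (1 / (unit_ball_vol (real DIM('a)) * S ^ DIM('a))) * c) * indicator {h. norm h < S} (h::'a) \<partial>lborel)"
    unfolding ball_avg_def by (simp add: mult_ac)
  also have "\<dots> = ennreal (1 / (unit_ball_vol (real DIM('a)) * S ^ DIM('a))) * c * ennreal (unit_ball_vol (real DIM('a)) * S ^ DIM('a))"
  proof -
    have "{h::'a. norm h < S} = ball 0 S" by auto
    then show ?thesis using S by (simp add: nn_integral_cmult_indicator emeasure_ball)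
  qed
  also have "\<dots> = c * ennreal ((1 / (unit_ball_vol (real DIM('a)) * S ^ DIM('a))) * (unit_ball_vol (real DIM('a)) * S ^ DIM('a)))"
    using v by (subst ennreal_mult) (auto simp: mult_ac)
  also have "(1 / (unit_ball_vol (real DIM('a)) * S ^ DIM('a))) * (unit_ball_vol (real DIM('a)) * S ^ DIM('a)) = 1"
    using less_imp_neq[OF v] by (metis nonzero_divide_eq_eq)
  finally show ?thesis by simp
qed

lemma ball_avg_mono: "(\<And>h. g h \<le> g' h) \<Longrightarrow> ball_avg S g \<le> ball_avg S g'"
  unfolding ball_avg_def by (intro nn_integral_mono mult_left_mono) auto

lemma ball_avg_add:
  assumes [measurable]: "g \<in> borel_measurable borel" "g' \<in> borel_measurable borel"
  shows "ball_avg S (\<lambda>h. g h + g' h) = ball_avg S g + ball_avg S g'"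
  unfolding ball_avg_def distrib_left by (rule nn_integral_add) measurable

lemma ball_avg_cmult:
  assumes [measurable]: "g \<in> borel_measurable borel"
  shows "ball_avg S (\<lambda>h. c * g h) = c * ball_avg S g"
  unfolding ball_avg_def by (subst nn_integral_cmult[symmetric]) (auto simp: mult_ac)

lemma ball_avg_sum:
  assumes "\<And>j. g j \<in> borel_measurable borel"
  shows "ball_avg S (\<lambda>h. \<Sum>j\<in>J. g j h) = (\<Sum>j\<in>J. ball_avg S (g j))"
proof -
  have [measurable]: "g j \<in> borel_measurable borel" for j by (rule assms)
  show ?thesis unfolding ball_avg_def sum_distrib_left by (rule nn_integral_sum) measurable
qed

text \<open>Hoelder's inequality for an average, followed by the substitution y = x + j h. The bound
  is a multiple of S^(-n/q) times the L^q norm of g: it is uniform in x and tends to 0 for large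
  S.\<close>

lemma ball_avg_translate_le:
  fixes g :: "'a::euclidean_space \<Rightarrow> ennreal"
  assumes [measurable]: "g \<in> borel_measurable borel" and S: "0 < S" and j: "1 \<le> (j::nat)" and q: "1 \<le> q"
  shows "ball_avg S (\<lambda>h. g (x + real j *\<^sub>R h))
    \<le> 2 * epowr (ennreal (1 / (unit_ball_vol (real DIM('a)) * S ^ DIM('a))) * (\<integral>\<^sup>+y. epowr (g y) q \<partial>lborel)) (1 / q)"
proof -
  let ?v = "ennreal (1 / (unit_ball_vol (real DIM('a)) * S ^ DIM('a)))"
  have le: "ball_avg S (\<lambda>h. epowr (g (x + real j *\<^sub>R h)) q) \<le> ?v * (\<integral>\<^sup>+y. epowr (g y) q \<partial>lborel)"
  proof -
    have "ball_avg S (\<lambda>h. epowr (g (x + real j *\<^sub>R h)) q) \<le> (\<integral>\<^sup>+h. ?v * epowr (g (x + real j *\<^sub>R h)) q \<partial>lborel)"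
      unfolding ball_avg_def by (intro nn_integral_mono) (auto simp: indicator_def)
    also have "\<dots> = ?v * (\<integral>\<^sup>+h. epowr (g (x + real j *\<^sub>R h)) q \<partial>lborel)" by (rule nn_integral_cmult) measurable
    also have "\<dots> \<le> ?v * (\<integral>\<^sup>+y. epowr (g y) q \<partial>lborel)"
    proof (rule mult_left_mono)
      \<comment> \<open>The Jacobian j^n is at least 1 and is simply dropped.\<close>
      have "1 * (\<integral>\<^sup>+h. epowr (g (x + real j *\<^sub>R h)) q \<partial>lborel) \<le> ennreal (\<bar>real j\<bar> ^ DIM('a)) * (\<integral>\<^sup>+h. epowr (g (x + real j *\<^sub>R h)) q \<partial>lborel)"
        using j by (intro mult_right_mono) (auto simp: one_le_power)
      also have "\<dots> = (\<integral>\<^sup>+y. epowr (g y) q \<partial>lborel)"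
        using j by (intro nn_integral_lborel_affine[symmetric]) auto
      finally show "(\<integral>\<^sup>+h. epowr (g (x + real j *\<^sub>R h)) q \<partial>lborel) \<le> (\<integral>\<^sup>+y. epowr (g y) q \<partial>lborel)" by simp
    qed simp
    finally show ?thesis .
  qed
  have "ball_avg S (\<lambda>h. g (x + real j *\<^sub>R h)) \<le> ennreal (1 + 1) * epowr (?v * (\<integral>\<^sup>+y. epowr (g y) q \<partial>lborel)) (1 / q)"
  proof (rule le_epowr_optimize)
    fix \<tau> :: real assume \<tau>: "0 < \<tau>"
    have "ball_avg S (\<lambda>h. g (x + real j *\<^sub>R h)) \<le> ball_avg S (\<lambda>h. ennreal \<tau> + ennreal (\<tau> powr (1 - q)) * epowr (g (x + real j *\<^sub>R h)) q)"
      by (intro ball_avg_mono le_split_power \<tau> q)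
    also have "\<dots> = ennreal \<tau> + ennreal (\<tau> powr (1 - q)) * ball_avg S (\<lambda>h. epowr (g (x + real j *\<^sub>R h)) q)"
      by (subst ball_avg_add) (auto simp: ball_avg_const[OF S] ball_avg_cmult)
    also have "\<dots> \<le> ennreal (1 * \<tau>) + ennreal (1 * \<tau> powr (1 - q)) * (?v * (\<integral>\<^sup>+y. epowr (g y) q \<partial>lborel))"
      unfolding mult_1 by (intro add_left_mono mult_left_mono le) auto
    finally show "ball_avg S (\<lambda>h. g (x + real j *\<^sub>R h)) \<le> ennreal (1 * \<tau>) + ennreal (1 * \<tau> powr (1 - q)) * (?v * (\<integral>\<^sup>+y. epowr (g y) q \<partial>lborel))" .
  qed (use q in auto)
  then show ?thesis by simp
qed

lemma test_functions_Lp_finite: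
  assumes f: "f \<in> test_functions" and q: "0 < q"
  shows "(\<integral>\<^sup>+x. ennreal (norm (f x) powr q) \<partial>lborel) < \<infinity>"
proof -
  have [measurable]: "f \<in> borel_measurable borel" using f by simp
  obtain B where B: "\<And>x. norm (f x) \<le> B" using test_functions_bounded[OF f] by blast
  obtain R where R: "\<And>x. R < norm x \<Longrightarrow> f x = 0" using test_functions_support[OF f] by blast
  have "integrable lborel (\<lambda>x. norm (f x) powr q)"
    by (rule integrable_bounded_support[where R = R and B = "B powr q"])
       (use B R q in \<open>auto intro!: powr_mono2\<close>)
  then show ?thesis by (simp add: integrable_iff_bounded)
qed

text \<open>The weight |h|^(-n-\<beta>) comes out of a power count. At the level l the radius S(l)
  satisfies S^n = (2 D E / l)^q with E the L^q norm of f, and the level set has measure at most 2/l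
  times the average over |h| < S(l) of the L^1 norms of the differences. Against q l^(q-1) this
  gives the integrand l^(2q-2) for l below L(h) = 2 D E |h|^(-n/q). The integral is a multiple of
  L^(2q-1), and (n/q)(2q-1) = n + \<beta> because n/q = n - \<beta>.\<close>

lemma sobolev_embedding_1:
  fixes q \<beta> :: real
  assumes \<beta>: "0 < \<beta>" "\<beta> < real DIM('a::euclidean_space)" and q: "q = real DIM('a) / (real DIM('a) - \<beta>)"
    and k: "1 \<le> (k::nat)"
  obtains C where "0 < C"
    "\<And>f. f \<in> (test_functions :: ('a \<Rightarrow> complex) set) \<Longrightarrow>
      Lp_norm q f \<le> ennreal C * (\<integral>\<^sup>+h. (\<integral>\<^sup>+x. ennreal (norm ((fdiff h ^^ k) f x)) \<partial>lborel) * ennreal (norm h powr (- (real DIM('a) + \<beta>))) \<partial>lborel)"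
proof -
  define n where "n = real DIM('a)"
  have n: "0 < n" by (simp add: n_def)
  define v where "v = unit_ball_vol n"
  have v: "0 < v" by (simp add: v_def n_def)
  have q1: "1 < q" using \<beta> by (simp add: q)
  have nq: "n / q = n - \<beta>" using \<beta> n by (simp add: q n_def)
  obtain Ck where Ck: "0 < Ck"
    "\<And>f h x. norm (f x :: complex) \<le> norm ((fdiff h ^^ k) f x) + Ck * (\<Sum>j=1..k. norm (f (x + real j *\<^sub>R (h :: 'a))))"
    using norm_le_fdiff_funpow[of k] by blast
  \<comment> \<open>Collects the constant of the difference identity, the k translates, and the
    factor 2 v^(-1/q) of each average, so that the translates contribute at most D E S^(-n/q)
    altogether.\<close>
  define D where "D = Ck * (real k * (2 * (1 / v) powr (1 / q)))"
  have D: "0 < D" using Ck(1) v k by (simp add: D_def)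
  \<comment> \<open>2 is from Markov's inequality, q from the layer cake, 1/v from the volume of the
    ball and 1/(2q-1) from the integral over l; (2D)^(q-1) is what remains of (2 D E)^(-q) (2 D
    E)^(2q-1) once E^(q-1) is split off.\<close>
  define C where "C = 2 * q / ((2 * q - 1) * v) * (2 * D) powr (q - 1)"
  have C: "0 < C" using q1 v D by (simp add: C_def)
  have "Lp_norm q f \<le> ennreal C * (\<integral>\<^sup>+h. (\<integral>\<^sup>+x. ennreal (norm ((fdiff h ^^ k) f x)) \<partial>lborel) * ennreal (norm h powr (- (n + \<beta>))) \<partial>lborel)"
    if f: "f \<in> test_functions" for f :: "'a \<Rightarrow> complex"
  proof -
    have [measurable]: "f \<in> borel_measurable borel" using f by simp
    define N where "N h = (\<integral>\<^sup>+x. ennreal (norm ((fdiff h ^^ k) f x)) \<partial>lborel)" for h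
    have [measurable]: "N \<in> borel_measurable borel" unfolding N_def by measurable
    define T where "T = (\<integral>\<^sup>+h. N h * ennreal (norm h powr (- (n + \<beta>))) \<partial>lborel)"
    obtain I where I: "(\<integral>\<^sup>+x. ennreal (norm (f x) powr q) \<partial>lborel) = ennreal I" "0 \<le> I"
      using test_functions_Lp_finite[OF f, of q] q1 by (cases "\<integral>\<^sup>+x. ennreal (norm (f x) powr q) \<partial>lborel") auto
    show ?thesis
    proof (cases "I = 0")
      case True
      then show ?thesis using I by (simp add: Lp_norm_def)
    next
      case False
      define E where "E = I powr (1 / q)"
      have E: "0 < E" "E powr q = I" using False I q1 by (auto simp: E_def powr_powr)
      \<comment> \<open>The radius at which the bound D E S^(-n/q) for the averaged translates
        equals l/2.\<close>
      define S where "S l = (2 * D * E / l) powr (q / n)" for l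
      have [measurable]: "S \<in> borel_measurable borel" unfolding S_def by measurable
      have S: "0 < S l" "S l ^ DIM('a) = (2 * D * E / l) powr q" if "0 < l" for l
        using that D E n by (auto simp: S_def powr_realpow[symmetric] powr_powr n_def)
      have level: "emeasure lborel {x\<in>space lborel. ennreal l < ennreal (norm (f x))} \<le> ennreal (2 / l) * ball_avg (S l) N"
        if l: "0 < l" for l
      proof -
        define V where "V x = ball_avg (S l) (\<lambda>h. ennreal (norm ((fdiff h ^^ k) f x)))" for x
        have [measurable]: "V \<in> borel_measurable borel" unfolding V_def ball_avg_def by measurable
        have split: "ennreal (norm (f x)) \<le> ennreal (l / 2) + V x" for x
        proof -
          have "ennreal (norm (f x)) = ball_avg (S l) (\<lambda>_::'a. ennreal (norm (f x)))"
            by (rule ball_avg_const[OF S(1)[OF l], symmetric])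
          also have "\<dots> \<le> ball_avg (S l) (\<lambda>h. ennreal (norm ((fdiff h ^^ k) f x)) + ennreal Ck * (\<Sum>j=1..k. ennreal (norm (f (x + real j *\<^sub>R h)))))"
          proof (rule ball_avg_mono)
            fix h
            have "ennreal (norm (f x)) \<le> ennreal (norm ((fdiff h ^^ k) f x) + Ck * (\<Sum>j=1..k. norm (f (x + real j *\<^sub>R h))))"
              by (intro ennreal_leI Ck(2))
            then show "ennreal (norm (f x)) \<le> ennreal (norm ((fdiff h ^^ k) f x)) + ennreal Ck * (\<Sum>j=1..k. ennreal (norm (f (x + real j *\<^sub>R h))))"
              using Ck(1) by (simp add: ennreal_mult sum_nonneg)
          qed
          also have "\<dots> = V x + ennreal Ck * (\<Sum>j=1..k. ball_avg (S l) (\<lambda>h. ennreal (norm (f (x + real j *\<^sub>R h)))))"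
            unfolding V_def by (subst ball_avg_add, measurable, subst ball_avg_cmult, measurable, subst ball_avg_sum) simp_all
          also have "\<dots> \<le> V x + ennreal Ck * (\<Sum>j=1..k. 2 * ennreal ((1 / v) powr (1 / q) * (l / (2 * D))))"
          proof (intro add_left_mono mult_left_mono sum_mono)
            fix j assume "j \<in> {1..k}"
            then have "ball_avg (S l) (\<lambda>h. ennreal (norm (f (x + real j *\<^sub>R h))))
              \<le> 2 * epowr (ennreal (1 / (v * S l ^ DIM('a))) * (\<integral>\<^sup>+y. epowr (ennreal (norm (f y))) q \<partial>lborel)) (1 / q)"
              unfolding v_def n_def using S(1)[OF l] q1
              by (intro ball_avg_translate_le[of "\<lambda>y. ennreal (norm (f y))"]) auto
            also have "(\<integral>\<^sup>+y. epowr (ennreal (norm (f y))) q \<partial>lborel) = ennreal I" using I(1) by (simp add: epowr_ennreal)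
            also have "epowr (ennreal (1 / (v * S l ^ DIM('a))) * ennreal I) (1 / q) = ennreal ((1 / v) powr (1 / q) * (l / (2 * D)))"
            proof -
              have "1 / (v * S l ^ DIM('a)) * I = (1 / v) * (l / (2 * D)) powr q"
                unfolding S(2)[OF l] E(2)[symmetric] using l D E(1) by (simp add: powr_divide powr_mult field_simps)
              then have "(1 / (v * S l ^ DIM('a)) * I) powr (1 / q) = (1 / v) powr (1 / q) * (l / (2 * D))"
                using v l D q1 powr_mult[of "1 / v" "(l / (2 * D)) powr q" "1 / q"] by (simp add: powr_powr)
              moreover have "0 \<le> 1 / (v * S l ^ DIM('a))" using v S(1)[OF l] by simp
              ultimately show ?thesis using I(2) by (simp add: ennreal_mult[symmetric] epowr_ennreal)
            qed
            finally show "ball_avg (S l) (\<lambda>h. ennreal (norm (f (x + real j *\<^sub>R h)))) \<le> 2 * ennreal ((1 / v) powr (1 / q) * (l / (2 * D)))" .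
          qed simp
          also have "ennreal Ck * (\<Sum>j=1..k. 2 * ennreal ((1 / v) powr (1 / q) * (l / (2 * D)))) = ennreal (l / 2)"
          proof -
            have "ennreal Ck * (\<Sum>j=1..k. 2 * ennreal ((1 / v) powr (1 / q) * (l / (2 * D))))
              = ennreal Ck * (ennreal (real k) * (ennreal 2 * ennreal ((1 / v) powr (1 / q) * (l / (2 * D)))))"
              by (simp add: ennreal_of_nat_eq_real_of_nat)
            also have "\<dots> = ennreal (Ck * (real k * (2 * ((1 / v) powr (1 / q) * (l / (2 * D))))))"
            proof -
              have "ennreal Ck * (ennreal (real k) * (ennreal 2 * ennreal Y)) = ennreal (Ck * (real k * (2 * Y)))" if "0 \<le> Y" for Y
                using that Ck(1) by (simp add: ennreal_mult)
              then show ?thesis using D l by simp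
            qed
            also have "Ck * (real k * (2 * ((1 / v) powr (1 / q) * (l / (2 * D))))) = D * (l / (2 * D))"
              unfolding D_def by (simp add: mult_ac)
            also have "\<dots> = l / 2" using D by simp
            finally show ?thesis .
          qed
          finally show ?thesis by (simp add: add.commute)
        qed
        have "emeasure lborel {x\<in>space lborel. ennreal l < ennreal (norm (f x))} \<le> ennreal (2 / l) * (\<integral>\<^sup>+x. V x \<partial>lborel)"
          by (rule emeasure_level_bound[OF _ l split]) measurable
        also have "(\<integral>\<^sup>+x. V x \<partial>lborel) = ball_avg (S l) N"
        proof -
          have "(\<integral>\<^sup>+x. V x \<partial>lborel) = (\<integral>\<^sup>+h. (\<integral>\<^sup>+x. ennreal (1 / (unit_ball_vol (real DIM('a)) * S l ^ DIM('a))) * indicator {h. norm h < S l} h * ennreal (norm ((fdiff h ^^ k) f x)) \<partial>lborel) \<partial>lborel)"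
            unfolding V_def ball_avg_def by (rule lborel_pair.Fubini') measurable
          also have "\<dots> = ball_avg (S l) N"
            unfolding N_def ball_avg_def by (intro nn_integral_cong nn_integral_cmult) measurable
          finally show ?thesis .
        qed
        finally show ?thesis .
      qed
      have "ennreal I = (\<integral>\<^sup>+x. epowr (ennreal (norm (f x))) q \<partial>lborel)"
        using I(1) by (simp add: epowr_ennreal)
      also have "\<dots> = (\<integral>\<^sup>+l. ennreal (q * l powr (q - 1)) * indicator {0<..} l * emeasure lborel {x\<in>space lborel. ennreal l < ennreal (norm (f x))} \<partial>lborel)"
        by (rule lborel.nn_integral_layer_cake) (use q1 in auto)
      also have "\<dots> \<le> (\<integral>\<^sup>+l. (\<integral>\<^sup>+h. (ennreal (2 * q / v * (2 * D * E) powr (- q)) * N h) *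
          (ennreal (l powr (2 * q - 2)) * indicator {l. 0 < l \<and> norm h < S l} l) \<partial>lborel) \<partial>lborel)"
      proof (rule nn_integral_mono)
        fix l :: real
        show "ennreal (q * l powr (q - 1)) * indicator {0<..} l * emeasure lborel {x\<in>space lborel. ennreal l < ennreal (norm (f x))}
          \<le> (\<integral>\<^sup>+h. (ennreal (2 * q / v * (2 * D * E) powr (- q)) * N h) *
          (ennreal (l powr (2 * q - 2)) * indicator {l. 0 < l \<and> norm h < S l} l) \<partial>lborel)"
        proof (cases "0 < l")
          case True
          have "ennreal (q * l powr (q - 1)) * emeasure lborel {x\<in>space lborel. ennreal l < ennreal (norm (f x))}
            \<le> ennreal (q * l powr (q - 1)) * (ennreal (2 / l) * ball_avg (S l) N)"
            by (intro mult_left_mono level True) simp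
          also have "\<dots> = ennreal (q * l powr (q - 1) * (2 / l)) * ball_avg (S l) N"
            using True q1 by (subst ennreal_mult) (auto simp: mult.assoc)
          also have "\<dots> = (\<integral>\<^sup>+h. ennreal (q * l powr (q - 1) * (2 / l)) * (ennreal (1 / (v * S l ^ DIM('a))) * indicator {h. norm h < S l} h * N h) \<partial>lborel)"
            unfolding ball_avg_def v_def n_def by (rule nn_integral_cmult[symmetric]) measurable
          also have "\<dots> = (\<integral>\<^sup>+h. (ennreal (2 * q / v * (2 * D * E) powr (- q)) * N h) *
            (ennreal (l powr (2 * q - 2)) * indicator {l. 0 < l \<and> norm h < S l} l) \<partial>lborel)"
          proof (intro nn_integral_cong)
            fix h
            have "q * l powr (q - 1) * (2 / l) * (1 / (v * S l ^ DIM('a))) = 2 * q / v * (2 * D * E) powr (- q) * l powr (2 * q - 2)"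
            proof -
              have a: "1 / S l ^ DIM('a) = (2 * D * E) powr (- q) * l powr q"
                unfolding S(2)[OF True] using True D E(1) by (simp add: powr_divide powr_minus_divide)
              have b: "l powr (q - 1) * (1 / l) * l powr q = l powr (2 * q - 2)"
              proof -
                have "l powr (q - 1) * (1 / l) * l powr q = l powr (q - 1) * l powr (- 1) * l powr q"
                  using True by (simp add: powr_minus_divide)
                also have "\<dots> = l powr (2 * q - 2)" unfolding powr_add[symmetric] by (rule arg_cong[where f = "\<lambda>z. l powr z"]) simp
                finally show ?thesis .
              qed
              have "q * l powr (q - 1) * (2 / l) * (1 / (v * S l ^ DIM('a))) = 2 * q / v * (l powr (q - 1) * (1 / l)) * (1 / S l ^ DIM('a))"
                by (simp add: mult_ac)
              also have "\<dots> = 2 * q / v * (2 * D * E) powr (- q) * (l powr (q - 1) * (1 / l) * l powr q)" unfolding a by (simp only: mult_ac)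
              finally show ?thesis unfolding b .
            qed
            then have "ennreal (q * l powr (q - 1) * (2 / l)) * ennreal (1 / (v * S l ^ DIM('a))) = ennreal (2 * q / v * (2 * D * E) powr (- q)) * ennreal (l powr (2 * q - 2))"
              using True q1 v S(1)[OF True] by (subst (1 2) ennreal_mult[symmetric]) auto
            then have eq: "(ennreal (q * l powr (q - 1) * (2 / l)) * ennreal (1 / (v * S l ^ DIM('a)))) * N h * indicator {l. 0 < l \<and> norm h < S l} l
              = (ennreal (2 * q / v * (2 * D * E) powr (- q)) * ennreal (l powr (2 * q - 2))) * N h * indicator {l. 0 < l \<and> norm h < S l} l"
              by (simp only:)
            have ind: "indicator {h. norm h < S l} h = (indicator {l. 0 < l \<and> norm h < S l} l :: ennreal)"
              using True by (simp add: indicator_def)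
            show "ennreal (q * l powr (q - 1) * (2 / l)) * (ennreal (1 / (v * S l ^ DIM('a))) * indicator {h. norm h < S l} h * N h)
              = (ennreal (2 * q / v * (2 * D * E) powr (- q)) * N h) * (ennreal (l powr (2 * q - 2)) * indicator {l. 0 < l \<and> norm h < S l} l)"
              unfolding ind using eq by (simp only: mult_ac)
          qed
          finally show ?thesis using True by simp
        qed simp
      qed
      also have "\<dots> = (\<integral>\<^sup>+h. (\<integral>\<^sup>+l. (ennreal (2 * q / v * (2 * D * E) powr (- q)) * N h) *
          (ennreal (l powr (2 * q - 2)) * indicator {l. 0 < l \<and> norm h < S l} l) \<partial>lborel) \<partial>lborel)"
        by (rule lborel_pair.Fubini') measurable
      also have "\<dots> = (\<integral>\<^sup>+h. ennreal (C * E powr (q - 1)) * (N h * ennreal (norm h powr (- (n + \<beta>)))) \<partial>lborel)"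
      proof (rule nn_integral_cong_AE)
        have "(\<integral>\<^sup>+l. (ennreal (2 * q / v * (2 * D * E) powr (- q)) * N h) *
          (ennreal (l powr (2 * q - 2)) * indicator {l. 0 < l \<and> norm h < S l} l) \<partial>lborel)
          = ennreal (C * E powr (q - 1)) * (N h * ennreal (norm h powr (- (n + \<beta>))))" if h: "h \<noteq> 0" for h
        proof -
          \<comment> \<open>The inverse of S: for fixed h the condition |h| < S(l) means l <
            L.\<close>
          define L where "L = 2 * D * E * norm h powr (- (n / q))"
          have L: "0 < L" using D E(1) h by (simp add: L_def)
          have set: "{l. 0 < l \<and> norm h < S l} = {0<..<L}"
          proof -
            have "norm h < S l \<longleftrightarrow> l < L" if l: "0 < l" for l
            proof -
              have "norm h < S l \<longleftrightarrow> norm h powr (n / q) < S l powr (n / q)"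
                using h S(1)[OF l] n q1 by (metis divide_pos_pos less_imp_le linorder_not_le norm_ge_zero order_less_trans powr_less_mono2 powr_mono2 zero_less_one)
              also have "S l powr (n / q) = 2 * D * E / l" using D E(1) l n q1 by (simp add: S_def powr_powr)
              also have "norm h powr (n / q) < 2 * D * E / l \<longleftrightarrow> l < L"
                using l h by (simp add: L_def powr_minus field_simps)
              finally show ?thesis .
            qed
            then show ?thesis by auto
          qed
          have "(\<integral>\<^sup>+l. (ennreal (2 * q / v * (2 * D * E) powr (- q)) * N h) *
              (ennreal (l powr (2 * q - 2)) * indicator {l. 0 < l \<and> norm h < S l} l) \<partial>lborel)
            = (ennreal (2 * q / v * (2 * D * E) powr (- q)) * N h) * ennreal (L powr (2 * q - 1) / (2 * q - 1))"
            unfolding set using L q1 nn_integral_powr_less'[of "2 * q - 2" L] by (subst nn_integral_cmult) auto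
          also have "\<dots> = ennreal (2 * q / v * (2 * D * E) powr (- q) * (L powr (2 * q - 1) / (2 * q - 1))) * N h"
            using q1 v by (subst ennreal_mult) (auto simp: mult_ac)
          also have "2 * q / v * (2 * D * E) powr (- q) * (L powr (2 * q - 1) / (2 * q - 1)) = C * E powr (q - 1) * norm h powr (- (n + \<beta>))"
          proof -
            have "L powr (2 * q - 1) = (2 * D * E) powr (2 * q - 1) * norm h powr (- (n / q) * (2 * q - 1))"
              using D E(1) h unfolding L_def by (subst powr_mult) (auto simp: powr_powr)
            also have "- (n / q) * (2 * q - 1) = - (n + \<beta>)"
            proof -
              have "(n / q) * (2 * q - 1) = 2 * n - n / q" using q1 by (simp add: right_diff_distrib)
              then show ?thesis unfolding mult_minus_left by (simp add: nq)
            qed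
            finally have a: "L powr (2 * q - 1) = (2 * D * E) powr (2 * q - 1) * norm h powr (- (n + \<beta>))" .
            have b: "(2 * D * E) powr (- q) * (2 * D * E) powr (2 * q - 1) = (2 * D) powr (q - 1) * E powr (q - 1)"
              unfolding powr_add[symmetric] using D E(1) by (simp add: powr_mult[symmetric])
            have "2 * q / v * (2 * D * E) powr (- q) * (L powr (2 * q - 1) / (2 * q - 1))
               = 2 * q / ((2 * q - 1) * v) * ((2 * D * E) powr (- q) * (2 * D * E) powr (2 * q - 1)) * norm h powr (- (n + \<beta>))"
              unfolding a by (simp add: mult_ac)
            then show ?thesis unfolding b C_def by (simp only: mult.assoc)
          qed
          finally show ?thesis using C E by (simp add: ennreal_mult mult_ac)
        qed
        then show "AE h in lborel. (\<integral>\<^sup>+l. (ennreal (2 * q / v * (2 * D * E) powr (- q)) * N h) *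
          (ennreal (l powr (2 * q - 2)) * indicator {l. 0 < l \<and> norm h < S l} l) \<partial>lborel)
          = ennreal (C * E powr (q - 1)) * (N h * ennreal (norm h powr (- (n + \<beta>))))"
          using AE_lborel_singleton[of "0::'a"] by (auto elim: eventually_mono)
      qed
      also have "\<dots> = ennreal (C * E powr (q - 1)) * T"
        unfolding T_def by (rule nn_integral_cmult) measurable
      finally have "ennreal I \<le> ennreal (C * E powr (q - 1)) * T" .
      \<comment> \<open>The L^q norm E, positive and finite for the test function f, is on both
        sides: E^q is bounded by C E^(q-1) T, and E^(q-1) is divided out.\<close>
      then have "ennreal (E powr (1 - q)) * ennreal I \<le> ennreal (E powr (1 - q)) * (ennreal (C * E powr (q - 1)) * T)"
        by (rule mult_left_mono) simp
      moreover have "ennreal (E powr (1 - q)) * ennreal I = ennreal E"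
        using E I(2) by (simp add: ennreal_mult[symmetric] powr_add[symmetric] flip: E(2))
      moreover have "ennreal (E powr (1 - q)) * (ennreal (C * E powr (q - 1)) * T) = ennreal C * T"
      proof -
        have "E powr (1 - q) * (C * E powr (q - 1)) = C"
          using E(1) by (simp add: mult.left_commute[of _ C] powr_add[symmetric])
        then have "ennreal (E powr (1 - q)) * ennreal (C * E powr (q - 1)) = ennreal C"
          using C by (subst ennreal_mult[symmetric]) auto
        then show ?thesis by (simp add: mult.assoc[symmetric])
      qed
      ultimately have "ennreal E \<le> ennreal C * T" by simp
      then show ?thesis using I by (simp add: Lp_norm_def epowr_ennreal E_def T_def N_def)
    qed
  qed
  then show ?thesis using that C unfolding n_def by blast
qed

subsection \<open>The Sobolev norm as a seminorm on test functions\<close>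

lemma sobolev_embedding:
  fixes \<beta> p :: real
  assumes \<beta>: "0 < \<beta>" "\<beta> < real DIM('a::euclidean_space)" and p: "1 \<le> p" "p * \<beta> < real DIM('a)"
  obtains C where "0 < C"
    "\<And>f. f \<in> (test_functions :: ('a \<Rightarrow> complex) set) \<Longrightarrow>
      Lp_norm (p * real DIM('a) / (real DIM('a) - p * \<beta>)) f \<le> ennreal C * sobolev_norm \<beta> p f"
proof (cases "p = 1")
  case True
  let ?k = "1 + nat \<lfloor>\<beta>\<rfloor>" and ?n = "real DIM('a)"
  obtain C where C: "0 < C" "\<And>f. f \<in> (test_functions :: ('a \<Rightarrow> complex) set) \<Longrightarrow>
      Lp_norm (?n / (?n - \<beta>)) f \<le> ennreal C * (\<integral>\<^sup>+h. (\<integral>\<^sup>+x. ennreal (norm ((fdiff h ^^ ?k) f x)) \<partial>lborel) * ennreal (norm h powr (- (?n + \<beta>))) \<partial>lborel)"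
    using sobolev_embedding_1[OF \<beta> refl, of ?k] by auto
  have "(\<integral>\<^sup>+h. (\<integral>\<^sup>+x. ennreal (norm ((fdiff h ^^ ?k) f x)) \<partial>lborel) * ennreal (norm h powr (- (?n + \<beta>))) \<partial>lborel)
     = sobolev_norm \<beta> 1 f" for f :: "'a \<Rightarrow> complex"
  proof -
    have e: "epowr (Lp_norm 1 g) 1 = (\<integral>\<^sup>+x. ennreal (norm (g x)) \<partial>lborel)" for g :: "'a \<Rightarrow> complex"
      by (simp add: Lp_norm_def)
    \<comment> \<open>At h = 0 this can fail, as the negative power is 0 there while the quotient
      divides by 0; the exception is a null set.\<close>
    have "a * ennreal (norm h powr (- (?n + \<beta>))) = a / ennreal (norm h powr (?n + 1 * \<beta>))" if "h \<noteq> 0" for a and h :: 'a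
    proof -
      have "ennreal (norm h powr (- (?n + \<beta>))) = inverse (ennreal (norm h powr (?n + \<beta>)))"
        unfolding powr_minus using that by (intro inverse_ennreal[symmetric]) simp
      then show ?thesis by (simp add: divide_ennreal_def)
    qed
    then have "AE h in lborel. (\<integral>\<^sup>+x. ennreal (norm ((fdiff h ^^ ?k) f x)) \<partial>lborel) * ennreal (norm h powr (- (?n + \<beta>)))
      = (\<integral>\<^sup>+x. ennreal (norm ((fdiff h ^^ ?k) f x)) \<partial>lborel) / ennreal (norm h powr (?n + 1 * \<beta>))"
      using AE_lborel_singleton[of "0::'a"] by (auto elim: eventually_mono)
    then show ?thesis unfolding sobolev_norm_def e by (simp add: nn_integral_cong_AE)
  qed
  then show ?thesis using that C True by simp
next
  case False
  then have "1 < p" using p by simp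
  then obtain C where "0 < C" "\<And>f. f \<in> (test_functions :: ('a \<Rightarrow> complex) set) \<Longrightarrow>
      Lp_norm (p * real DIM('a) / (real DIM('a) - p * \<beta>)) f \<le> ennreal C * Lp_norm p (frac_laplacian (\<beta> / 2) f)"
    using sobolev_embedding_gt_1[OF _ \<beta>(1) p(2) refl] by blast
  then show ?thesis using that False by (simp add: sobolev_norm_def)
qed

text \<open>On the open half-line this is convexity of the power; if x or y is 0 it comes down to
  \<theta>^p \<le> \<theta> for 0 \<le> \<theta> \<le> 1.\<close>

lemma powr_convex_combination:
  fixes x y \<theta> p :: real
  assumes p: "1 \<le> p" and \<theta>: "0 \<le> \<theta>" "\<theta> \<le> 1" and xy: "0 \<le> x" "0 \<le> y"
  shows "(\<theta> * x + (1 - \<theta>) * y) powr p \<le> \<theta> * x powr p + (1 - \<theta>) * y powr p"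
proof -
  have *: "(\<theta> * x) powr p \<le> \<theta> * x powr p" if "0 \<le> \<theta>" "\<theta> \<le> 1" "0 \<le> x" for \<theta> x :: real
  proof -
    have "\<theta> powr p \<le> \<theta>"
      using that p powr_mono'[of 1 p \<theta>] by (cases "\<theta> = 0") auto
    then show ?thesis using that by (simp add: powr_mult mult_right_mono)
  qed
  consider "x = 0" | "y = 0" | "0 < x" "0 < y" using xy by fastforce
  then show ?thesis
  proof cases
    case 3
    then show ?thesis
      using convex_onD[OF powr_convex[OF p], of "1 - \<theta>" x y] \<theta> by simp
  qed (use *[of \<theta> x] *[of "1 - \<theta>" y] \<theta> xy p in auto)
qed

text \<open>Minkowski's inequality from convexity of the unit ball: f + g is (a+b) times the convex
  combination of f/a and g/b with weights a/(a+b) and b/(a+b).\<close>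

lemma Lp_norm_triangle:
  fixes f g :: "'a::euclidean_space \<Rightarrow> complex"
  assumes [measurable]: "f \<in> borel_measurable borel" "g \<in> borel_measurable borel" and p: "1 \<le> p"
  shows "Lp_norm p (\<lambda>x. f x + g x) \<le> Lp_norm p f + Lp_norm p g"
proof (cases "Lp_norm p f = top \<or> Lp_norm p g = top")
  case False
  then obtain F G where FG: "Lp_norm p f = ennreal F" "0 \<le> F" "Lp_norm p g = ennreal G" "0 \<le> G"
    by (metis ennreal_cases)
  have unit: "(\<integral>\<^sup>+x. ennreal ((norm (u x) / a) powr p) \<partial>lborel) \<le> 1"
    if [measurable]: "u \<in> borel_measurable borel" and u: "Lp_norm p u = ennreal U" "0 \<le> U" "U < a" for u :: "'a \<Rightarrow> complex" and a U
  proof -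
    have a: "0 < a" using u by simp
    have "epowr (Lp_norm p u) p = (\<integral>\<^sup>+x. ennreal (norm (u x) powr p) \<partial>lborel)"
      using p by (simp add: Lp_norm_def epowr_epowr)
    then have I: "(\<integral>\<^sup>+x. ennreal (norm (u x) powr p) \<partial>lborel) = ennreal (U powr p)" using u by (simp add: epowr_ennreal)
    have "(\<integral>\<^sup>+x. ennreal ((norm (u x) / a) powr p) \<partial>lborel) = (\<integral>\<^sup>+x. ennreal (1 / a powr p) * ennreal (norm (u x) powr p) \<partial>lborel)"
      using a by (intro nn_integral_cong) (simp add: powr_divide ennreal_mult[symmetric])
    also have "\<dots> = ennreal (1 / a powr p) * ennreal (U powr p)" by (simp add: nn_integral_cmult I)
    also have "\<dots> = ennreal (U powr p / a powr p)" by (simp add: ennreal_mult[symmetric])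
    also have "\<dots> \<le> 1"
    proof -
      have "U powr p \<le> a powr p" using u p by (intro powr_mono2) auto
      then show ?thesis using a by (simp add: divide_le_eq_1)
    qed
    finally show ?thesis .
  qed
  show ?thesis
  proof (rule ennreal_le_epsilon)
    fix e :: real assume e: "0 < e"
    \<comment> \<open>The norms are enlarged slightly so that they can be divided by even when they
      vanish.\<close>
    define a where "a = F + e / 2"
    define b where "b = G + e / 2"
    have ab: "0 < a" "0 < b" "F < a" "G < b" "a + b = F + G + e" using e FG by (auto simp: a_def b_def)
    define \<theta> where "\<theta> = a / (a + b)"
    have \<theta>1: "(a + b) * \<theta> = a" using ab(1,2) by (simp add: \<theta>_def)
    have \<theta>: "0 \<le> \<theta>" "\<theta> \<le> 1" "(a + b) * \<theta> = a" "(a + b) * (1 - \<theta>) = b"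
      using ab(1,2) \<theta>1 by (simp_all add: \<theta>_def divide_le_eq_1 right_diff_distrib del: times_divide_eq_right)
    have "(\<integral>\<^sup>+x. ennreal (norm (f x + g x) powr p) \<partial>lborel)
      \<le> (\<integral>\<^sup>+x. ennreal ((a + b) powr p) * (ennreal \<theta> * ennreal ((norm (f x) / a) powr p) + ennreal (1 - \<theta>) * ennreal ((norm (g x) / b) powr p)) \<partial>lborel)"
    proof (rule nn_integral_mono)
      fix x
      have "norm (f x + g x) \<le> norm (f x) + norm (g x)" by (rule norm_triangle_ineq)
      also have "\<dots> = ((a + b) * \<theta>) * (norm (f x) / a) + ((a + b) * (1 - \<theta>)) * (norm (g x) / b)"
        unfolding \<theta> using ab by simp
      also have "\<dots> = (a + b) * (\<theta> * (norm (f x) / a) + (1 - \<theta>) * (norm (g x) / b))"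
        by (simp only: distrib_left mult.assoc)
      finally have "norm (f x + g x) powr p \<le> ((a + b) * (\<theta> * (norm (f x) / a) + (1 - \<theta>) * (norm (g x) / b))) powr p"
        using p by (intro powr_mono2) auto
      also have "\<dots> = (a + b) powr p * (\<theta> * (norm (f x) / a) + (1 - \<theta>) * (norm (g x) / b)) powr p"
        using ab \<theta> by (intro powr_mult)
      also have "\<dots> \<le> (a + b) powr p * (\<theta> * (norm (f x) / a) powr p + (1 - \<theta>) * (norm (g x) / b) powr p)"
        using ab \<theta> p by (intro mult_left_mono powr_convex_combination) auto
      finally have "ennreal (norm (f x + g x) powr p) \<le> ennreal ((a + b) powr p * (\<theta> * (norm (f x) / a) powr p + (1 - \<theta>) * (norm (g x) / b) powr p))"
        by (rule ennreal_leI)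
      also have "\<dots> = ennreal ((a + b) powr p) * (ennreal \<theta> * ennreal ((norm (f x) / a) powr p) + ennreal (1 - \<theta>) * ennreal ((norm (g x) / b) powr p))"
        using \<theta>(1,2) by (simp add: ennreal_mult)
      finally show "ennreal (norm (f x + g x) powr p) \<le> ennreal ((a + b) powr p) * (ennreal \<theta> * ennreal ((norm (f x) / a) powr p) + ennreal (1 - \<theta>) * ennreal ((norm (g x) / b) powr p))" .
    qed
    also have "\<dots> = ennreal ((a + b) powr p) * (ennreal \<theta> * (\<integral>\<^sup>+x. ennreal ((norm (f x) / a) powr p) \<partial>lborel) + ennreal (1 - \<theta>) * (\<integral>\<^sup>+x. ennreal ((norm (g x) / b) powr p) \<partial>lborel))"
      by (simp add: nn_integral_cmult nn_integral_add)
    also have "\<dots> \<le> ennreal ((a + b) powr p) * (ennreal \<theta> * 1 + ennreal (1 - \<theta>) * 1)"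
      using ab FG by (intro mult_left_mono add_mono unit[OF assms(1) FG(1)] unit[OF assms(2) FG(3)]) auto
    also have "ennreal \<theta> * 1 + ennreal (1 - \<theta>) * 1 = 1" using \<theta> by (simp add: ennreal_plus[symmetric] del: ennreal_plus)
    finally have "(\<integral>\<^sup>+x. ennreal (norm (f x + g x) powr p) \<partial>lborel) \<le> ennreal ((a + b) powr p)" by simp
    then have "Lp_norm p (\<lambda>x. f x + g x) \<le> epowr (ennreal ((a + b) powr p)) (1 / p)"
      unfolding Lp_norm_def using p by (intro epowr_mono) auto
    also have "\<dots> = ennreal (F + G + e)" using ab p by (simp add: epowr_ennreal powr_powr)
    finally show "Lp_norm p (\<lambda>x. f x + g x) \<le> Lp_norm p f + Lp_norm p g + ennreal e"
      using FG e by simp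
  qed
qed (auto simp: Lp_norm_def)

lemma Lp_norm_minus_commute: "Lp_norm p (\<lambda>x. f x - g x) = Lp_norm p (\<lambda>x. g x - f x)"
  by (simp add: Lp_norm_def norm_minus_commute)

lemma fdiff_funpow_diff: "(fdiff h ^^ k) (\<lambda>x. f x - g x) = (\<lambda>x. (fdiff h ^^ k) f x - (fdiff h ^^ k) g x)"
proof (induction k)
  case (Suc k)
  show ?case by (rule ext) (simp only: fdiff_funpow_Suc Suc.IH, simp)
qed simp

lemma frac_laplacian_diff:
  fixes f g :: "'a::euclidean_space \<Rightarrow> complex"
  assumes f: "f \<in> test_functions" and g: "g \<in> test_functions" and s: "0 \<le> s"
  shows "frac_laplacian s (\<lambda>x. f x - g x) = (\<lambda>x. frac_laplacian s f x - frac_laplacian s g x)"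
proof
  fix x :: 'a
  have i: "integrable lborel (\<lambda>x. cis (- (x \<bullet> \<xi>)) * u x)" if "u \<in> test_functions" for u and \<xi> :: 'a
    by (intro integrable_cis_mult test_functions_integrable that) measurable
  have fo: "fourier (\<lambda>x. f x - g x) \<xi> = fourier f \<xi> - fourier g \<xi>" for \<xi>
    unfolding fourier_def using i[OF f] i[OF g] by (simp add: right_diff_distrib)
  have j: "integrable lborel (\<lambda>\<xi>. cis (x \<bullet> \<xi>) * (complex_of_real (norm \<xi> powr (2 * s)) * fourier u \<xi>))" if "u \<in> test_functions" for u
    by (intro integrable_cis_mult integrable_fourier_powr that) (use s in auto)
  show "frac_laplacian s (\<lambda>x. f x - g x) x = frac_laplacian s f x - frac_laplacian s g x"
    unfolding frac_laplacian_def inv_fourier_def fo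
    using j[OF f] j[OF g] by (simp add: right_diff_distrib)
qed

lemma sobolev_norm_minus_commute:
  fixes f g :: "'a::euclidean_space \<Rightarrow> complex"
  assumes f: "f \<in> test_functions" and g: "g \<in> test_functions" and "0 < \<beta>"
  shows "sobolev_norm \<beta> p (\<lambda>x. f x - g x) = sobolev_norm \<beta> p (\<lambda>x. g x - f x)"
proof -
  have "Lp_norm p ((fdiff h ^^ k) (\<lambda>x. f x - g x)) = Lp_norm p ((fdiff h ^^ k) (\<lambda>x. g x - f x))" for h k
    unfolding fdiff_funpow_diff by (rule Lp_norm_minus_commute)
  moreover have "Lp_norm p (frac_laplacian (\<beta> / 2) (\<lambda>x. f x - g x)) = Lp_norm p (frac_laplacian (\<beta> / 2) (\<lambda>x. g x - f x))"
    using assms by (simp add: frac_laplacian_diff Lp_norm_minus_commute[of p "frac_laplacian (\<beta> / 2) f"])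
  ultimately show ?thesis by (simp only: sobolev_norm_def)
qed

lemma frac_laplacian_measurable [measurable]:
  "f \<in> borel_measurable borel \<Longrightarrow> frac_laplacian s f \<in> borel_measurable borel"
proof -
  assume [measurable]: "f \<in> borel_measurable borel"
  show ?thesis unfolding frac_laplacian_def inv_fourier_def[abs_def] by measurable
qed

lemma sobolev_norm_triangle:
  fixes f g :: "'a::euclidean_space \<Rightarrow> complex"
  assumes f: "f \<in> test_functions" and g: "g \<in> test_functions" and \<beta>: "0 < \<beta>" and p: "1 \<le> p"
  shows "sobolev_norm \<beta> p f \<le> sobolev_norm \<beta> p g + sobolev_norm \<beta> p (\<lambda>x. f x - g x)"
proof -
  have [measurable]: "f \<in> borel_measurable borel" "g \<in> borel_measurable borel" using f g by simp_all
  show ?thesis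
  proof (cases "p = 1")
    case True
    define D where "D h u = (\<integral>\<^sup>+x. ennreal (norm ((fdiff h ^^ (1 + nat \<lfloor>\<beta>\<rfloor>)) u x)) \<partial>lborel)" for h and u :: "'a \<Rightarrow> complex"
    have [measurable]: "(\<lambda>h. D h u) \<in> borel_measurable borel" if [measurable]: "u \<in> borel_measurable borel" for u
      unfolding D_def by measurable
    have S: "sobolev_norm \<beta> p u = (\<integral>\<^sup>+h. D h u / ennreal (norm h powr (real DIM('a) + \<beta>)) \<partial>lborel)" for u :: "'a \<Rightarrow> complex"
      by (simp add: sobolev_norm_def True Lp_norm_def D_def)
    have "D h f \<le> D h g + D h (\<lambda>x. f x - g x)" for h
    proof -
      have "D h f \<le> (\<integral>\<^sup>+x. ennreal (norm ((fdiff h ^^ (1 + nat \<lfloor>\<beta>\<rfloor>)) g x)) + ennreal (norm ((fdiff h ^^ (1 + nat \<lfloor>\<beta>\<rfloor>)) (\<lambda>x. f x - g x) x)) \<partial>lborel)"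
        unfolding D_def fdiff_funpow_diff
      proof (rule nn_integral_mono)
        fix x
        show "ennreal (norm ((fdiff h ^^ (1 + nat \<lfloor>\<beta>\<rfloor>)) f x)) \<le> ennreal (norm ((fdiff h ^^ (1 + nat \<lfloor>\<beta>\<rfloor>)) g x)) + ennreal (norm ((fdiff h ^^ (1 + nat \<lfloor>\<beta>\<rfloor>)) f x - (fdiff h ^^ (1 + nat \<lfloor>\<beta>\<rfloor>)) g x))"
          by (subst ennreal_plus[symmetric]) (auto intro!: ennreal_leI norm_triangle_sub simp del: ennreal_plus)
      qed
      also have "\<dots> = D h g + D h (\<lambda>x. f x - g x)" unfolding D_def by (rule nn_integral_add) measurable
      finally show ?thesis .
    qed
    then have "sobolev_norm \<beta> p f \<le> (\<integral>\<^sup>+h. D h g / ennreal (norm h powr (real DIM('a) + \<beta>)) + D h (\<lambda>x. f x - g x) / ennreal (norm h powr (real DIM('a) + \<beta>)) \<partial>lborel)"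
      unfolding S divide_ennreal_def distrib_right[symmetric] by (intro nn_integral_mono mult_right_mono) auto
    also have "\<dots> = sobolev_norm \<beta> p g + sobolev_norm \<beta> p (\<lambda>x. f x - g x)"
      unfolding S by (rule nn_integral_add) measurable
    finally show ?thesis .
  next
    case False
    have "Lp_norm p (\<lambda>x. frac_laplacian (\<beta> / 2) g x + (frac_laplacian (\<beta> / 2) f x - frac_laplacian (\<beta> / 2) g x))
       \<le> Lp_norm p (frac_laplacian (\<beta> / 2) g) + Lp_norm p (\<lambda>x. frac_laplacian (\<beta> / 2) f x - frac_laplacian (\<beta> / 2) g x)"
      by (rule Lp_norm_triangle[OF _ _ p]) measurable
    then show ?thesis using False \<beta> by (simp add: sobolev_norm_def frac_laplacian_diff f g)
  qed
qed

text \<open>Serves as reflexivity of \<open>sobolev_rel\<close>: a sequence belongs to its own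
  class.\<close>

lemma sobolev_norm_zero: "sobolev_norm \<beta> p (\<lambda>_. 0) = 0"
proof -
  have "(fdiff h ^^ k) (\<lambda>_. 0) = (\<lambda>_. 0)" for h :: 'a and k
    using fdiff_funpow_diff[of k h "\<lambda>_. 0" "\<lambda>_. 0"] by simp
  moreover have "frac_laplacian s (\<lambda>_. 0) = (\<lambda>_::'a. 0)" for s
    by (simp add: frac_laplacian_def inv_fourier_def fourier_def fun_eq_iff)
  ultimately show ?thesis by (simp add: sobolev_norm_def Lp_norm_def fdiff_def)
qed

subsection \<open>Elements of the completion as functions\<close>

text \<open>The terms may be \<infinity>, so completeness of the reals does not apply directly. The
  hypothesis gives limsup \<le> liminf + e for every e > 0.\<close>

lemma Cauchy_ennreal_convergent:
  fixes X :: "nat \<Rightarrow> ennreal"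
  assumes X: "\<And>e. 0 < e \<Longrightarrow> \<exists>N. \<forall>j\<ge>N. \<forall>k\<ge>N. X j \<le> X k + ennreal e"
  obtains L where "X \<longlonglongrightarrow> L"
proof -
  have "limsup X \<le> liminf X"
  proof (rule ennreal_le_epsilon)
    fix e :: real assume "0 < e"
    from X[OF this] obtain N where N: "\<And>j k. N \<le> j \<Longrightarrow> N \<le> k \<Longrightarrow> X j \<le> X k + ennreal e" by blast
    have "limsup X \<le> X k + ennreal e" if "N \<le> k" for k
      by (rule Limsup_bounded) (use N that in \<open>auto simp: eventually_sequentially\<close>)
    then have "limsup X - ennreal e \<le> X k" if "N \<le> k" for k
      using that by (metis add.commute ennreal_minus_le_iff ennreal_neq_top)
    then have "limsup X - ennreal e \<le> liminf X"
      by (intro Liminf_bounded) (auto simp: eventually_sequentially)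
    then show "limsup X \<le> liminf X + ennreal e"
      by (metis add.commute ennreal_minus_le_iff ennreal_neq_top)
  qed
  then have "limsup X = liminf X" by (intro antisym Liminf_le_Limsup) auto
  then show ?thesis using that tendsto_Liminf[of sequentially X] by simp
qed

context
  fixes \<beta> p :: real and V :: "(nat \<Rightarrow> 'a::euclidean_space \<Rightarrow> complex) set"
  assumes \<beta>: "0 < \<beta>" and p: "1 \<le> p" and V: "V \<in> sobolev_space \<beta> p"
begin

text \<open>A class is the image of one sequence under \<open>sobolev_rel\<close>; this sequence is
  kept as the reference with which all members are compared.\<close>

lemma sobolev_space_member:
  obtains \<phi> where "\<phi> \<in> V" "\<phi> \<in> sobolev_Cauchy \<beta> p"
    "\<And>\<psi>. \<psi> \<in> V \<Longrightarrow> \<psi> \<in> sobolev_Cauchy \<beta> p"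
    "\<And>\<psi>. \<psi> \<in> V \<Longrightarrow> (\<lambda>k. sobolev_norm \<beta> p (\<lambda>x. \<phi> k x - \<psi> k x)) \<longlonglongrightarrow> 0"
proof -
  from V obtain \<phi> where \<phi>: "\<phi> \<in> sobolev_Cauchy \<beta> p" "V = sobolev_rel \<beta> p `` {\<phi>}"
    by (auto simp: sobolev_space_def quotient_def)
  have "\<phi> \<in> V" using \<phi> by (simp add: sobolev_rel_def sobolev_norm_zero)
  moreover have "\<psi> \<in> sobolev_Cauchy \<beta> p \<and> (\<lambda>k. sobolev_norm \<beta> p (\<lambda>x. \<phi> k x - \<psi> k x)) \<longlonglongrightarrow> 0" if "\<psi> \<in> V" for \<psi>
  proof -
    have "(\<phi>, \<psi>) \<in> sobolev_rel \<beta> p" using that unfolding \<phi>(2) by (rule ImageE) simp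
    then show ?thesis unfolding sobolev_rel_def mem_Collect_eq prod.case by (elim conjE) (rule conjI)
  qed
  ultimately show ?thesis using that[of \<phi>] \<phi>(1) by blast
qed

lemma sobolev_Cauchy_norm_tendsto:
  assumes \<phi>: "\<phi> \<in> (sobolev_Cauchy \<beta> p :: (nat \<Rightarrow> 'a \<Rightarrow> complex) set)"
  obtains L where "(\<lambda>k. sobolev_norm \<beta> p (\<phi> k)) \<longlonglongrightarrow> L"
proof (rule Cauchy_ennreal_convergent)
  fix e :: real assume "0 < e"
  then obtain N where N: "\<And>j k. N \<le> j \<Longrightarrow> N \<le> k \<Longrightarrow> sobolev_norm \<beta> p (\<lambda>x. \<phi> j x - \<phi> k x) < ennreal e"
    using \<phi> by (auto simp: sobolev_Cauchy_def) blast
  have "sobolev_norm \<beta> p (\<phi> j) \<le> sobolev_norm \<beta> p (\<phi> k) + ennreal e" if "N \<le> j" "N \<le> k" for j k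
  proof -
    have "\<phi> j \<in> test_functions" "\<phi> k \<in> test_functions" using \<phi> by (auto simp: sobolev_Cauchy_def)
    from sobolev_norm_triangle[OF this \<beta> p] show ?thesis
      by (rule order_trans) (intro add_left_mono less_imp_le N that)
  qed
  then show "\<exists>N. \<forall>j\<ge>N. \<forall>k\<ge>N. sobolev_norm \<beta> p (\<phi> j) \<le> sobolev_norm \<beta> p (\<phi> k) + ennreal e" by blast
qed (rule that)

text \<open>All members of a class have the same limit of norms, by the triangle inequality in both
  directions. This gives the definite description in \<open>sobolev_space_norm\<close> its
  meaning.\<close>

lemma sobolev_space_norm_tendsto:
  assumes \<psi>: "\<psi> \<in> V"
  shows "(\<lambda>k. sobolev_norm \<beta> p (\<psi> k)) \<longlonglongrightarrow> sobolev_space_norm \<beta> p V"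
proof -
  obtain \<phi> where \<phi>: "\<phi> \<in> V" "\<phi> \<in> sobolev_Cauchy \<beta> p"
    and V1: "\<And>\<psi>. \<psi> \<in> V \<Longrightarrow> \<psi> \<in> sobolev_Cauchy \<beta> p"
    and V2: "\<And>\<psi>. \<psi> \<in> V \<Longrightarrow> (\<lambda>k. sobolev_norm \<beta> p (\<lambda>x. \<phi> k x - \<psi> k x)) \<longlonglongrightarrow> 0"
    using sobolev_space_member by blast
  obtain L where L: "(\<lambda>k. sobolev_norm \<beta> p (\<phi> k)) \<longlonglongrightarrow> L" using sobolev_Cauchy_norm_tendsto[OF \<phi>(2)] by blast
  have lim: "(\<lambda>k. sobolev_norm \<beta> p (\<psi> k)) \<longlonglongrightarrow> L" if \<psi>: "\<psi> \<in> V" for \<psi>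
  proof -
    obtain L' where L': "(\<lambda>k. sobolev_norm \<beta> p (\<psi> k)) \<longlonglongrightarrow> L'" using sobolev_Cauchy_norm_tendsto[OF V1[OF \<psi>]] by blast
    have t: "\<phi> k \<in> test_functions" "\<psi> k \<in> test_functions" for k
      using \<phi>(2) V1[OF \<psi>] by (auto simp: sobolev_Cauchy_def)
    have "(\<lambda>k. sobolev_norm \<beta> p (\<psi> k) + sobolev_norm \<beta> p (\<lambda>x. \<phi> k x - \<psi> k x)) \<longlonglongrightarrow> L' + 0"
      by (intro tendsto_add L' V2 \<psi>)
    then have "L \<le> L' + 0"
      by (rule LIMSEQ_le[OF L]) (use sobolev_norm_triangle[OF t \<beta> p] in auto)
    moreover have "(\<lambda>k. sobolev_norm \<beta> p (\<phi> k) + sobolev_norm \<beta> p (\<lambda>x. \<phi> k x - \<psi> k x)) \<longlonglongrightarrow> L + 0"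
      by (intro tendsto_add L V2 \<psi>)
    then have "L' \<le> L + 0"
      by (rule LIMSEQ_le[OF L'])
         (use sobolev_norm_triangle[OF t(2,1) \<beta> p] sobolev_norm_minus_commute[OF t \<beta>] in auto)
    ultimately show ?thesis using L' by simp
  qed
  have "sobolev_space_norm \<beta> p V = L"
    unfolding sobolev_space_norm_def
  proof (rule the_equality)
    fix L' assume "\<forall>\<phi>\<in>V. (\<lambda>k. sobolev_norm \<beta> p (\<phi> k)) \<longlonglongrightarrow> L'"
    then show "L' = L" using \<phi>(1) L LIMSEQ_unique by blast
  qed (use lim in blast)
  then show ?thesis using lim[OF \<psi>] by simp
qed

end

text \<open>The Gaussian weight turns local convergence into convergence in a single weighted \<open>L\<^sup>1\<close>
  space, into which \<open>L\<^sup>q\<close> embeds.\<close>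

definition wdist :: "('a::euclidean_space \<Rightarrow> complex) \<Rightarrow> ('a \<Rightarrow> complex) \<Rightarrow> ennreal" where
  "wdist f g = (\<integral>\<^sup>+x. ennreal (norm (f x - g x) * exp (- 1 * (norm x)\<^sup>2)) \<partial>lborel)"

lemma wdist_commute: "wdist f g = wdist g f"
  by (simp add: wdist_def norm_minus_commute)

lemma wdist_triangle:
  assumes [measurable]: "f \<in> borel_measurable borel" "g \<in> borel_measurable borel" "h \<in> borel_measurable borel"
  shows "wdist f h \<le> wdist f g + wdist g h"
proof -
  have "wdist f h \<le> (\<integral>\<^sup>+x. ennreal (norm (f x - g x) * exp (- 1 * (norm x)\<^sup>2)) + ennreal (norm (g x - h x) * exp (- 1 * (norm x)\<^sup>2)) \<partial>lborel)"
    unfolding wdist_def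
  proof (rule nn_integral_mono)
    fix x
    have "norm (f x - h x) * exp (- 1 * (norm x)\<^sup>2) \<le> (norm (f x - g x) + norm (g x - h x)) * exp (- 1 * (norm x)\<^sup>2)"
      by (intro mult_right_mono norm_diff_triangle_le[OF order_refl order_refl]) simp
    then show "ennreal (norm (f x - h x) * exp (- 1 * (norm x)\<^sup>2))
      \<le> ennreal (norm (f x - g x) * exp (- 1 * (norm x)\<^sup>2)) + ennreal (norm (g x - h x) * exp (- 1 * (norm x)\<^sup>2))"
      by (subst ennreal_plus[symmetric]) (auto intro!: ennreal_leI simp: distrib_right simp del: ennreal_plus)
  qed
  also have "\<dots> = wdist f g + wdist g h" unfolding wdist_def by (rule nn_integral_add) measurable
  finally show ?thesis .
qed

lemma set_nn_integral_le_wdist: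
  fixes f g :: "'a::euclidean_space \<Rightarrow> complex"
  assumes [measurable]: "f \<in> borel_measurable borel" "g \<in> borel_measurable borel" and K: "K \<subseteq> cball 0 R"
  shows "(\<integral>\<^sup>+x\<in>K. ennreal (norm (f x - g x)) \<partial>lborel) \<le> ennreal (exp (R\<^sup>2)) * wdist f g"
proof -
  have "(\<integral>\<^sup>+x\<in>K. ennreal (norm (f x - g x)) \<partial>lborel) \<le> (\<integral>\<^sup>+x. ennreal (exp (R\<^sup>2)) * ennreal (norm (f x - g x) * exp (- 1 * (norm x)\<^sup>2)) \<partial>lborel)"
  proof (rule nn_integral_mono)
    fix x
    show "ennreal (norm (f x - g x)) * indicator K x \<le> ennreal (exp (R\<^sup>2)) * ennreal (norm (f x - g x) * exp (- 1 * (norm x)\<^sup>2))"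
    proof (cases "x \<in> K")
      case True
      then have "norm x \<le> R" using K by auto
      then have "(norm x)\<^sup>2 \<le> R\<^sup>2" by (intro power_mono) auto
      then have "1 \<le> exp (R\<^sup>2) * exp (- 1 * (norm x)\<^sup>2)" by (simp add: exp_add[symmetric])
      then have "norm (f x - g x) * 1 \<le> norm (f x - g x) * (exp (R\<^sup>2) * exp (- 1 * (norm x)\<^sup>2))"
        by (intro mult_left_mono) auto
      then show ?thesis using True by (simp add: ennreal_mult[symmetric] mult_ac ennreal_leI)
    qed simp
  qed
  also have "\<dots> = ennreal (exp (R\<^sup>2)) * wdist f g" unfolding wdist_def by (rule nn_integral_cmult) measurable
  finally show ?thesis .
qed

text \<open>Hoelder's inequality against a finite Gaussian measure. In the q-th power term the
  weight is bounded by 1, which leaves the unweighted norm; in the other term it supplies the finite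
  mass W.\<close>

lemma wdist_le_Lp_norm:
  assumes q: "1 \<le> q"
  obtains C where "0 < C"
    "\<And>f g. f \<in> borel_measurable borel \<Longrightarrow> g \<in> borel_measurable borel \<Longrightarrow>
      wdist f (g :: 'a::euclidean_space \<Rightarrow> complex) \<le> ennreal C * Lp_norm q (\<lambda>x. f x - g x)"
proof -
  define W where "W = sqrt (pi / 1) ^ DIM('a)"
  have W: "0 < W" by (simp add: W_def)
  have W_int: "(\<integral>\<^sup>+x. ennreal (exp (- 1 * (norm (x::'a))\<^sup>2)) \<partial>lborel) = ennreal W"
    unfolding W_def by (rule nn_integral_gauss) simp
  have "wdist f g \<le> ennreal (W + 1) * Lp_norm q (\<lambda>x. f x - g x)"
    if [measurable]: "f \<in> borel_measurable borel" "g \<in> borel_measurable borel" for f g :: "'a \<Rightarrow> complex"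
    unfolding Lp_norm_def
  proof (rule le_epowr_optimize)
    fix \<tau> :: real assume \<tau>: "0 < \<tau>"
    have "wdist f g \<le> (\<integral>\<^sup>+x. ennreal \<tau> * ennreal (exp (- 1 * (norm x)\<^sup>2)) + ennreal (\<tau> powr (1 - q)) * ennreal (norm (f x - g x) powr q) \<partial>lborel)"
      unfolding wdist_def
    proof (rule nn_integral_mono)
      fix x :: 'a
      let ?e = "ennreal (exp (- 1 * (norm x)\<^sup>2))"
      have "ennreal (norm (f x - g x) * exp (- 1 * (norm x)\<^sup>2)) = ennreal (norm (f x - g x)) * ?e" by (simp add: ennreal_mult)
      also have "\<dots> \<le> (ennreal \<tau> + ennreal (\<tau> powr (1 - q)) * ennreal (norm (f x - g x) powr q)) * ?e"
        using le_split_power[OF \<tau> q, of "ennreal (norm (f x - g x))"] by (intro mult_right_mono) (simp_all add: epowr_ennreal)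
      also have "\<dots> \<le> ennreal \<tau> * ?e + ennreal (\<tau> powr (1 - q)) * ennreal (norm (f x - g x) powr q) * 1"
        unfolding distrib_right by (intro add_left_mono mult_left_mono) auto
      finally show "ennreal (norm (f x - g x) * exp (- 1 * (norm x)\<^sup>2)) \<le> ennreal \<tau> * ?e + ennreal (\<tau> powr (1 - q)) * ennreal (norm (f x - g x) powr q)" by simp
    qed
    also have "\<dots> = ennreal \<tau> * ennreal W + ennreal (\<tau> powr (1 - q)) * (\<integral>\<^sup>+x. ennreal (norm (f x - g x) powr q) \<partial>lborel)"
      unfolding W_int[symmetric] by (subst nn_integral_add) (simp_all add: nn_integral_cmult)
    also have "ennreal \<tau> * ennreal W = ennreal (W * \<tau>)" using W \<tau> by (simp add: ennreal_mult mult.commute)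
    finally show "wdist f g \<le> ennreal (W * \<tau>) + ennreal (1 * \<tau> powr (1 - q)) * (\<integral>\<^sup>+x. ennreal (norm (f x - g x) powr q) \<partial>lborel)"
      by simp
  qed (use W q in auto)
  then show ?thesis using W by (intro that[of "W + 1"]) auto
qed

section \<open>Completeness of the weighted L^1 distance and the function represented by a
  class\<close>

lemma tendsto_0_if_le_ennreal:
  fixes X :: "nat \<Rightarrow> ennreal"
  assumes X: "\<And>e. 0 < e \<Longrightarrow> \<exists>M. \<forall>k\<ge>M. X k \<le> ennreal e"
  shows "X \<longlonglongrightarrow> 0"
proof (rule order_tendstoI)
  fix a :: ennreal assume "0 < a"
  then obtain z where z: "0 < z" "z < a" using dense by blast
  then obtain e where e: "z = ennreal e" "0 < e" by (cases z) auto
  from X[OF e(2)] obtain M where "\<forall>k\<ge>M. X k \<le> ennreal e" by blast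
  then show "\<forall>\<^sub>F k in sequentially. X k < a"
    using z e by (auto simp: eventually_sequentially intro: le_less_trans)
qed simp

lemma tendsto_0_le_ennreal:
  fixes X Y :: "nat \<Rightarrow> ennreal"
  assumes "\<And>k. X k \<le> Y k" "Y \<longlonglongrightarrow> c" "c = 0"
  shows "X \<longlonglongrightarrow> 0"
  using assms by (intro tendsto_sandwich[of "\<lambda>_. 0" X sequentially Y 0]) auto

text \<open>The Riesz-Fischer argument: a subsequence whose steps are at most 2^(-i) converges
  almost everywhere, and Fatou's lemma gives convergence of the whole sequence. The subsequence is
  part of the conclusion because the L^q bound needs pointwise convergence again.\<close>

lemma wdist_complete:
  fixes \<phi> :: "nat \<Rightarrow> 'a::euclidean_space \<Rightarrow> complex"
  assumes meas: "\<And>k. \<phi> k \<in> borel_measurable borel"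
    and cauchy: "\<And>e. 0 < e \<Longrightarrow> \<exists>N. \<forall>j\<ge>N. \<forall>k\<ge>N. wdist (\<phi> j) (\<phi> k) \<le> ennreal e"
  obtains f r where "f \<in> borel_measurable borel" "strict_mono (r :: nat \<Rightarrow> nat)"
    "AE x in lborel. (\<lambda>i. \<phi> (r i) x) \<longlonglongrightarrow> f x" "(\<lambda>k. wdist (\<phi> k) f) \<longlonglongrightarrow> 0"
proof -
  have [measurable]: "\<phi> k \<in> borel_measurable borel" for k by (rule meas)
  have "\<forall>i. \<exists>N. \<forall>j\<ge>N. \<forall>k\<ge>N. wdist (\<phi> j) (\<phi> k) \<le> ennreal ((1 / 2) ^ i)"
    using cauchy by simp
  then obtain N where N: "\<And>i j k. N i \<le> j \<Longrightarrow> N i \<le> k \<Longrightarrow> wdist (\<phi> j) (\<phi> k) \<le> ennreal ((1 / 2) ^ i)"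
    by metis
  \<comment> \<open>The partial sums dominate each \<open>N i\<close>, and the summand i makes the
    sequence strictly increasing even where some \<open>N i\<close> vanish.\<close>
  define r where "r i = (\<Sum>j\<le>i. N j) + i" for i
  have r: "strict_mono r" unfolding r_def by (rule strict_monoI_Suc) simp
  have rN: "N i \<le> r i" for i unfolding r_def using member_le_sum[of i "{..i}" N] by simp
  have step: "wdist (\<phi> (r (Suc i))) (\<phi> (r i)) \<le> ennreal ((1 / 2) ^ i)" for i
    using rN[of i] strict_mono_leD[OF r, of i "Suc i"] by (intro N) auto
  have "(\<integral>\<^sup>+x. (\<Sum>i. ennreal (norm (\<phi> (r (Suc i)) x - \<phi> (r i) x) * exp (- 1 * (norm x)\<^sup>2))) \<partial>lborel)
     = (\<Sum>i. wdist (\<phi> (r (Suc i))) (\<phi> (r i)))"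
    unfolding wdist_def by (rule nn_integral_suminf) measurable
  also have "\<dots> \<le> (\<Sum>i. ennreal ((1 / 2) ^ i))" by (intro suminf_le step) auto
  also have "\<dots> < \<infinity>"
  proof -
    have "(\<Sum>i. ennreal ((1 / 2) ^ i)) = ennreal (\<Sum>i. (1 / 2) ^ i)"
      by (rule suminf_ennreal2) (simp_all add: summable_geometric)
    then show ?thesis by (simp only: ennreal_less_top infinity_ennreal_def)
  qed
  finally have "AE x in lborel. (\<Sum>i. ennreal (norm (\<phi> (r (Suc i)) x - \<phi> (r i) x) * exp (- 1 * (norm x)\<^sup>2))) \<noteq> \<infinity>"
    by (intro nn_integral_PInf_AE) auto
  then have conv: "AE x in lborel. convergent (\<lambda>i. \<phi> (r i) x)"
  proof eventually_elim
    fix x assume fin: "(\<Sum>i. ennreal (norm (\<phi> (r (Suc i)) x - \<phi> (r i) x) * exp (- 1 * (norm x)\<^sup>2))) \<noteq> \<infinity>"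
    have "summable (\<lambda>i. norm (\<phi> (r (Suc i)) x - \<phi> (r i) x) * exp (- 1 * (norm x)\<^sup>2))"
      by (rule summable_suminf_not_top) (use fin in auto)
    then have "summable (\<lambda>i. norm (\<phi> (r (Suc i)) x - \<phi> (r i) x) * exp (- 1 * (norm x)\<^sup>2) * exp ((norm x)\<^sup>2))"
      by (rule summable_mult2)
    then have "summable (\<lambda>i. norm (\<phi> (r (Suc i)) x - \<phi> (r i) x))" by (simp add: mult.assoc exp_add[symmetric])
    then have "summable (\<lambda>i. \<phi> (r (Suc i)) x - \<phi> (r i) x)" by (rule summable_norm_cancel)
    then have "convergent (\<lambda>n. \<Sum>i<n. \<phi> (r (Suc i)) x - \<phi> (r i) x)" by (simp add: summable_iff_convergent)
    then have "convergent (\<lambda>n. \<phi> (r n) x - \<phi> (r 0) x)" unfolding sum_lessThan_telescope[of "\<lambda>i. \<phi> (r i) x"] .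
    from convergent_add[OF this convergent_const[of "\<phi> (r 0) x"]]
    show "convergent (\<lambda>i. \<phi> (r i) x)" by simp
  qed
  define f where "f x = lim (\<lambda>i. \<phi> (r i) x)" for x
  have f[measurable]: "f \<in> borel_measurable borel" unfolding f_def by measurable
  have lim: "AE x in lborel. (\<lambda>i. \<phi> (r i) x) \<longlonglongrightarrow> f x"
    using conv by eventually_elim (simp add: f_def convergent_LIMSEQ_iff)
  have le: "wdist (\<phi> k) f \<le> ennreal e" if e: "0 < e" and N': "\<forall>j\<ge>M. \<forall>k\<ge>M. wdist (\<phi> j) (\<phi> k) \<le> ennreal e" "M \<le> k" for e M k
  proof -
    have "wdist (\<phi> k) f = (\<integral>\<^sup>+x. liminf (\<lambda>i. ennreal (norm (\<phi> k x - \<phi> (r i) x) * exp (- 1 * (norm x)\<^sup>2))) \<partial>lborel)"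
      unfolding wdist_def
    proof (rule nn_integral_cong_AE)
      show "AE x in lborel. ennreal (norm (\<phi> k x - f x) * exp (- 1 * (norm x)\<^sup>2)) = liminf (\<lambda>i. ennreal (norm (\<phi> k x - \<phi> (r i) x) * exp (- 1 * (norm x)\<^sup>2)))"
        using lim
      proof eventually_elim
        fix x assume "(\<lambda>i. \<phi> (r i) x) \<longlonglongrightarrow> f x"
        then have "(\<lambda>i. ennreal (norm (\<phi> k x - \<phi> (r i) x) * exp (- 1 * (norm x)\<^sup>2))) \<longlonglongrightarrow> ennreal (norm (\<phi> k x - f x) * exp (- 1 * (norm x)\<^sup>2))"
          by (intro tendsto_intros tendsto_ennrealI)
        then show "ennreal (norm (\<phi> k x - f x) * exp (- 1 * (norm x)\<^sup>2)) = liminf (\<lambda>i. ennreal (norm (\<phi> k x - \<phi> (r i) x) * exp (- 1 * (norm x)\<^sup>2)))"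
          by (intro lim_imp_Liminf[symmetric]) auto
      qed
    qed
    also have "\<dots> \<le> liminf (\<lambda>i. wdist (\<phi> k) (\<phi> (r i)))"
      unfolding wdist_def by (rule nn_integral_liminf) measurable
    also have "\<dots> \<le> ennreal e"
    proof (rule Liminf_le)
      have "wdist (\<phi> k) (\<phi> (r i)) \<le> ennreal e" if "M \<le> i" for i
        using N' that strict_mono_imp_increasing[OF r, of i] by auto
      then show "\<forall>\<^sub>F i in sequentially. wdist (\<phi> k) (\<phi> (r i)) \<le> ennreal e" by (auto simp: eventually_sequentially)
    qed simp
    finally show ?thesis .
  qed
  have "(\<lambda>k. wdist (\<phi> k) f) \<longlonglongrightarrow> 0"
  proof (rule tendsto_0_if_le_ennreal)
    fix e :: real assume e: "0 < e"
    from cauchy[OF this] obtain M where "\<forall>j\<ge>M. \<forall>k\<ge>M. wdist (\<phi> j) (\<phi> k) \<le> ennreal e" by blast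
    from le[OF e this] show "\<exists>M. \<forall>k\<ge>M. wdist (\<phi> k) f \<le> ennreal e" by blast
  qed
  then show ?thesis using that f r lim by blast
qed

text \<open>Identifies the chosen \<open>sobolev_fun\<close> with the limit that is actually
  constructed. The two are compared on the balls of integer radius, whose countable union is the
  whole space.\<close>

lemma AE_eq_if_local_L1_limits:
  fixes f g :: "'a::euclidean_space \<Rightarrow> complex"
  assumes [measurable]: "f \<in> borel_measurable borel" "g \<in> borel_measurable borel" "\<And>k. \<phi> k \<in> borel_measurable borel"
    and f: "\<And>K. compact K \<Longrightarrow> (\<lambda>k. \<integral>\<^sup>+x\<in>K. ennreal (norm (\<phi> k x - f x)) \<partial>lborel) \<longlonglongrightarrow> 0"
    and g: "\<And>K. compact K \<Longrightarrow> (\<lambda>k. \<integral>\<^sup>+x\<in>K. ennreal (norm (\<phi> k x - g x)) \<partial>lborel) \<longlonglongrightarrow> 0"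
  shows "AE x in lborel. f x = g x"
proof -
  have "AE x in lborel. norm x \<le> real R \<longrightarrow> f x = g x" for R :: nat
  proof -
    define K where "K = cball (0::'a) (real R)"
    have K: "compact K" "K \<in> sets borel" by (auto simp: K_def)
    have [measurable]: "Measurable.pred borel (\<lambda>x. x \<in> K)" using K(2) by measurable
    have "(\<integral>\<^sup>+x\<in>K. ennreal (norm (f x - g x)) \<partial>lborel) \<le> (\<integral>\<^sup>+x\<in>K. ennreal (norm (\<phi> k x - f x)) \<partial>lborel) + (\<integral>\<^sup>+x\<in>K. ennreal (norm (\<phi> k x - g x)) \<partial>lborel)" for k
    proof -
      have "(\<integral>\<^sup>+x\<in>K. ennreal (norm (f x - g x)) \<partial>lborel) \<le> (\<integral>\<^sup>+x. ennreal (norm (\<phi> k x - f x)) * indicator K x + ennreal (norm (\<phi> k x - g x)) * indicator K x \<partial>lborel)"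
      proof (rule nn_integral_mono)
        fix x
        have "norm (f x - g x) \<le> norm (\<phi> k x - f x) + norm (\<phi> k x - g x)"
          using norm_triangle_ineq4[of "\<phi> k x - g x" "\<phi> k x - f x"] by (simp add: add.commute)
        then have "ennreal (norm (f x - g x)) \<le> ennreal (norm (\<phi> k x - f x)) + ennreal (norm (\<phi> k x - g x))"
          by (subst ennreal_plus[symmetric]) (auto intro!: ennreal_leI simp del: ennreal_plus)
        then show "ennreal (norm (f x - g x)) * indicator K x \<le> ennreal (norm (\<phi> k x - f x)) * indicator K x + ennreal (norm (\<phi> k x - g x)) * indicator K x"
          unfolding distrib_right[symmetric] by (intro mult_right_mono) auto
      qed
      also have "\<dots> = (\<integral>\<^sup>+x\<in>K. ennreal (norm (\<phi> k x - f x)) \<partial>lborel) + (\<integral>\<^sup>+x\<in>K. ennreal (norm (\<phi> k x - g x)) \<partial>lborel)"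
        by (rule nn_integral_add) measurable
      finally show ?thesis .
    qed
    then have "(\<integral>\<^sup>+x\<in>K. ennreal (norm (f x - g x)) \<partial>lborel) \<le> 0 + 0"
      by (intro LIMSEQ_le_const[OF tendsto_add[OF f[OF K(1)] g[OF K(1)]]]) auto
    then have "(\<integral>\<^sup>+x\<in>K. ennreal (norm (f x - g x)) \<partial>lborel) = 0" by simp
    then have "AE x in lborel. ennreal (norm (f x - g x)) * indicator K x = 0"
      by (subst (asm) nn_integral_0_iff_AE) auto
    then show ?thesis by eventually_elim (auto simp: K_def indicator_def split: if_splits)
  qed
  then have "AE x in lborel. \<forall>R::nat. norm x \<le> real R \<longrightarrow> f x = g x"
    unfolding AE_all_countable by blast
  then show ?thesis
  proof eventually_elim
    fix x assume *: "\<forall>R::nat. norm x \<le> real R \<longrightarrow> f x = g x"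
    obtain R :: nat where "norm x \<le> real R" using real_arch_simple by blast
    then show "f x = g x" using * by blast
  qed
qed

lemma Lp_norm_cong_AE: "AE x in lborel. f x = g x \<Longrightarrow> Lp_norm q f = Lp_norm q g"
  unfolding Lp_norm_def by (intro arg_cong2[where f = epowr] nn_integral_cong_AE) (auto elim: eventually_mono)

text \<open>The embedding applied to differences shows that a Sobolev-Cauchy sequence is Cauchy for
  \<open>wdist\<close>, and that equivalent sequences have the same limit. The limit represents the
  class, and the embedding applied along an almost everywhere convergent subsequence bounds its L^q
  norm.\<close>

lemma sobolev_fun_bound:
  fixes \<beta> p :: real
  assumes \<beta>: "0 < \<beta>" "\<beta> < real DIM('a::euclidean_space)" and p: "1 \<le> p" "p * \<beta> < real DIM('a)"
  defines "q \<equiv> p * real DIM('a) / (real DIM('a) - p * \<beta>)"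
  obtains C where "0 < C"
    "\<And>V. V \<in> (sobolev_space \<beta> p :: (nat \<Rightarrow> 'a \<Rightarrow> complex) set set) \<Longrightarrow>
      sobolev_fun V \<in> borel_measurable borel \<and> Lp_norm q (sobolev_fun V) \<le> ennreal C * sobolev_space_norm \<beta> p V"
proof -
  have q: "1 \<le> q"
  proof -
    have "real DIM('a) - p * \<beta> \<le> real DIM('a)" using \<beta> p by simp
    also have "\<dots> \<le> p * real DIM('a)" using p by simp
    finally show ?thesis using p unfolding q_def by (simp add: le_divide_eq)
  qed
  obtain C where C: "0 < C" "\<And>f. f \<in> (test_functions :: ('a \<Rightarrow> complex) set) \<Longrightarrow> Lp_norm q f \<le> ennreal C * sobolev_norm \<beta> p f"
    using sobolev_embedding[OF \<beta> p] unfolding q_def by blast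
  obtain D where D: "0 < D" "\<And>f g. f \<in> borel_measurable borel \<Longrightarrow> g \<in> borel_measurable borel \<Longrightarrow>
      wdist f (g :: 'a \<Rightarrow> complex) \<le> ennreal D * Lp_norm q (\<lambda>x. f x - g x)"
    using wdist_le_Lp_norm[OF q] by blast
  have wd: "wdist f g \<le> ennreal (D * C) * sobolev_norm \<beta> p (\<lambda>x. f x - g x)"
    if "f \<in> test_functions" "g \<in> test_functions" for f g :: "'a \<Rightarrow> complex"
  proof -
    have "wdist f g \<le> ennreal D * Lp_norm q (\<lambda>x. f x - g x)" using that by (intro D(2)) auto
    also have "\<dots> \<le> ennreal D * (ennreal C * sobolev_norm \<beta> p (\<lambda>x. f x - g x))"
      by (intro mult_left_mono C(2) test_functions_diff that) auto
    finally show ?thesis using C(1) D(1) by (simp add: ennreal_mult mult.assoc)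
  qed
  have "sobolev_fun V \<in> borel_measurable borel \<and> Lp_norm q (sobolev_fun V) \<le> ennreal C * sobolev_space_norm \<beta> p V"
    if V: "V \<in> sobolev_space \<beta> p" for V :: "(nat \<Rightarrow> 'a \<Rightarrow> complex) set"
  proof -
    obtain \<phi> where \<phi>: "\<phi> \<in> V" "\<phi> \<in> sobolev_Cauchy \<beta> p"
      and V1: "\<And>\<psi>. \<psi> \<in> V \<Longrightarrow> \<psi> \<in> sobolev_Cauchy \<beta> p"
      and V2: "\<And>\<psi>. \<psi> \<in> V \<Longrightarrow> (\<lambda>k. sobolev_norm \<beta> p (\<lambda>x. \<phi> k x - \<psi> k x)) \<longlonglongrightarrow> 0"
      using sobolev_space_member[OF \<beta>(1) p(1) V] by blast
    have test: "\<psi> k \<in> test_functions" if "\<psi> \<in> V" for \<psi> k using V1[OF that] by (simp add: sobolev_Cauchy_def)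
    have meas: "\<psi> k \<in> borel_measurable borel" if "\<psi> \<in> V" for \<psi> k using test[OF that] by simp
    have cauchy: "\<exists>N. \<forall>j\<ge>N. \<forall>k\<ge>N. wdist (\<phi> j) (\<phi> k) \<le> ennreal e" if e: "0 < e" for e
    proof -
      have "0 < e / (D * C)" using e C(1) D(1) by simp
      then obtain N where N: "\<And>j k. N \<le> j \<Longrightarrow> N \<le> k \<Longrightarrow> sobolev_norm \<beta> p (\<lambda>x. \<phi> j x - \<phi> k x) < ennreal (e / (D * C))"
        using \<phi>(2) unfolding sobolev_Cauchy_def by blast
      have "wdist (\<phi> j) (\<phi> k) \<le> ennreal e" if "N \<le> j" "N \<le> k" for j k
      proof -
        have "wdist (\<phi> j) (\<phi> k) \<le> ennreal (D * C) * sobolev_norm \<beta> p (\<lambda>x. \<phi> j x - \<phi> k x)"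
          by (intro wd test \<phi>(1))
        also have "\<dots> \<le> ennreal (D * C) * ennreal (e / (D * C))"
          by (rule mult_left_mono[OF less_imp_le[OF N[OF that]]]) simp
        also have "\<dots> = ennreal e" using C(1) D(1) e by (simp add: ennreal_mult[symmetric])
        finally show ?thesis .
      qed
      then show ?thesis by blast
    qed
    obtain f r where f[measurable]: "f \<in> borel_measurable borel" and r: "strict_mono (r :: nat \<Rightarrow> nat)"
      and lim: "AE x in lborel. (\<lambda>i. \<phi> (r i) x) \<longlonglongrightarrow> f x" and wlim: "(\<lambda>k. wdist (\<phi> k) f) \<longlonglongrightarrow> 0"
      using wdist_complete[OF meas[OF \<phi>(1)] cauchy] by blast
    have loc: "(\<lambda>k. \<integral>\<^sup>+x\<in>K. ennreal (norm (\<psi> k x - f x)) \<partial>lborel) \<longlonglongrightarrow> 0" if \<psi>: "\<psi> \<in> V" and K: "compact K" for \<psi> K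
    proof -
      obtain R where "\<forall>x\<in>K. norm x \<le> R" using compact_imp_bounded[OF K] unfolding bounded_iff by blast
      then have R: "K \<subseteq> cball 0 R" by auto
      have "(\<integral>\<^sup>+x\<in>K. ennreal (norm (\<psi> k x - f x)) \<partial>lborel) \<le> ennreal (exp (R\<^sup>2)) * (ennreal (D * C) * sobolev_norm \<beta> p (\<lambda>x. \<phi> k x - \<psi> k x) + wdist (\<phi> k) f)" for k
      proof -
        have "(\<integral>\<^sup>+x\<in>K. ennreal (norm (\<psi> k x - f x)) \<partial>lborel) \<le> ennreal (exp (R\<^sup>2)) * wdist (\<psi> k) f"
          by (rule set_nn_integral_le_wdist[OF meas[OF \<psi>] f R])
        also have "\<dots> \<le> ennreal (exp (R\<^sup>2)) * (wdist (\<phi> k) (\<psi> k) + wdist (\<phi> k) f)"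
          using wdist_triangle[OF meas[OF \<psi>] meas[OF \<phi>(1)] f, of k k] by (intro mult_left_mono) (simp_all add: wdist_commute)
        also have "\<dots> \<le> ennreal (exp (R\<^sup>2)) * (ennreal (D * C) * sobolev_norm \<beta> p (\<lambda>x. \<phi> k x - \<psi> k x) + wdist (\<phi> k) f)"
          by (intro mult_left_mono add_right_mono wd test \<phi>(1) \<psi>) simp
        finally show ?thesis .
      qed
      moreover have "(\<lambda>k. ennreal (exp (R\<^sup>2)) * (ennreal (D * C) * sobolev_norm \<beta> p (\<lambda>x. \<phi> k x - \<psi> k x) + wdist (\<phi> k) f)) \<longlonglongrightarrow> ennreal (exp (R\<^sup>2)) * (ennreal (D * C) * 0 + 0)"
        by (intro ennreal_tendsto_cmult tendsto_add V2 \<psi> wlim) auto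
      ultimately show ?thesis
        by (rule tendsto_0_le_ennreal) simp
    qed
    have "represents f V"
      unfolding represents_def
    proof (intro conjI allI impI ballI f loc)
      fix K :: "'a set" assume K: "compact K"
      have [measurable]: "K \<in> sets borel" using K by (simp add: borel_compact)
      \<comment> \<open>The limit is integrable on K as the difference of a test function and a
        remainder whose integral over K is below 1 for a suitable index.\<close>
      from loc[OF \<phi>(1) K] have "\<forall>\<^sub>F k in sequentially. (\<integral>\<^sup>+x\<in>K. ennreal (norm (\<phi> k x - f x)) \<partial>lborel) < 1"
        by (rule order_tendstoD) simp
      then obtain k where k: "(\<integral>\<^sup>+x\<in>K. ennreal (norm (\<phi> k x - f x)) \<partial>lborel) < 1"
        by (auto simp: eventually_sequentially)
      have [measurable]: "\<phi> k \<in> borel_measurable borel" by (rule meas[OF \<phi>(1)])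
      have "integrable lborel (\<lambda>x. indicator K x *\<^sub>R (\<phi> k x - f x))"
      proof (rule integrableI_bounded)
        have "(\<integral>\<^sup>+x. ennreal (norm (indicator K x *\<^sub>R (\<phi> k x - f x))) \<partial>lborel) = (\<integral>\<^sup>+x\<in>K. ennreal (norm (\<phi> k x - f x)) \<partial>lborel)"
          by (intro nn_integral_cong) (auto simp: indicator_def)
        then show "(\<integral>\<^sup>+x. ennreal (norm (indicator K x *\<^sub>R (\<phi> k x - f x))) \<partial>lborel) < \<infinity>"
          using k by (simp add: less_trans[OF _ ennreal_one_less_top])
      qed measurable
      moreover have "integrable lborel (\<lambda>x. indicator K x *\<^sub>R \<phi> k x)"
        by (intro integrable_mult_indicator test_functions_integrable test \<phi>(1)) simp
      ultimately have "integrable lborel (\<lambda>x. indicator K x *\<^sub>R \<phi> k x - indicator K x *\<^sub>R (\<phi> k x - f x))"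
        by (intro Bochner_Integration.integrable_diff)
      then show "set_integrable lborel K f" unfolding set_integrable_def by (simp add: scaleR_diff_right)
    qed
    then have rep: "represents (sobolev_fun V) V" unfolding sobolev_fun_def by (rule someI[of "\<lambda>f. represents f V"])
    then have meas_V: "sobolev_fun V \<in> borel_measurable borel" by (simp add: represents_def)
    \<comment> \<open>The choice may differ from f, but both are local L^1 limits of the same
      sequence, so the L^q norm is that of f.\<close>
    have "AE x in lborel. sobolev_fun V x = f x"
      by (rule AE_eq_if_local_L1_limits[OF meas_V f meas[OF \<phi>(1)]])
         (use rep \<phi>(1) loc in \<open>auto simp: represents_def\<close>)
    then have "Lp_norm q (sobolev_fun V) = Lp_norm q f" by (rule Lp_norm_cong_AE)
    also have "Lp_norm q f \<le> ennreal C * sobolev_space_norm \<beta> p V"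
    proof -
      have [measurable]: "\<phi> k \<in> borel_measurable borel" for k by (rule meas[OF \<phi>(1)])
      have "(\<integral>\<^sup>+x. ennreal (norm (f x) powr q) \<partial>lborel) = (\<integral>\<^sup>+x. liminf (\<lambda>i. ennreal (norm (\<phi> (r i) x) powr q)) \<partial>lborel)"
      proof (rule nn_integral_cong_AE)
        show "AE x in lborel. ennreal (norm (f x) powr q) = liminf (\<lambda>i. ennreal (norm (\<phi> (r i) x) powr q))"
          using lim
        proof eventually_elim
          fix x assume "(\<lambda>i. \<phi> (r i) x) \<longlonglongrightarrow> f x"
          then have "(\<lambda>i. ennreal (norm (\<phi> (r i) x) powr q)) \<longlonglongrightarrow> ennreal (norm (f x) powr q)"
            using q by (intro tendsto_ennrealI tendsto_powr' tendsto_norm tendsto_const) auto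
          then show "ennreal (norm (f x) powr q) = liminf (\<lambda>i. ennreal (norm (\<phi> (r i) x) powr q))"
            by (intro lim_imp_Liminf[symmetric]) auto
        qed
      qed
      also have "\<dots> \<le> liminf (\<lambda>i. \<integral>\<^sup>+x. ennreal (norm (\<phi> (r i) x) powr q) \<partial>lborel)"
        by (rule nn_integral_liminf) measurable
      finally have le: "(\<integral>\<^sup>+x. ennreal (norm (f x) powr q) \<partial>lborel) \<le> liminf (\<lambda>i. \<integral>\<^sup>+x. ennreal (norm (\<phi> (r i) x) powr q) \<partial>lborel)" .
      define L where "L = sobolev_space_norm \<beta> p V"
      have L: "(\<lambda>i. sobolev_norm \<beta> p (\<phi> (r i))) \<longlonglongrightarrow> L"
        using LIMSEQ_subseq_LIMSEQ[OF sobolev_space_norm_tendsto[OF \<beta>(1) p(1) V \<phi>(1)] r] by (simp add: L_def o_def)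
      show ?thesis
      proof (cases "L = top")
        case True
        then show ?thesis using C(1) by (simp add: L_def[symmetric] ennreal_mult_top)
      next
        case False
        have "Lp_norm q f \<le> ennreal C * (L + ennreal e)" if e: "0 < e" for e
        proof -
          \<comment> \<open>The margin e provides a strict inequality, so the norms along the
            subsequence eventually lie below L + e, also when L = 0.\<close>
          have "L < L + ennreal e" using False e by (cases L) (auto simp: ennreal_plus[symmetric] ennreal_less_iff simp del: ennreal_plus)
          from order_tendstoD(2)[OF L this]
          have "\<forall>\<^sub>F i in sequentially. (\<integral>\<^sup>+x. ennreal (norm (\<phi> (r i) x) powr q) \<partial>lborel) \<le> epowr (ennreal C * (L + ennreal e)) q"
          proof eventually_elim
            fix i assume "sobolev_norm \<beta> p (\<phi> (r i)) < L + ennreal e"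
            then have "Lp_norm q (\<phi> (r i)) \<le> ennreal C * (L + ennreal e)"
              using C(2)[OF test[OF \<phi>(1), of "r i"]] by (meson less_imp_le mult_left_mono order_trans zero_le)
            from epowr_mono[OF this, of q] show "(\<integral>\<^sup>+x. ennreal (norm (\<phi> (r i) x) powr q) \<partial>lborel) \<le> epowr (ennreal C * (L + ennreal e)) q"
              using q by (simp add: Lp_norm_def epowr_epowr)
          qed
          then have "liminf (\<lambda>i. \<integral>\<^sup>+x. ennreal (norm (\<phi> (r i) x) powr q) \<partial>lborel) \<le> epowr (ennreal C * (L + ennreal e)) q"
            by (intro Liminf_le) auto
          then have "(\<integral>\<^sup>+x. ennreal (norm (f x) powr q) \<partial>lborel) \<le> epowr (ennreal C * (L + ennreal e)) q" using le by (rule order_trans[rotated])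
          from epowr_mono[OF this, of "1 / q"] show ?thesis using q by (simp add: Lp_norm_def epowr_epowr)
        qed
        note bound = this
        have "Lp_norm q f \<le> ennreal C * L"
        proof (rule ennreal_le_epsilon)
          fix e :: real assume e: "0 < e"
          have "Lp_norm q f \<le> ennreal C * (L + ennreal (e / C))" using e C(1) by (intro bound) simp
          also have "\<dots> = ennreal C * L + ennreal e" using e C(1) by (simp add: distrib_left ennreal_mult[symmetric])
          finally show "Lp_norm q f \<le> ennreal C * L + ennreal e" .
        qed
        then show ?thesis by (simp add: L_def)
      qed
    qed
    finally show ?thesis using meas_V by simp
  qed
  then show ?thesis using that C(1) by blast
qed

text \<open>The modulus of the semigroup is dominated pointwise by averages of |v_0|. Both claims
  are the bounds for these averages in terms of the L^q norm of v_0, combined with the bound of that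
  norm by the norm of the class.\<close>

theorem corollary1p14:
  fixes \<alpha> \<beta> p \<gamma> n :: real
  assumes n: "n = real DIM('a::euclidean_space)"
    and \<alpha>: "0 < \<alpha>" "\<alpha> \<le> 1"
    and \<beta>: "0 < \<beta>" "\<beta> < n"
    and p: "1 \<le> p" "p < n / \<beta>"
    and p1: "p = 1 \<Longrightarrow> \<beta> \<notin> \<nat>"
    and \<gamma>: "-1 < \<gamma>"
  shows
    "(\<exists>C>0. \<forall>V \<in> (sobolev_space \<beta> p :: (nat \<Rightarrow> 'a \<Rightarrow> complex) set set).
        let v = (\<lambda>t. heat_semigroup \<alpha> t (sobolev_fun V)) in
        epowr (\<integral>\<^sup>+z\<in>{0<..} \<times> (UNIV :: 'a set).
                 ennreal (norm (v (fst z powr (2 * \<alpha>)) (snd z)) powr (p * (1 + n + \<gamma>) / (n - p * \<beta>))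
                          * fst z powr \<gamma>) \<partial>lborel)
              ((n - p * \<beta>) / (p * (1 + n + \<gamma>)))
          \<le> ennreal C * sobolev_space_norm \<beta> p V) \<and>
     (\<exists>C>0. \<forall>V \<in> (sobolev_space \<beta> p :: (nat \<Rightarrow> 'a \<Rightarrow> complex) set set).
        let v = (\<lambda>t. heat_semigroup \<alpha> t (sobolev_fun V)) in
        (SUP t\<in>{0<..}.
           epowr (\<integral>\<^sup>+x. ennreal (norm (v (t powr (2 * \<alpha>)) x) powr (p * n / (n - p * \<beta>))) \<partial>lborel)
                 ((n - p * \<beta>) / (p * n)))
          \<le> ennreal C * sobolev_space_norm \<beta> p V)"
proof -
  have p\<beta>: "p * \<beta> < n" using p \<beta> by (simp add: less_divide_eq)
  have n0: "0 < n" by (simp add: n)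
  define q where "q = p * n / (n - p * \<beta>)"
  define r where "r = p * (1 + n + \<gamma>) / (n - p * \<beta>)"
  have q1: "1 < q"
  proof -
    have "n - p * \<beta> < n" using p \<beta> by simp
    also have "n \<le> p * n" using p n0 by simp
    finally show ?thesis using p\<beta> by (simp add: q_def less_divide_eq)
  qed
  \<comment> \<open>The quotient r/q is (1+n+\<gamma>)/n, the exponent of the weak type estimate, so
    the space-time exponent of the claim is exactly the one that interpolation delivers.\<close>
  have r_eq: "r = q * (1 + real DIM('a) + \<gamma>) / real DIM('a)"
    using n0 unfolding q_def r_def n[symmetric] by simp
  have r0: "0 < r" using p p\<beta> n0 \<gamma> by (simp add: r_def)
  have inv_q: "(n - p * \<beta>) / (p * n) = 1 / q" and inv_r: "(n - p * \<beta>) / (p * (1 + n + \<gamma>)) = 1 / r"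
    by (simp_all add: q_def r_def)
  obtain A B where ker: "bounded_kernel (\<lambda>x::'a. norm (heat_kernel \<alpha> 1 x)) A B"
    using heat_kernel_bounded_kernel[OF \<alpha>] by blast
  interpret bounded_kernel "\<lambda>x::'a. norm (heat_kernel \<alpha> 1 x)" A B by (rule ker)
  obtain C where C: "0 < C" "\<And>V. V \<in> (sobolev_space \<beta> p :: (nat \<Rightarrow> 'a \<Rightarrow> complex) set set) \<Longrightarrow>
      sobolev_fun V \<in> borel_measurable borel \<and> Lp_norm q (sobolev_fun V) \<le> ennreal C * sobolev_space_norm \<beta> p V"
    using sobolev_fun_bound[of \<beta> p, where 'a='a] \<beta> p p\<beta> unfolding q_def n by blast
  obtain D where D: "0 < D" "\<And>g. g \<in> borel_measurable borel \<Longrightarrow>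
      (\<integral>\<^sup>+t. ennreal (t powr \<gamma>) * indicator {0<..} t * (\<integral>\<^sup>+x. epowr (avg t g x) r \<partial>lborel) \<partial>lborel)
      \<le> ennreal D * epowr (\<integral>\<^sup>+y. epowr (g y) q \<partial>lborel) (r / q)"
    using avg_mixed_norm_bound[OF q1 \<gamma> r_eq] by blast
  \<comment> \<open>Tonelli's theorem turns the integral over the half space into the iterated one
    of the mixed norm bound. The outer power 1/r reduces the exponent r/q there to 1/q, which gives
    the L^q norm of v_0.\<close>
  have a: "epowr (\<integral>\<^sup>+z\<in>{0<..} \<times> (UNIV :: 'a set).
                 ennreal (norm (heat_semigroup \<alpha> (fst z powr (2 * \<alpha>)) (sobolev_fun V) (snd z)) powr r * fst z powr \<gamma>) \<partial>lborel) (1 / r)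
      \<le> ennreal (D powr (1 / r) * C) * sobolev_space_norm \<beta> p V"
    if V: "V \<in> sobolev_space \<beta> p" for V :: "(nat \<Rightarrow> 'a \<Rightarrow> complex) set"
  proof -
    define f where "f = sobolev_fun V"
    have f[measurable]: "f \<in> borel_measurable borel" using C(2)[OF V] by (simp add: f_def)
    define g where "g y = ennreal (norm (f y))" for y
    have g[measurable]: "g \<in> borel_measurable borel" unfolding g_def by measurable
    define F where "F = (\<lambda>(t, x). ennreal (t powr \<gamma>) * indicator {0<..} t * epowr (avg t g x) r)"
    have F[measurable]: "F \<in> borel_measurable (lborel \<Otimes>\<^sub>M lborel)" unfolding F_def by measurable
    have "(\<integral>\<^sup>+z\<in>{0<..} \<times> (UNIV :: 'a set).
                 ennreal (norm (heat_semigroup \<alpha> (fst z powr (2 * \<alpha>)) f (snd z)) powr r * fst z powr \<gamma>) \<partial>lborel)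
      \<le> (\<integral>\<^sup>+z. F z \<partial>lborel)"
    proof (rule nn_integral_mono)
      fix z :: "real \<times> 'a"
      obtain t x where z: "z = (t, x)" by (cases z)
      show "ennreal (norm (heat_semigroup \<alpha> (fst z powr (2 * \<alpha>)) f (snd z)) powr r * fst z powr \<gamma>) * indicator ({0<..} \<times> UNIV) z \<le> F z"
      proof (cases "0 < t")
        case True
        have "ennreal (norm (heat_semigroup \<alpha> (t powr (2 * \<alpha>)) f x) powr r) \<le> epowr (avg t g x) r"
          using epowr_mono[OF norm_heat_semigroup_le[OF ker True, of f x], of r] r0
          by (simp add: epowr_ennreal g_def[abs_def])
        from mult_left_mono[OF this, of "ennreal (t powr \<gamma>)"] show ?thesis
          using True by (simp add: z F_def ennreal_mult mult.commute)
      qed (simp add: z)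
    qed
    also have "\<dots> = (\<integral>\<^sup>+t. (\<integral>\<^sup>+x. F (t, x) \<partial>lborel) \<partial>lborel)"
      unfolding lborel_prod[symmetric] by (rule lborel.nn_integral_fst[symmetric, OF F])
    also have "\<dots> = (\<integral>\<^sup>+t. ennreal (t powr \<gamma>) * indicator {0<..} t * (\<integral>\<^sup>+x. epowr (avg t g x) r \<partial>lborel) \<partial>lborel)"
      unfolding F_def prod.case by (intro nn_integral_cong nn_integral_cmult) measurable
    also have "\<dots> \<le> ennreal D * epowr (\<integral>\<^sup>+y. epowr (g y) q \<partial>lborel) (r / q)" by (rule D(2)[OF g])
    finally have "epowr (\<integral>\<^sup>+z\<in>{0<..} \<times> (UNIV :: 'a set).
                 ennreal (norm (heat_semigroup \<alpha> (fst z powr (2 * \<alpha>)) f (snd z)) powr r * fst z powr \<gamma>) \<partial>lborel) (1 / r)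
        \<le> epowr (ennreal D * epowr (\<integral>\<^sup>+y. epowr (g y) q \<partial>lborel) (r / q)) (1 / r)"
      using r0 by (intro epowr_mono) auto
    also have "\<dots> = ennreal (D powr (1 / r)) * Lp_norm q f"
      using D(1) r0 by (simp add: epowr_mult epowr_ennreal epowr_epowr Lp_norm_def g_def)
    also have "\<dots> \<le> ennreal (D powr (1 / r)) * (ennreal C * sobolev_space_norm \<beta> p V)"
      using C(2)[OF V] by (intro mult_left_mono) (auto simp: f_def)
    finally show ?thesis using C(1) by (simp add: f_def ennreal_mult mult.assoc)
  qed
  \<comment> \<open>The constant is free of t, and the supremum inherits the bound.\<close>
  have b: "epowr (\<integral>\<^sup>+x. ennreal (norm (heat_semigroup \<alpha> (t powr (2 * \<alpha>)) (sobolev_fun V) x) powr q) \<partial>lborel) (1 / q)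
      \<le> ennreal (((A + 1) powr q * A) powr (1 / q) * C) * sobolev_space_norm \<beta> p V"
    if V: "V \<in> sobolev_space \<beta> p" and t: "0 < t" for V :: "(nat \<Rightarrow> 'a \<Rightarrow> complex) set" and t
  proof -
    define f where "f = sobolev_fun V"
    have f[measurable]: "f \<in> borel_measurable borel" using C(2)[OF V] by (simp add: f_def)
    define g where "g y = ennreal (norm (f y))" for y
    have g[measurable]: "g \<in> borel_measurable borel" unfolding g_def by measurable
    have "(\<integral>\<^sup>+x. ennreal (norm (heat_semigroup \<alpha> (t powr (2 * \<alpha>)) f x) powr q) \<partial>lborel) \<le> (\<integral>\<^sup>+x. epowr (avg t g x) q \<partial>lborel)"
    proof (rule nn_integral_mono)
      fix x
      show "ennreal (norm (heat_semigroup \<alpha> (t powr (2 * \<alpha>)) f x) powr q) \<le> epowr (avg t g x) q"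
        using epowr_mono[OF norm_heat_semigroup_le[OF ker t, of f x], of q] q1
        by (simp add: epowr_ennreal g_def[abs_def])
    qed
    also have "\<dots> \<le> ennreal ((A + 1) powr q * A) * (\<integral>\<^sup>+y. epowr (g y) q \<partial>lborel)"
      using t q1 by (intro nn_integral_epowr_avg) auto
    finally have "epowr (\<integral>\<^sup>+x. ennreal (norm (heat_semigroup \<alpha> (t powr (2 * \<alpha>)) f x) powr q) \<partial>lborel) (1 / q)
      \<le> epowr (ennreal ((A + 1) powr q * A) * (\<integral>\<^sup>+y. epowr (g y) q \<partial>lborel)) (1 / q)"
      using q1 by (intro epowr_mono) auto
    also have "\<dots> = ennreal (((A + 1) powr q * A) powr (1 / q)) * Lp_norm q f"
      using A_pos by (simp add: epowr_mult epowr_ennreal Lp_norm_def g_def del: ennreal_plus)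
    also have "\<dots> \<le> ennreal (((A + 1) powr q * A) powr (1 / q)) * (ennreal C * sobolev_space_norm \<beta> p V)"
      using C(2)[OF V] by (intro mult_left_mono) (auto simp: f_def)
    finally show ?thesis using C(1) by (simp add: f_def ennreal_mult mult.assoc)
  qed
  have "0 < D powr (1 / r) * C" "0 < ((A + 1) powr q * A) powr (1 / q) * C"
    using C(1) D(1) A_pos by auto
  then show ?thesis
    unfolding Let_def inv_q inv_r q_def[symmetric] r_def[symmetric]
    using a b by (intro conjI exI[of _ "D powr (1 / r) * C"] exI[of _ "((A + 1) powr q * A) powr (1 / q) * C"] ballI SUP_least) auto
qed

end
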